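(* Fix $d\in\mathbb{Z}_{>0}$ and $\delta>0$. There is $\varepsilon=\varepsilon(d,\delta)>0$ such that for all sufficiently large $z$, for all primes $p\le z$ with the exception of at most $z^{\delta}$ of them, the following holds: for every polynomial $f(x,y)\in\mathbb{F}_p[x,y]$ of degree at most $d$ that is not divisible by any polynomial of the form $\rho x^{a}y^{b}-1$ or $\rho y^{b}-x^{a}$ with $\rho\in\overline{\mathbb{F}}_p$ and integers $a,b$, all solutions $(x,y)\in(\overline{\mathbb{F}}_p^* )^2$ of $f(x,y)=0$ satisfy $$\mathrm{ord}(x)+\mathrm{ord}(y)\ge p^{\varepsilon},$$ except for at most $11d^3+d$ of them.
   Context: For $x\in\overline{\mathbb{F}}_p^*$, $\mathrm{ord}(x)$ denotes its multiplicative order. *)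

theory Defs
  imports Complex_Main "HOL-Number_Theory.Residues" "HOL-Algebra.UnivPoly"
    "HOL-Algebra.Algebraic_Closure"
begin

definition Fp :: "nat \<Rightarrow> int ring"
  where "Fp p = residue_ring (int p)"

definition Fp_bar :: "nat \<Rightarrow> ((int list \<times> nat) multiset \<Rightarrow> int) ring"
  where "Fp_bar p = field.alg_closure (Fp p)"

definition Fp_incl :: "nat \<Rightarrow> int \<Rightarrow> ((int list \<times> nat) multiset \<Rightarrow> int)"
  where "Fp_incl p = ring.indexed_const (Fp p)"

lemma field_Fp: "Factorial_Ring.prime p \<Longrightarrow> field (Fp p)"
  unfolding Fp_def by (rule residues_prime.is_field) (simp add: residues_prime_def)

lemma algebraic_closure_Fp_bar:
  assumes "Factorial_Ring.prime p"
  shows "algebraic_closure (Fp_bar p) (Fp_incl p ` carrier (Fp p))"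
    and "Fp_incl p \<in> ring_hom (Fp p) (Fp_bar p)"
  using field.alg_closureE[OF field_Fp[OF assms]] unfolding Fp_bar_def Fp_incl_def by simp_all

text \<open>
  Bivariate polynomials over \<open>R\<close> are polynomials in \<open>y\<close> whose coefficients are polynomials
  in \<open>x\<close>, i.e. elements of \<open>R[x][y]\<close>.
\<close>

abbreviation UP2 :: "('a, 'm) ring_scheme \<Rightarrow> (nat \<Rightarrow> 'a, nat \<Rightarrow> nat \<Rightarrow> 'a) up_ring"
  where "UP2 R \<equiv> UP (UP R)"

text \<open>The coefficient of \<open>x^i y^j\<close>.\<close>

definition coeff2 :: "('a, 'm) ring_scheme \<Rightarrow> (nat \<Rightarrow> nat \<Rightarrow> 'a) \<Rightarrow> nat \<Rightarrow> nat \<Rightarrow> 'a"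
  where "coeff2 R f i j = coeff (UP R) (coeff (UP2 R) f j) i"

text \<open>
  The total degree. As for the library's univariate \<^const>\<open>deg\<close>, the zero polynomial gets
  degree 0.
\<close>

definition total_degree :: "('a, 'm) ring_scheme \<Rightarrow> (nat \<Rightarrow> nat \<Rightarrow> 'a) \<Rightarrow> nat"
  where "total_degree R f = (LEAST n. \<forall>i j. n < i + j \<longrightarrow> coeff2 R f i j = \<zero>\<^bsub>R\<^esub>)"

text \<open>The monomial \<open>c x^a y^b\<close>.\<close>

definition monom2 :: "('a, 'm) ring_scheme \<Rightarrow> 'a \<Rightarrow> nat \<Rightarrow> nat \<Rightarrow> (nat \<Rightarrow> nat \<Rightarrow> 'a)"
  where "monom2 R c a b = monom (UP2 R) (monom (UP R) c a) b"

definition eval2 :: "('a, 'm) ring_scheme \<Rightarrow> (nat \<Rightarrow> nat \<Rightarrow> 'a) \<Rightarrow> 'a \<Rightarrow> 'a \<Rightarrow> 'a"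
  where "eval2 R f x y = eval (UP R) R (eval R R id x) y f"

text \<open>The image in \<open>S[x][y]\<close> of a polynomial over \<open>R\<close> under a homomorphism \<open>h\<close> from \<open>R\<close> to \<open>S\<close>.\<close>

definition base_change :: "('a, 'm) ring_scheme \<Rightarrow> ('a \<Rightarrow> 'b) \<Rightarrow> (nat \<Rightarrow> nat \<Rightarrow> 'a) \<Rightarrow> (nat \<Rightarrow> nat \<Rightarrow> 'b)"
  where "base_change R h f = (\<lambda>j i. h (coeff2 R f i j))"

text \<open>
  The polynomials \<open>\<rho> x^a y^b - 1\<close> and \<open>\<rho> y^b - x^a\<close>. The exponents are natural
  numbers because these are to be polynomials rather than Laurent polynomials; up to units
  of the Laurent polynomial ring, other signs of the exponents give nothing new for nonzero \<open>\<rho>\<close>.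
  Units (such as the case \<open>\<rho> = 0\<close> of the first family) are left out: they divide every
  polynomial and would make non-divisibility by the whole family impossible.
\<close>

definition binomials :: "('a, 'm) ring_scheme \<Rightarrow> (nat \<Rightarrow> nat \<Rightarrow> 'a) set"
  where "binomials K =
    {g. g \<notin> Units (UP2 K) \<and>
        (\<exists>\<rho>\<in>carrier K. \<exists>a b.
           g = monom2 K \<rho> a b \<ominus>\<^bsub>UP2 K\<^esub> \<one>\<^bsub>UP2 K\<^esub> \<or>
           g = monom2 K \<rho> 0 b \<ominus>\<^bsub>UP2 K\<^esub> monom2 K \<one>\<^bsub>K\<^esub> a 0)}"

text \<open>The multiplicative order; meant for nonzero elements of a field.\<close>

definition mult_ord :: "('a, 'm) ring_scheme \<Rightarrow> 'a \<Rightarrow> nat"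
  where "mult_ord K x = group.ord (Multiplicative_Group.mult_of K) x"

end

theory Submission
  imports Defs "Jordan_Normal_Form.Char_Poly"
    "HOL-Computational_Algebra.Field_as_Ring" "HOL-Computational_Algebra.Computational_Algebra"
begin

text \<open>
  Suppose that \<open>f\<close> has \<open>N = 11 * d ^ 3 + d + 1\<close> zeros of low order. Their coordinates are powers of a
  single element \<open>z\<close>, whose order \<open>n\<close> is bounded by a small power of \<open>p\<close>. The values of the monomials of
  degree at most \<open>d\<close> at the \<open>N\<close> points are linearly dependent, so a Gram determinant \<open>D\<close>, an integer
  polynomial depending on \<open>n\<close> and the exponents only, vanishes at \<open>z\<close>. If \<open>D\<close> does not vanish at
  \<open>zeta = exp (2 * pi * i / n)\<close>, then \<open>p\<close> divides the norm of \<open>D(zeta)\<close>, a nonzero integer of size at most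
  \<open>C ^ n\<close>; as there are few choices of \<open>n\<close> and of the exponents, this happens for few \<open>p\<close> only.

  Otherwise a complex curve of degree at most \<open>d\<close> passes through the \<open>N\<close> points whose coordinates are the
  corresponding powers of \<open>zeta\<close>. By the theorem of Beukers and Smyth an irreducible curve of degree
  \<open>e\<close> with noncollinear support contains at most \<open>11 * e ^ 2\<close> torsion points, hence many of these points
  satisfy a common relation \<open>x ^ a * y ^ b = const\<close> or \<open>x ^ a = const * y ^ b\<close>. The same relation holds for
  the original points. Its solutions are parametrised by one variable \<open>t\<close>, and \<open>f\<close> has more zeros in
  \<open>t\<close> than its degree allows, so the binomial divides \<open>f\<close>.
\<close>

subsection \<open>Conjugate roots of unity and norms\<close>

text \<open>The obstacle is that \<open>f\<close> has no distinguished lift to characteristic 0;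
  only the exponents of the points survive the change of characteristic. The curve therefore enters
  through linear dependence alone, and the complex curve found afterwards need not be related to
  \<open>f\<close>. What returns to characteristic p is a relation between exponents modulo n:
  \<open>zeta n ^ s = zeta n ^ t\<close> forces s and t to be congruent modulo n.

  A Gram determinant is one polynomial, where minors would form a family. In characteristic p a
  dependence kills it by plain linear algebra; over the complex numbers positivity turns its
  vanishing back into a dependence. The norm is kept as an identity D * E = \<Phi> * Q + R of
  integer polynomials, with \<Phi> cyclotomic, because such an identity can be evaluated in every
  field.

  The sizes decide \<epsilon>: N points have 2 * N coordinates of order at most L, so n is at most L
  ^ (2 * N); there are at most n ^ (2 * N) families of exponents for each n, and each excludes at
  most a constant times n primes. Hence \<epsilon> is \<delta> divided by a constant that depends on
  d only.\<close>

definition int_eval :: "int poly \<Rightarrow> complex \<Rightarrow> complex"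
  where "int_eval q z = poly (map_poly of_int q) z"

lemma int_eval_0 [simp]: "int_eval 0 z = 0"
  and int_eval_1 [simp]: "int_eval 1 z = 1"
  and int_eval_add [simp]: "int_eval (p + q) z = int_eval p z + int_eval q z"
  and int_eval_diff [simp]: "int_eval (p - q) z = int_eval p z - int_eval q z"
  and int_eval_uminus [simp]: "int_eval (- p) z = - int_eval p z"
  and int_eval_mult [simp]: "int_eval (p * q) z = int_eval p z * int_eval q z"
  and int_eval_pCons [simp]: "int_eval (pCons a p) z = of_int a + z * int_eval p z"
  and int_eval_monom [simp]: "int_eval (Polynomial.monom a k) z = of_int a * z ^ k"
  unfolding int_eval_def
  by (auto simp: of_int_poly_hom.hom_add of_int_poly_hom.hom_mult of_int_poly_hom.hom_minus
      of_int_poly_hom.hom_uminus poly_monom of_int_hom.map_poly_pCons_hom map_poly_monom)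

lemma int_eval_smult [simp]: "int_eval (Polynomial.smult a p) z = of_int a * int_eval p z"
  using int_eval_mult[of "[:a:]" p z] by simp

lemma int_eval_power [simp]: "int_eval (p ^ k) z = int_eval p z ^ k"
  by (induction k) auto

lemma int_eval_sum: "int_eval (\<Sum>i\<in>I. f i) z = (\<Sum>i\<in>I. int_eval (f i) z)"
  by (induction I rule: infinite_finite_induct) auto

lemma int_eval_prod: "int_eval (\<Prod>i\<in>I. f i) z = (\<Prod>i\<in>I. int_eval (f i) z)"
  by (induction I rule: infinite_finite_induct) auto

lemma int_eval_pcompose: "int_eval (p \<circ>\<^sub>p q) z = int_eval p (int_eval q z)"
  by (induction p) (auto simp: pcompose_pCons)

lemma int_eval_dvd: "p dvd q \<Longrightarrow> int_eval p z = 0 \<Longrightarrow> int_eval q z = 0"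
  by (auto elim!: dvdE)

text \<open>Pseudo-division multiplies the dividend by a power of the leading coefficient of
  \<open>g\<close>; that power is 1 here, so division with remainder stays over the
  integers.\<close>

lemma monic_division:
  fixes f g :: "'a :: idom poly"
  assumes "lead_coeff g = 1"
  obtains q r where "f = g * q + r" "r = 0 \<or> degree r < degree g"
proof -
  obtain q r where qr: "pseudo_divmod f g = (q, r)" by fastforce
  have g: "g \<noteq> 0" using assms by auto
  show ?thesis
    using that[of q r] pseudo_divmod[OF g qr] assms by simp
qed

lemma content_monom_diff_one:
  assumes "n > 0"
  shows "content (Polynomial.monom 1 n - 1 :: int poly) = 1"
proof -
  have "coeff (Polynomial.monom 1 n - 1 :: int poly) n = 1"
    using assms by simp
  then have "content (Polynomial.monom 1 n - 1 :: int poly) dvd 1"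
    by (metis content_dvd_coeff)
  then show ?thesis
    by (metis is_unit_normalize normalize_content)
qed

text \<open>Gauss's lemma in disguise. A primitive integer polynomial of least degree vanishing at z
  pseudo-divides X^n - 1 without remainder; comparing contents removes the multiplier, so it divides
  X^n - 1 over the integers, and its leading coefficient must be a unit.\<close>

lemma monic_minimal_poly_of_root_of_unity:
  fixes z :: complex
  assumes z: "z ^ n = 1" and n: "n > 0"
  obtains g :: "int poly" where "lead_coeff g = 1" "degree g > 0" "int_eval g z = 0"
    "\<And>r. int_eval r z = 0 \<Longrightarrow> r \<noteq> 0 \<Longrightarrow> degree g \<le> degree r"
    "g dvd Polynomial.monom 1 n - 1"
proof -
  define f :: "int poly" where "f = Polynomial.monom 1 n - 1"
  have f: "int_eval f z = 0" "coeff f n = 1" using z n unfolding f_def by auto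
  then have f0: "f \<noteq> 0" by auto
  have lf: "degree f = n" "lead_coeff f = 1"
  proof -
    have "degree f \<le> n" unfolding f_def
      by (rule degree_diff_le) (auto simp: degree_monom_le)
    moreover have "degree f \<ge> n" using f(2) by (intro le_degree) auto
    ultimately show "degree f = n" by simp
    then show "lead_coeff f = 1" using f(2) by simp
  qed
  obtain g0 where g0: "g0 \<noteq> 0" "int_eval g0 z = 0"
    and min: "\<And>r. int_eval r z = 0 \<Longrightarrow> r \<noteq> 0 \<Longrightarrow> degree g0 \<le> degree r"
    using ex_has_least_nat[of "\<lambda>g. g \<noteq> 0 \<and> int_eval g z = 0" f degree] f(1) f0 by blast
  define p where "p = primitive_part g0"
  have g0p: "g0 = Polynomial.smult (content g0) p" unfolding p_def by simp
  have c0: "content g0 \<noteq> 0" using g0 by simp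
  have p0: "p \<noteq> 0" using g0(1) g0p by auto
  have dp: "degree p = degree g0" unfolding p_def by simp
  have pz: "int_eval p z = 0" using g0(2) c0 g0p by (metis int_eval_smult mult_eq_0_iff of_int_eq_0_iff)
  have cp: "content p = 1" using g0(1) unfolding p_def by (rule content_primitive_part)
  obtain a q where a: "a \<noteq> 0" and aq: "Polynomial.smult a f = p * q + pseudo_mod f p"
    using pseudo_mod(1)[OF p0, of f] by blast
  have "int_eval (pseudo_mod f p) z = 0"
    using arg_cong[OF aq, of "\<lambda>q. int_eval q z"] f(1) pz by simp
  then have "pseudo_mod f p = 0"
    using min[of "pseudo_mod f p"] pseudo_mod(2)[OF p0, of f] dp by fastforce
  then have eq: "Polynomial.smult a f = p * q" using aq by simp
  have "content (Polynomial.smult a f) = content q"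
    unfolding eq using cp by (simp add: content_mult)
  then have "a dvd content q"
    using content_monom_diff_one[OF n] unfolding f_def[symmetric] by (simp add: content_smult)
       (metis dvd_normalize_iff dvd_refl normalize_int_def)
  then have "[:a:] dvd q" by (simp add: const_poly_dvd_iff_dvd_content)
  then obtain q' where q': "q = [:a:] * q'" by (elim dvdE)
  have "Polynomial.smult a f = Polynomial.smult a (p * q')"
    unfolding eq q' by simp
  then have fpq: "f = p * q'" using a by (simp add: smult_cancel)
  then have "lead_coeff p * lead_coeff q' = 1"
    using lf(2) by (metis lead_coeff_mult)
  then have l: "lead_coeff p = 1 \<or> lead_coeff p = -1"
    by (metis zmult_eq_1_iff)
  define g where "g = (if lead_coeff p = 1 then p else - p)"
  have g: "lead_coeff g = 1" "int_eval g z = 0" "degree g = degree g0" "g dvd f"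
    using l pz dp fpq unfolding g_def by auto
  have "degree g > 0"
  proof (rule ccontr)
    assume "\<not> degree g > 0"
    then obtain c where c: "g = [:c:]" using degree_eq_zeroE[of g] by auto
    then show False using g(1,2) by auto
  qed
  then show ?thesis using that[of g] g min unfolding f_def by auto
qed

lemma freshman_dream_dvd:
  fixes u v :: "'a :: comm_ring_1"
  assumes "Factorial_Ring.prime (l :: nat)"
  shows "of_nat l dvd (u + v) ^ l - (u ^ l + v ^ l)"
proof -
  have l: "l > 0" using assms prime_gt_0_nat by blast
  have "{..l} = insert 0 (insert l {1..<l})" using l by auto
  then have "(u + v) ^ l = u ^ l + v ^ l + (\<Sum>k\<in>{1..<l}. of_nat (l choose k) * u ^ k * v ^ (l - k))"
    unfolding binomial_ring using l by (simp add: algebra_simps)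
  moreover have "of_nat l dvd (\<Sum>k\<in>{1..<l}. of_nat (l choose k) * u ^ k * v ^ (l - k) :: 'a)"
  proof (rule dvd_sum)
    fix k assume "k \<in> {1..<l}"
    then have "l dvd (l choose k)" by (intro dvd_choose_prime) (use assms in auto)
    then have "(of_nat l :: 'a) dvd of_nat (l choose k)" by (metis dvd_def of_nat_mult)
    then show "of_nat l dvd (of_nat (l choose k) * u ^ k * v ^ (l - k) :: 'a)"
      by (simp add: mult.assoc)
  qed
  ultimately show ?thesis by simp
qed

lemma fermat_int_dvd:
  assumes "Factorial_Ring.prime (l :: nat)"
  shows "int l dvd a ^ l - a"
proof (induction a rule: int_induct[where k = 0])
  case base
  then show ?case using prime_gt_0_nat[OF assms] by (simp add: zero_power)
next
  case (step1 i)
  have "int l dvd (i + 1) ^ l - (i ^ l + 1 ^ l)"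
    using freshman_dream_dvd[OF assms, of i 1] by simp
  from dvd_add[OF this step1(2)] show ?case by (simp add: algebra_simps)
next
  case (step2 i)
  have "int l dvd ((i - 1) + 1) ^ l - ((i - 1) ^ l + 1 ^ l)"
    using freshman_dream_dvd[OF assms, of "i - 1" 1] by simp
  from dvd_diff[OF step2(2) this] show ?case by (simp add: algebra_simps)
qed

text \<open>The Frobenius congruence g(X^l) = g(X)^l modulo l: Fermat handles the constant
  coefficient, and raising to the power l is additive modulo l.\<close>

lemma pcompose_monom_frobenius:
  assumes "Factorial_Ring.prime (l :: nat)"
  shows "of_nat l dvd (g \<circ>\<^sub>p Polynomial.monom 1 l) - (g :: int poly) ^ l"
proof (induction g)
  case 0
  then show ?case using prime_gt_0_nat[OF assms] by (simp add: zero_power)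
next
  case (pCons a g)
  let ?M = "Polynomial.monom 1 l :: int poly"
  have X: "pCons 0 g = Polynomial.monom 1 1 * g"
    by (simp add: monom_Suc monom_0)
  have p: "pCons a g = [:a:] + pCons 0 g" by simp
  have "of_nat l dvd (pCons a g) ^ l - ([:a:] ^ l + (pCons 0 g) ^ l)"
    unfolding p by (rule freshman_dream_dvd[OF assms])
  moreover have "(pCons 0 g) ^ l = ?M * g ^ l"
    unfolding X by (simp add: power_mult_distrib monom_power)
  moreover have "of_nat l dvd ([:a:] ^ l - [:a:])"
  proof -
    have "[:a:] ^ l - [:a:] = [:a ^ l - a:]" by (simp add: poly_const_pow)
    moreover have "of_nat l = [:int l:]" by (simp add: of_nat_poly)
    ultimately show ?thesis using fermat_int_dvd[OF assms, of a] by simp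
  qed
  moreover have "of_nat l dvd ?M * ((g \<circ>\<^sub>p ?M) - g ^ l)"
    using pCons.IH by simp
  ultimately have "of_nat l dvd ?M * ((g \<circ>\<^sub>p ?M) - g ^ l) - ([:a:] ^ l - [:a:])
     - ((pCons a g) ^ l - ([:a:] ^ l + ?M * g ^ l))"
    by (metis dvd_diff)
  then show ?case by (simp add: pcompose_pCons algebra_simps)
qed

text \<open>Dedekind's argument. If the minimal polynomial g did not vanish at w = z^l, then w would
  be a root of the cofactor h of g in X^n - 1. By Frobenius g(w) is l times an element of Z[z], and
  the derivative of X^n - 1 at w then makes n a multiple of l in Z[z], which forces l to divide
  n.\<close>

lemma conjugate_prime_root:
  fixes z :: complex
  assumes l: "Factorial_Ring.prime (l :: nat)" "\<not> l dvd n" and z: "z ^ n = 1" and n: "n > 0"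
    and q: "int_eval q z = 0"
  shows "int_eval q (z ^ l) = 0"
proof (rule ccontr)
  assume nz: "int_eval q (z ^ l) \<noteq> 0"
  obtain g :: "int poly" where g: "lead_coeff g = 1" "degree g > 0" "int_eval g z = 0"
    and min: "\<And>r. int_eval r z = 0 \<Longrightarrow> r \<noteq> 0 \<Longrightarrow> degree g \<le> degree r"
    and dvd: "g dvd Polynomial.monom 1 n - 1"
    using monic_minimal_poly_of_root_of_unity[OF z n] by metis
  obtain q1 r1 where qr: "q = g * q1 + r1" "r1 = 0 \<or> degree r1 < degree g"
    using monic_division[OF g(1)] by blast
  have "int_eval r1 z = 0" using q g(3) unfolding qr(1) by simp
  then have "r1 = 0" using min[of r1] qr(2) by fastforce
  then have gw: "int_eval g (z ^ l) \<noteq> 0" using nz qr by auto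
  define w where "w = z ^ l"
  have w: "w ^ n = 1" unfolding w_def using z by (metis power_mult mult.commute power_one)
  obtain h where h: "Polynomial.monom 1 n - 1 = g * h" using dvd by (elim dvdE)
  have hw: "int_eval h w = 0"
    using arg_cong[OF h, of "\<lambda>p. int_eval p w"] w gw unfolding w_def[symmetric] by simp
  \<comment> \<open>Derivative of X^n - 1 = g * h at w, where the term containing h(w) drops
    out.\<close>
  have "of_nat n * w ^ (n - 1) = int_eval g w * int_eval (pderiv h) w"
    using arg_cong[OF h, of "\<lambda>p. int_eval (pderiv p) w"] hw
    by (simp add: pderiv_diff pderiv_monom pderiv_mult)
  then have "of_nat n * (w ^ (n - 1) * w) = int_eval g w * int_eval (pderiv h) w * w"
    by (simp only: mult.assoc[symmetric])
  moreover have "w ^ (n - 1) * w = 1" using w n by (metis power_minus_mult)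
  ultimately have "of_nat n * 1 = int_eval g w * int_eval (pderiv h) w * w" by (simp only:)
  then have nw: "of_nat n = w * int_eval g w * int_eval (pderiv h) w"
    by (simp only: mult_1_right mult_1_left mult_ac)
  obtain t where t: "(g \<circ>\<^sub>p Polynomial.monom 1 l) - g ^ l = of_nat l * t"
    using pcompose_monom_frobenius[OF l(1), of g] by (elim dvdE)
  have "int_eval g w = of_nat l * int_eval t z"
    using arg_cong[OF t, of "\<lambda>p. int_eval p z"] g(3) prime_gt_0_nat[OF l(1)]
    by (simp add: int_eval_pcompose w_def of_nat_poly zero_power)
  define s where "s = Polynomial.monom 1 l * t * (pderiv h \<circ>\<^sub>p Polynomial.monom 1 l)"
  have s: "of_nat n = of_nat l * int_eval s z"
    unfolding nw s_def \<open>int_eval g w = of_nat l * int_eval t z\<close>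
    by (simp add: int_eval_pcompose w_def)
  obtain s1 s2 where s12: "s = g * s1 + s2" "s2 = 0 \<or> degree s2 < degree g"
    using monic_division[OF g(1)] by blast
  \<comment> \<open>The polynomial \<open>e\<close> vanishes at z and has smaller degree than g, so
    it is zero; its constant coefficient says that l divides n.\<close>
  define e where "e = Polynomial.smult (int l) s2 - [:int n:]"
  have "int_eval e z = 0" using s g(3) unfolding e_def s12(1) by simp
  moreover have "degree e < degree g"
    unfolding e_def using s12(2) g(2) by (intro degree_diff_less) auto
  ultimately have "e = 0" using min[of e] by fastforce
  then have "int l * coeff s2 0 = int n"
    unfolding e_def by (metis coeff_pCons_0 coeff_smult eq_iff_diff_eq_0)
  then have "int l dvd int n" by (metis dvd_triv_left)
  then show False using l(2) by simp
qed

text \<open>One prime factor of k is split off at a time. Each step replaces z by a power of z,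
  hence the induction is over all z.\<close>

lemma conjugate_root:
  fixes z :: complex
  assumes "coprime k n" "k > 0" "z ^ n = 1" "n > 0" "int_eval q z = 0"
  shows "int_eval q (z ^ k) = 0"
  using assms
proof (induction k arbitrary: z rule: less_induct)
  case (less k)
  show ?case
  proof (cases "k = 1")
    case True
    then show ?thesis using less.prems by simp
  next
    case False
    then obtain l where l: "Factorial_Ring.prime l" "l dvd k"
      using prime_factor_nat by blast
    then obtain k' where k': "k = l * k'" by (elim dvdE)
    have "\<not> l dvd n"
      using l less.prems(1) by (metis coprime_common_divisor_nat not_prime_1)
    then have "int_eval q (z ^ l) = 0"
      using conjugate_prime_root[OF l(1)] less.prems by blast
    moreover have "k' < k" "k' > 0" "coprime k' n"
      using l(1) less.prems k' prime_gt_1_nat[OF l(1)] by auto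
    moreover have "(z ^ l) ^ n = 1"
      using less.prems(3) by (metis power_mult mult.commute power_one)
    ultimately show ?thesis
      using less.IH[of k' "z ^ l"] less.prems(4) k' by (simp add: power_mult)
  qed
qed

section \<open>Primitive roots of unity, the cyclotomic factor and the norm\<close>

definition zeta :: "nat \<Rightarrow> complex" where "zeta n = cis (2 * pi / real n)"

lemma zeta_power_eq: "zeta n ^ k = cis (2 * pi * real k / real n)"
  unfolding zeta_def by (simp add: DeMoivre algebra_simps)

lemma zeta_pow_self: "n > 0 \<Longrightarrow> zeta n ^ n = 1"
  unfolding zeta_power_eq by simp

lemma norm_zeta [simp]: "norm (zeta n) = 1"
  unfolding zeta_def by simp

lemma zeta_nonzero [simp]: "zeta n \<noteq> 0"
  unfolding zeta_def by simp

lemma root_of_unity_zeta_power: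
  assumes "n > 0" "w ^ n = 1"
  obtains j where "j < n" "w = zeta n ^ j"
  using bij_betw_roots_unity[OF assms(1)] assms(2) that
  unfolding zeta_power_eq bij_betw_def by (auto simp: image_iff)

lemma zeta_power_inj:
  assumes "n > 0" "i < n" "j < n" "zeta n ^ i = zeta n ^ j"
  shows "i = j"
  using bij_betw_roots_unity[OF assms(1)] assms
  unfolding zeta_power_eq bij_betw_def inj_on_def by auto

lemma power_gcd_eq_one:
  fixes w :: "'a :: field"
  assumes "w ^ a = 1" "w ^ b = 1"
  shows "w ^ gcd a b = 1"
proof (cases "a = 0")
  case False
  obtain x y where "a * x = b * y + gcd a b" using bezout_nat[OF False] by blast
  then have "w ^ (a * x) = w ^ (b * y) * w ^ gcd a b" by (simp add: power_add)
  then show ?thesis using assms by (simp add: power_mult)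
qed (use assms in auto)

lemma zeta_power_eq_one_iff:
  assumes "n > 0"
  shows "zeta n ^ i = 1 \<longleftrightarrow> n dvd i"
proof
  assume "zeta n ^ i = 1"
  then have "zeta n ^ gcd i n = 1" using zeta_pow_self[OF assms] by (rule power_gcd_eq_one)
  moreover have "gcd i n \<le> n" using assms by (simp add: gcd_le2_nat)
  ultimately show "n dvd i"
    using zeta_power_inj[OF assms, of "gcd i n" 0] assms
    by (metis gcd_dvd1 gcd_pos_nat le_neq_implies_less less_irrefl power_0)
next
  assume "n dvd i"
  then show "zeta n ^ i = 1" using zeta_pow_self[OF assms] by (auto simp: power_mult elim!: dvdE)
qed

text \<open>Exact order n is tested on the proper divisors of n only, matching the factors of
  \<open>xprod\<close>.\<close>

definition primroots :: "nat \<Rightarrow> complex set"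
  where "primroots n = {w. w ^ n = 1 \<and> (\<forall>m. m dvd n \<longrightarrow> m < n \<longrightarrow> w ^ m \<noteq> 1)}"

lemma zeta_primroot: "n > 0 \<Longrightarrow> zeta n \<in> primroots n"
  unfolding primroots_def by (auto simp: zeta_pow_self zeta_power_eq_one_iff dest: dvd_imp_le)

lemma primroot_power_eq:
  assumes w: "w \<in> primroots n" and n: "n > 0" and "a \<le> b" "w ^ a = w ^ b"
  shows "n dvd b - a"
proof -
  have w0: "w \<noteq> 0" using w n unfolding primroots_def by (auto simp: zero_power)
  have "w ^ a * w ^ (b - a) = w ^ a * 1"
    using assms(3,4) by (metis le_add_diff_inverse power_add mult_1_right)
  then have "w ^ (b - a) = 1" using w0 by simp
  then have "w ^ gcd (b - a) n = 1" using w unfolding primroots_def by (blast intro: power_gcd_eq_one)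
  then have "\<not> gcd (b - a) n < n" using w unfolding primroots_def by auto
  then have "gcd (b - a) n = n" using gcd_le2_nat[of n "b - a"] n by linarith
  then show ?thesis by (metis gcd_dvd1)
qed

lemma exists_inverse_mod:
  assumes "coprime k n" "n > (0::nat)"
  obtains k' where "coprime k' n" "k' > 0" "[k * k' = 1] (mod n)"
proof -
  obtain x where x: "[k * x = 1] (mod n)" using cong_solve_coprime_nat[OF assms(1)] by auto
  have "[k * (x + n) = 1] (mod n)"
    using x by (simp add: distrib_left cong_def)
  moreover from this have "coprime (x + n) n"
    by (metis coprime_mult_left_iff cong_imp_coprime cong_sym coprime_1_left)
  ultimately show ?thesis using that[of "x + n"] assms(2) by simp
qed

lemma power_cong_root_of_unity:
  fixes w :: complex
  assumes "w ^ n = 1" "[a = b] (mod n)"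
  shows "w ^ a = w ^ b"
proof -
  have "w ^ c = w ^ (c mod n)" for c
    using assms(1) by (metis mult_div_mod_eq power_add power_mult power_one mult_1)
  then show ?thesis using assms(2) unfolding cong_def by metis
qed

lemma primroot_power:
  assumes w: "w \<in> primroots n" and n: "n > 0" and k: "coprime k n"
  shows "w ^ k \<in> primroots n"
proof -
  obtain k' where k': "[k * k' = 1] (mod n)" using exists_inverse_mod[OF k n] by metis
  have wn: "w ^ n = 1" using w unfolding primroots_def by auto
  have "w ^ m = 1" if "(w ^ k) ^ m = 1" for m
  proof -
    have "w ^ (m * (k * k')) = 1"
      using that by (metis mult.assoc mult.commute power_mult power_one)
    moreover have "[m * (k * k') = m] (mod n)" using cong_scalar_left[OF k', of m] by simp
    ultimately show ?thesis using power_cong_root_of_unity[OF wn] by metis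
  qed
  moreover have "(w ^ k) ^ n = 1" using wn by (metis power_mult mult.commute power_one)
  ultimately show ?thesis using w unfolding primroots_def by blast
qed

text \<open>Exponents coprime to n send primitive roots injectively to primitive roots. For
  \<open>zeta n\<close> the map is shown to be onto, which gives the cardinality; for any other w
  injectivity and equal cardinalities suffice.\<close>

lemma primroots_powers:
  assumes n: "n > 0" and w: "w \<in> primroots n"
  shows "bij_betw (\<lambda>k. w ^ k) (totatives n) (primroots n)"
proof -
  have inj: "inj_on (\<lambda>k. v ^ k) (totatives n)" if v: "v \<in> primroots n" for v
  proof -
    have "a = b" if "a \<in> totatives n" "b \<in> totatives n" "v ^ a = v ^ b" "a \<le> b" for a b
    proof -
      have "n dvd b - a" using primroot_power_eq[OF v n that(4,3)] .
      moreover have "b - a < n" using that(1,2) unfolding totatives_def by auto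
      ultimately show ?thesis using that(4) by (metis dvd_imp_le diff_is_0_eq le_antisym leD neq0_conv)
    qed
    then show ?thesis by (intro inj_onI) (metis nat_le_linear)
  qed
  have sub: "(\<lambda>k. v ^ k) ` totatives n \<subseteq> primroots n" if v: "v \<in> primroots n" for v
    using primroot_power[OF v n] by (auto simp: totatives_def)
  have "primroots n \<subseteq> (\<lambda>k. zeta n ^ k) ` totatives n"
  proof
    fix u assume u: "u \<in> primroots n"
    then have "u ^ n = 1" unfolding primroots_def by auto
    then obtain j where j: "j < n" "u = zeta n ^ j" using root_of_unity_zeta_power[OF n] by blast
    have cop: "coprime j n"
    proof (rule ccontr)
      assume "\<not> coprime j n"
      then have g1: "gcd j n \<noteq> 1" using coprime_iff_gcd_eq_1 by blast
      moreover have "gcd j n > 0" using n by simp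
      ultimately have g2: "gcd j n \<ge> 2" by linarith
      obtain c where c: "n = gcd j n * c" using gcd_dvd2 by (metis dvdE)
      obtain e where e: "j = gcd j n * e" using gcd_dvd1 by (metis dvdE)
      have c0: "c > 0" using c n by (cases c) auto
      have "2 * c \<le> gcd j n * c" using g2 by simp
      then have "c < n" using c c0 by linarith
      moreover have "c dvd n" by (subst c) simp
      moreover have "u ^ c = 1"
      proof -
        have "j * c = (gcd j n * c) * e" by (subst e) (simp add: mult_ac)
        then have "n dvd j * c" using c by simp
        then show ?thesis unfolding j(2) using zeta_power_eq_one_iff[OF n] by (simp flip: power_mult)
      qed
      ultimately show False using u unfolding primroots_def by auto
    qed
    show "u \<in> (\<lambda>k. zeta n ^ k) ` totatives n"
    proof (cases "j = 0")
      \<comment> \<open>The exponent 0 is not a totative. It arises for n = 1 only, where the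
        exponent 1 gives the same root.\<close>
      case True
      then have "n = 1" using cop by simp
      then show ?thesis using True j(2) zeta_pow_self[of 1] by (auto simp: image_iff)
    next
      case False
      then show ?thesis using j cop by (auto simp: image_iff totatives_def)
    qed
  qed
  then have eq: "primroots n = (\<lambda>k. zeta n ^ k) ` totatives n" using sub[OF zeta_primroot[OF n]] by blast
  then have "card (primroots n) = card (totatives n)" "finite (primroots n)"
    using card_image[OF inj[OF zeta_primroot[OF n]]] by auto
  then have "(\<lambda>k. w ^ k) ` totatives n = primroots n"
    using card_image[OF inj[OF w]] sub[OF w] by (metis card_subset_eq)
  then show ?thesis using inj[OF w] unfolding bij_betw_def by blast
qed

definition xpoly :: "nat \<Rightarrow> int poly" where "xpoly m = Polynomial.monom 1 m - 1"

lemma int_eval_xpoly [simp]: "int_eval (xpoly m) z = z ^ m - 1"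
  unfolding xpoly_def by simp

lemma lead_coeff_xpoly: "n > 0 \<Longrightarrow> degree (xpoly n) = n \<and> lead_coeff (xpoly n) = 1"
proof -
  assume n: "n > 0"
  have "coeff (xpoly n) n = 1" using n unfolding xpoly_def by simp
  moreover have "degree (xpoly n) \<le> n" unfolding xpoly_def
    by (rule degree_diff_le) (auto simp: degree_monom_le)
  moreover have "degree (xpoly n) \<ge> n" using calculation(1) by (intro le_degree) auto
  ultimately show ?thesis by simp
qed

lemma xpoly_dvd: "m dvd n \<Longrightarrow> xpoly m dvd xpoly n"
proof (elim dvdE)
  fix j assume n: "n = m * j"
  have "xpoly n = (Polynomial.monom 1 m) ^ j - 1"
    unfolding xpoly_def n by (simp add: monom_power)
  then show ?thesis unfolding xpoly_def by (simp add: power_diff_1_eq)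
qed

text \<open>Its complex roots are the n-th roots of unity of order smaller than n. A product of
  binomials X^m - 1 can be tested in every field, unlike a product over complex roots.\<close>

definition xprod :: "nat \<Rightarrow> int poly"
  where "xprod n = (\<Prod>m\<in>{m. m dvd n \<and> m < n}. xpoly m)"

text \<open>The cyclotomic polynomial, obtained as X^n - 1 divided by its gcd with
  \<open>xprod n\<close>. Because X^n - 1 has simple roots, a root of \<Phi> is not a root of h, so
  it has exact order n. The relations \<open>xpoly n = \<Phi> * h\<close> and
  \<open>h dvd xprod n\<close> are recorded because they remain meaningful in characteristic
  p.\<close>

lemma cyclotomic_factor:
  assumes n: "n > 0"
  obtains \<Phi> h where "lead_coeff \<Phi> = 1" "xpoly n = \<Phi> * h" "h dvd xprod n"
    "{w. int_eval \<Phi> w = 0} = primroots n"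
proof -
  define h0 where "h0 = gcd (xpoly n) (xprod n)"
  obtain p0 where p0: "xpoly n = h0 * p0" unfolding h0_def by (metis dvdE gcd_dvd1)
  have "lead_coeff h0 * lead_coeff p0 = 1"
    using lead_coeff_xpoly[OF n] p0 by (metis lead_coeff_mult)
  then have l: "lead_coeff h0 = 1 \<and> lead_coeff p0 = 1 \<or> lead_coeff h0 = -1 \<and> lead_coeff p0 = -1"
    by (metis zmult_eq_1_iff)
  define h where "h = (if lead_coeff h0 = 1 then h0 else - h0)"
  define \<Phi> where "\<Phi> = (if lead_coeff h0 = 1 then p0 else - p0)"
  have 1: "lead_coeff \<Phi> = 1" using l unfolding \<Phi>_def by auto
  have 2: "xpoly n = \<Phi> * h" using p0 unfolding \<Phi>_def h_def by auto
  have 3: "h dvd xprod n" unfolding h_def h0_def by auto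
  have fin: "finite {m. m dvd n \<and> m < n}" by auto
  have 4: "{w. int_eval \<Phi> w = 0} = primroots n"
  proof (intro Set.set_eqI iffI)
    fix w assume "w \<in> {w. int_eval \<Phi> w = 0}"
    then have w: "int_eval \<Phi> w = 0" by simp
    then have wn: "w ^ n = 1" using arg_cong[OF 2, of "\<lambda>p. int_eval p w"] by simp
    have "w ^ m \<noteq> 1" if m: "m dvd n" "m < n" for m
    proof
      assume "w ^ m = 1"
      have "xpoly m dvd xprod n" unfolding xprod_def using fin m by (intro dvd_prodI) auto
      then have "xpoly m dvd h0" unfolding h0_def using xpoly_dvd[OF m(1)] by simp
      then have "xpoly m dvd h" unfolding h_def by simp
      then have "int_eval h w = 0" using \<open>w ^ m = 1\<close> by (auto intro: int_eval_dvd)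
      then have "of_nat n * w ^ (n - 1) = 0"
        using arg_cong[OF 2, of "\<lambda>p. int_eval (pderiv p) w"] w
        by (simp add: xpoly_def pderiv_diff pderiv_monom pderiv_mult)
      then show False using n wn by (auto simp: zero_power)
    qed
    then show "w \<in> primroots n" using wn unfolding primroots_def by auto
  next
    fix w assume w: "w \<in> primroots n"
    then have "int_eval h0 w \<noteq> 0"
    proof -
      have "int_eval (xprod n) w \<noteq> 0"
        using w fin unfolding xprod_def primroots_def by (simp add: int_eval_prod)
      then show ?thesis using int_eval_dvd[of h0 "xprod n" w] unfolding h0_def by auto
    qed
    then have "int_eval h w \<noteq> 0" unfolding h_def by auto
    moreover have "int_eval (\<Phi> * h) w = 0" using w unfolding 2[symmetric] primroots_def by simp
    ultimately show "w \<in> {w. int_eval \<Phi> w = 0}" by simp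
  qed
  show ?thesis using that[OF 1 2 3 4] .
qed

lemma int_eval_roots_card:
  assumes "p \<noteq> 0"
  shows "finite {w. int_eval p w = 0}" "card {w. int_eval p w = 0} \<le> degree p"
proof -
  have "map_poly complex_of_int p \<noteq> 0" using assms by simp
  from poly_roots_finite[OF this] poly_roots_degree[OF this]
  show "finite {w. int_eval p w = 0}" "card {w. int_eval p w = 0} \<le> degree p" unfolding int_eval_def by auto
qed

text \<open>R is the norm of D(zeta n). The product F of all D(X^k) with k coprime to n takes the
  same value at every primitive root, so its remainder modulo \<Phi> is a constant, and integrality
  of R comes for free. The factor with k = 1 shows that D divides F. Every conjugate of D(zeta n) is
  at most C, whence the bound.\<close>

lemma norm_in_ideal:
  assumes n: "n > 0" and D: "int_eval D (zeta n) \<noteq> 0"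
    and C: "C \<ge> 1" "\<And>w. norm w = 1 \<Longrightarrow> norm (int_eval D w) \<le> C"
  obtains R :: int and E \<Phi> Q h where "R \<noteq> 0" "\<bar>real_of_int R\<bar> \<le> C ^ n"
    "xpoly n = \<Phi> * h" "h dvd xprod n" "D * E = \<Phi> * Q + [:R:]"
proof -
  obtain \<Phi> h where \<Phi>: "lead_coeff \<Phi> = 1" "xpoly n = \<Phi> * h" "h dvd xprod n"
    and roots: "{w. int_eval \<Phi> w = 0} = primroots n"
    using cyclotomic_factor[OF n] by metis
  have \<Phi>0: "\<Phi> \<noteq> 0" and h0: "h \<noteq> 0" using \<Phi>(1,2) lead_coeff_xpoly[OF n] by auto
  \<comment> \<open>The n distinct roots of X^n - 1 are shared between \<Phi> and h, whose degrees
    add up to n; so neither can have fewer roots than its degree.\<close>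
  have "card (primroots n) = degree \<Phi>"
  proof -
    have "w ^ n = 1 \<longleftrightarrow> int_eval \<Phi> w = 0 \<or> int_eval h w = 0" for w
      using arg_cong[OF \<Phi>(2), of "\<lambda>p. int_eval p w"]
      by (simp add: eq_iff_diff_eq_0[of "w ^ n" 1])
    then have "{z::complex. z ^ n = 1} = {w. int_eval \<Phi> w = 0} \<union> {w. int_eval h w = 0}"
      by auto
    then have "n \<le> card {w. int_eval \<Phi> w = 0} + card {w. int_eval h w = 0}"
      using card_roots_unity_eq[of n] n by (metis card_Un_le)
    moreover have "degree \<Phi> + degree h = n"
      using \<Phi>(2) lead_coeff_xpoly[OF n] degree_mult_eq[OF \<Phi>0 h0] by simp
    ultimately show ?thesis
      using int_eval_roots_card(2)[OF \<Phi>0] int_eval_roots_card(2)[OF h0] unfolding roots[symmetric] by linarith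
  qed
  define U where "U = totatives n"
  have finU: "finite U" and U1: "1 \<in> U" unfolding U_def using n by (auto simp: totatives_def)
  define F where "F = (\<Prod>k\<in>U. D \<circ>\<^sub>p Polynomial.monom 1 k)"
  define v where "v = (\<Prod>u\<in>primroots n. int_eval D u)"
  have Fv: "int_eval F w = v" if w: "w \<in> primroots n" for w
  proof -
    have "int_eval F w = (\<Prod>k\<in>U. int_eval D (w ^ k))"
      unfolding F_def by (simp add: int_eval_prod int_eval_pcompose)
    also have "\<dots> = v"
      unfolding v_def U_def by (rule prod.reindex_bij_betw[OF primroots_powers[OF n w]])
    finally show ?thesis .
  qed
  obtain Q r where Qr: "F = \<Phi> * Q + r" "r = 0 \<or> degree r < degree \<Phi>"
    using monic_division[OF \<Phi>(1)] by blast
  have deg: "degree \<Phi> > 0"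
    using \<open>card (primroots n) = degree \<Phi>\<close> zeta_primroot[OF n] roots int_eval_roots_card(1)[OF \<Phi>0]
    by (metis card_gt_0_iff empty_iff)
  have rv: "int_eval r w = v" if "w \<in> primroots n" for w
    using Fv[OF that] that roots unfolding Qr(1) by auto
  \<comment> \<open>The difference of the remainder and the constant v has more roots than its
    degree.\<close>
  define P where "P = map_poly complex_of_int r - [:v:]"
  have "P = 0"
  proof (rule ccontr)
    assume P: "P \<noteq> 0"
    have "primroots n \<subseteq> {w. poly P w = 0}"
      using rv unfolding P_def int_eval_def by auto
    then have "card (primroots n) \<le> degree P"
      using card_mono[OF poly_roots_finite[OF P]] poly_roots_degree[OF P] by (meson le_trans)
    moreover have "degree P < degree \<Phi>"
      unfolding P_def using Qr(2) deg by (intro degree_diff_less) auto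
    ultimately show False using \<open>card (primroots n) = degree \<Phi>\<close> by simp
  qed
  then have eq: "map_poly complex_of_int r = [:v:]" unfolding P_def by simp
  define R where "R = coeff r 0"
  have vR: "v = of_int R"
    using arg_cong[OF eq, of "\<lambda>p. coeff p 0"] unfolding R_def by simp
  have "degree r = 0" using arg_cong[OF eq, of degree] by simp
  then have r: "r = [:R:]" unfolding R_def by (metis degree_0_id)
  have "v \<noteq> 0"
  proof -
    have "int_eval D u \<noteq> 0" if u: "u \<in> primroots n" for u
    proof
      assume Du: "int_eval D u = 0"
      have "u \<in> (\<lambda>k. zeta n ^ k) ` totatives n"
        using primroots_powers[OF n zeta_primroot[OF n]] u unfolding bij_betw_def by auto
      then obtain k where k: "coprime k n" "k > 0" "u = zeta n ^ k"
        unfolding totatives_def by auto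
      obtain k' where k': "coprime k' n" "k' > 0" "[k * k' = 1] (mod n)"
        using exists_inverse_mod[OF k(1) n] by metis
      \<comment> \<open>A zero at one conjugate spreads to all of them; the inverse exponent k'
        leads from u back to \<open>zeta n\<close>.\<close>
      have "int_eval D (u ^ k') = 0"
        using conjugate_root[OF k'(1,2) _ n Du] u unfolding primroots_def by auto
      moreover have "u ^ k' = zeta n"
        using power_cong_root_of_unity[OF zeta_pow_self[OF n] k'(3)] unfolding k(3)
        by (simp add: power_mult)
      ultimately show False using D by simp
    qed
    then show ?thesis unfolding v_def using roots int_eval_roots_card(1)[OF \<Phi>0] by simp
  qed
  then have R0: "R \<noteq> 0" using vR by auto
  have Rb: "\<bar>real_of_int R\<bar> \<le> C ^ n"
  proof -
    have "\<bar>real_of_int R\<bar> = norm v" unfolding vR by simp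
    also have "\<dots> = (\<Prod>u\<in>primroots n. norm (int_eval D u))" unfolding v_def by (simp add: prod_norm)
    also have "\<dots> \<le> (\<Prod>u\<in>primroots n. C)"
    proof (intro prod_mono conjI)
      fix u assume "u \<in> primroots n"
      then have "u ^ n = 1" unfolding primroots_def by auto
      then have "norm u = 1" using power_eq_1_iff[of u n] n by auto
      then show "norm (int_eval D u) \<le> C" by (rule C(2))
    qed auto
    also have "\<dots> = C ^ degree \<Phi>" using \<open>card (primroots n) = degree \<Phi>\<close> by simp
    also have "\<dots> \<le> C ^ n"
    proof (rule power_increasing)
      show "degree \<Phi> \<le> n"
        using \<Phi>(2) lead_coeff_xpoly[OF n] degree_mult_eq[OF \<Phi>0 h0] by simp
    qed (use C in auto)
    finally show ?thesis .
  qed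
  have "D dvd F"
  proof -
    have "D \<circ>\<^sub>p Polynomial.monom 1 1 = D" by (simp add: monom_Suc monom_0 pcompose_idR)
    moreover have "D \<circ>\<^sub>p Polynomial.monom 1 1 dvd F" unfolding F_def using finU U1 by (rule dvd_prodI)
    ultimately show ?thesis by simp
  qed
  then obtain E where "F = D * E" by (elim dvdE)
  then have "D * E = \<Phi> * Q + [:R:]" using Qr(1) r by simp
  then show ?thesis using that[OF R0 Rb \<Phi>(2,3)] by blast
qed

subsection \<open>Bivariate polynomials and a Bezout bound\<close>

lemma homogeneous_system_nontrivial:
  fixes a :: "'i \<Rightarrow> 'j \<Rightarrow> 'a :: field"
  assumes "finite I" "finite J" "card I < card J"
  shows "\<exists>c. (\<exists>j\<in>J. c j \<noteq> 0) \<and> (\<forall>i\<in>I. (\<Sum>j\<in>J. a i j * c j) = 0)"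
  using assms
proof (induction I arbitrary: J a rule: finite_induct)
  case empty
  then obtain j where "j \<in> J" by fastforce
  then show ?case by (intro exI[of _ "\<lambda>_. 1"]) auto
next
  case (insert i0 I)
  show ?case
  proof (cases "\<forall>j\<in>J. a i0 j = 0")
    case True
    have "card I < card J" using insert by simp
    from insert.IH[OF insert.prems(1) this, of a] obtain c where
      "\<exists>j\<in>J. c j \<noteq> 0" "\<forall>i\<in>I. (\<Sum>j\<in>J. a i j * c j) = 0" by blast
    moreover have "(\<Sum>j\<in>J. a i0 j * c j) = 0" using True by simp
    ultimately show ?thesis by auto
  next
    case False
    then obtain j0 where j0: "j0 \<in> J" "a i0 j0 \<noteq> 0" by auto
    define J' where "J' = J - {j0}"
    have J: "J = insert j0 J'" "j0 \<notin> J'" "finite J'" using j0 insert.prems unfolding J'_def by auto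
    have "card I < card J'" using insert J by simp
    from insert.IH[OF J(3) this, of "\<lambda>i j. a i j - a i j0 * a i0 j / a i0 j0"]
    obtain c where c: "\<exists>j\<in>J'. c j \<noteq> 0"
      "\<And>i. i \<in> I \<Longrightarrow> (\<Sum>j\<in>J'. (a i j - a i j0 * a i0 j / a i0 j0) * c j) = 0"
      by auto
    define s where "s = (\<Sum>j\<in>J'. a i0 j * c j)"
    define c' where "c' = c(j0 := - s / a i0 j0)"
    have sum: "(\<Sum>j\<in>J. a i j * c' j) = (\<Sum>j\<in>J'. a i j * c j) - a i j0 * s / a i0 j0" for i
    proof -
      have "(\<Sum>j\<in>J'. a i j * c' j) = (\<Sum>j\<in>J'. a i j * c j)"
        using J unfolding c'_def by (intro sum.cong) auto
      then show ?thesis using J unfolding c'_def by simp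
    qed
    have "(\<Sum>j\<in>J. a i j * c' j) = 0" if "i \<in> insert i0 I" for i
    proof (cases "i = i0")
      case True
      then show ?thesis using j0 sum unfolding s_def by simp
    next
      case False
      have "(\<Sum>j\<in>J'. (a i j - a i j0 * a i0 j / a i0 j0) * c j)
          = (\<Sum>j\<in>J'. a i j * c j) - (\<Sum>j\<in>J'. a i j0 / a i0 j0 * (a i0 j * c j))"
        by (simp add: sum_subtractf[symmetric] algebra_simps)
      also have "(\<Sum>j\<in>J'. a i j0 / a i0 j0 * (a i0 j * c j)) = a i j0 * s / a i0 j0"
        unfolding s_def sum_distrib_left[symmetric] by simp
      finally show ?thesis using sum c(2)[of i] that False by simp
    qed
    moreover have "\<exists>j\<in>J. c' j \<noteq> 0" using c(1) J unfolding c'_def by auto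
    ultimately show ?thesis by blast
  qed
qed

text \<open>Solvability in the large domain descends to the subring S that contains the
  coefficients. This is Gaussian elimination without division: rows are cross-multiplied by the
  pivot. It later replaces a complex curve by one with coefficients in Z[zeta n].\<close>

lemma homogeneous_system_subring:
  fixes a :: "'i \<Rightarrow> 'j \<Rightarrow> 'a :: idom"
  assumes S: "0 \<in> S" "1 \<in> S" "\<And>x y. x \<in> S \<Longrightarrow> y \<in> S \<Longrightarrow> x + y \<in> S"
      "\<And>x y. x \<in> S \<Longrightarrow> y \<in> S \<Longrightarrow> x * y \<in> S" "\<And>x. x \<in> S \<Longrightarrow> - x \<in> S"
  assumes "finite J" "\<And>i j. i \<in> I \<Longrightarrow> j \<in> J \<Longrightarrow> a i j \<in> S"
    "\<exists>j\<in>J. c j \<noteq> 0" "\<And>i. i \<in> I \<Longrightarrow> (\<Sum>j\<in>J. a i j * c j) = 0"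
  shows "\<exists>c'. (\<forall>j\<in>J. c' j \<in> S) \<and> (\<exists>j\<in>J. c' j \<noteq> 0) \<and> (\<forall>i\<in>I. (\<Sum>j\<in>J. a i j * c' j) = 0)"
  using assms(6-)
proof (induction J arbitrary: a c rule: finite_induct)
  case empty
  then show ?case by simp
next
  case (insert j0 J)
  have Ssum: "sum f K \<in> S" if "finite K" "\<And>k. k \<in> K \<Longrightarrow> f k \<in> S" for f and K :: "'j set"
    using that by (induction K rule: finite_induct) (auto intro: S)
  show ?case
  proof (cases "\<forall>i\<in>I. a i j0 = 0")
    case True
    let ?c = "\<lambda>j. if j = j0 then 1 else 0"
    have "(\<Sum>j\<in>insert j0 J. a i j * ?c j) = 0" if "i \<in> I" for i
    proof (rule sum.neutral, rule)
      fix j show "a i j * ?c j = 0" using True that by auto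
    qed
    then show ?thesis using S(1,2) by (intro exI[of _ ?c]) auto
  next
    case False
    then obtain i0 where i0: "i0 \<in> I" "a i0 j0 \<noteq> 0" by auto
    define p where "p = a i0 j0"
    \<comment> \<open>Cross-multiplication with the pivot row eliminates \<open>j0\<close> within
      S.\<close>
    define b where "b = (\<lambda>i j. p * a i j + - (a i j0 * a i0 j))"
    have bsum: "(\<Sum>j\<in>J. b i j * d j) = p * (\<Sum>j\<in>J. a i j * d j) - a i j0 * (\<Sum>j\<in>J. a i0 j * d j)" for i d
      unfolding b_def by (simp add: sum_distrib_left sum_subtractf[symmetric] algebra_simps)
    have eqc: "(\<Sum>j\<in>J. a i j * c j) = - (a i j0 * c j0)" if "i \<in> I" for i
      using insert.prems(3)[OF that] insert.hyps by (simp add: eq_neg_iff_add_eq_0 add.commute)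
    have "(\<Sum>j\<in>J. b i j * c j) = 0" if "i \<in> I" for i
      unfolding bsum eqc[OF that] eqc[OF i0(1)] by (simp add: p_def algebra_simps)
    moreover have "\<exists>j\<in>J. c j \<noteq> 0"
    proof (rule ccontr)
      assume "\<not> (\<exists>j\<in>J. c j \<noteq> 0)"
      then have "(\<Sum>j\<in>J. a i0 j * c j) = 0" by (intro sum.neutral) auto
      then have "c j0 = 0" using eqc[OF i0(1)] i0(2) by simp
      then show False using insert.prems(2) \<open>\<not> (\<exists>j\<in>J. c j \<noteq> 0)\<close> by auto
    qed
    moreover have "b i j \<in> S" if "i \<in> I" "j \<in> J" for i j
      unfolding b_def p_def using that i0 insert.prems(1) by (intro S) auto
    ultimately obtain d where d: "\<And>j. j \<in> J \<Longrightarrow> d j \<in> S" "\<exists>j\<in>J. d j \<noteq> 0"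
      "\<And>i. i \<in> I \<Longrightarrow> (\<Sum>j\<in>J. b i j * d j) = 0"
      using insert.IH[of b c] by blast
    \<comment> \<open>Back-substitution: scaling the other unknowns by the pivot makes the value at
      \<open>j0\<close> free of division.\<close>
    define c' where "c' = (\<lambda>j. if j = j0 then - (\<Sum>j\<in>J. a i0 j * d j) else p * d j)"
    have c'J: "(\<Sum>j\<in>J. a i j * c' j) = p * (\<Sum>j\<in>J. a i j * d j)" for i
    proof -
      have "(\<Sum>j\<in>J. a i j * c' j) = (\<Sum>j\<in>J. p * (a i j * d j))"
        using insert.hyps unfolding c'_def by (intro sum.cong) auto
      then show ?thesis by (simp add: sum_distrib_left)
    qed
    have "(\<Sum>j\<in>insert j0 J. a i j * c' j) = 0" if "i \<in> I" for i
      using insert.hyps d(3)[OF that] unfolding bsum by (simp add: c'J) (simp add: c'_def)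
    moreover have "\<forall>j\<in>insert j0 J. c' j \<in> S"
      unfolding c'_def p_def using d(1) i0 insert.prems(1) insert.hyps
      by (auto intro!: S Ssum)
    moreover have "\<exists>j\<in>insert j0 J. c' j \<noteq> 0"
      using d(2) i0(2) insert.hyps unfolding c'_def p_def by auto
    ultimately show ?thesis by blast
  qed
qed

section \<open>Bivariate polynomials: coefficients, values and total degree\<close>

definition cf :: "'a::zero poly poly \<Rightarrow> nat \<Rightarrow> nat \<Rightarrow> 'a"
  where "cf p i j = coeff (coeff p j) i"

definition ev :: "'a::comm_ring_1 poly poly \<Rightarrow> 'a \<Rightarrow> 'a \<Rightarrow> 'a"
  where "ev p x y = poly (poly p [:y:]) x"

definition tdle :: "'a::zero poly poly \<Rightarrow> nat \<Rightarrow> bool"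
  where "tdle p m \<longleftrightarrow> (\<forall>i j. cf p i j \<noteq> 0 \<longrightarrow> i + j \<le> m)"

definition tri :: "nat \<Rightarrow> (nat \<times> nat) set" where "tri m = {(i, j). i + j \<le> m}"

definition con :: "'a::zero \<Rightarrow> 'a poly poly" where "con c = [:[:c:]:]"

definition mon :: "nat \<times> nat \<Rightarrow> 'a::comm_semiring_1 poly poly"
  where "mon u = Polynomial.monom (Polynomial.monom 1 (fst u)) (snd u)"

definition tp :: "(nat \<times> nat) set \<Rightarrow> (nat \<times> nat \<Rightarrow> 'a::comm_semiring_1) \<Rightarrow> 'a poly poly"
  where "tp J c = (\<Sum>u\<in>J. con (c u) * mon u)"

lemma ev_simps [simp]:
  "ev 0 x y = 0" "ev 1 x y = 1" "ev (p + q) x y = ev p x y + ev q x y"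
  "ev (p * q) x y = ev p x y * ev q x y" "ev (- p) x y = - ev p x y"
  "ev (p - q) x y = ev p x y - ev q x y"
  "ev (con c) x y = c" "ev (mon u) x y = x ^ fst u * y ^ snd u"
  unfolding ev_def con_def mon_def by (auto simp: poly_monom)

lemma ev_sum: "ev (\<Sum>i\<in>I. f i) x y = (\<Sum>i\<in>I. ev (f i) x y)"
  by (induction I rule: infinite_finite_induct) auto

lemma ev_prod: "ev (\<Prod>i\<in>I. f i) x y = (\<Prod>i\<in>I. ev (f i) x y)"
  by (induction I rule: infinite_finite_induct) auto

lemma ev_tp: "ev (tp J c) x y = (\<Sum>u\<in>J. c u * (x ^ fst u * y ^ snd u))"
  unfolding tp_def by (simp add: ev_sum)

lemma cf_0 [simp]: "cf 0 i j = 0" unfolding cf_def by simp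

lemma cf_add [simp]: "cf (p + q) i j = cf p i j + cf q i j" unfolding cf_def by simp

lemma cf_sum: "cf (\<Sum>k\<in>K. f k) i j = (\<Sum>k\<in>K. cf (f k) i j)"
  unfolding cf_def by (simp add: coeff_sum)

lemma cf_con_mult [simp]: "cf (con c * p) i j = c * cf p i j" for c :: "'a::comm_semiring_1"
  unfolding cf_def con_def by simp

lemma cf_mon: "cf (mon u) i j = (if u = (i, j) then 1 else 0)"
  unfolding cf_def mon_def by (cases u) auto

lemma cf_con: "cf (con c) i j = (if i = 0 \<and> j = 0 then c else 0)"
  unfolding cf_def con_def by (auto simp: coeff_pCons split: nat.splits)

lemma cf_tp: "finite J \<Longrightarrow> cf (tp J c) i j = (if (i, j) \<in> J then c (i, j) else 0)"
proof -
  assume J: "finite J"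
  have "cf (tp J c) i j = (\<Sum>u\<in>J. if (i, j) = u then c (i, j) else 0)"
    unfolding tp_def cf_sum by (intro sum.cong) (auto simp: cf_mon)
  then show ?thesis using J by simp
qed

lemma poly2_eqI: "(\<And>i j. cf p i j = cf q i j) \<Longrightarrow> p = q"
  unfolding cf_def by (simp add: poly_eq_iff)

lemma poly2_eq_0_iff: "p = 0 \<longleftrightarrow> (\<forall>i j. cf p i j = 0)"
  using poly2_eqI[of p 0] by auto

lemma finite_tri [simp]: "finite (tri m)"
  by (rule finite_subset[of _ "{..m} \<times> {..m}"]) (auto simp: tri_def)

lemma card_tri: "2 * card (tri m) = (m + 1) * (m + 2)"
proof (induction m)
  case 0
  have "tri 0 = {(0, 0)}" by (auto simp: tri_def)
  then show ?case by simp
next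
  case (Suc m)
  have "tri (Suc m) = tri m \<union> (\<lambda>i. (i, Suc m - i)) ` {..Suc m}"
    by (auto simp: tri_def image_iff)
  moreover have "tri m \<inter> (\<lambda>i. (i, Suc m - i)) ` {..Suc m} = {}" by (auto simp: tri_def)
  moreover have "card ((\<lambda>i. (i, Suc m - i)) ` {..Suc m}) = Suc m + 1"
    by (subst card_image) (auto simp: inj_on_def)
  ultimately have "card (tri (Suc m)) = card (tri m) + (Suc m + 1)"
    by (simp add: card_Un_disjoint)
  then show ?case using Suc by simp
qed

lemma tdle_tp: "J \<subseteq> tri m \<Longrightarrow> tdle (tp J c) m"
  unfolding tdle_def using finite_subset[OF _ finite_tri] by (auto simp: cf_tp tri_def)

lemma tp_of_tdle: "tdle p m \<Longrightarrow> p = tp (tri m) (\<lambda>u. cf p (fst u) (snd u))"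
  by (rule poly2_eqI) (use finite_tri[of m] in \<open>auto simp: cf_tp tdle_def tri_def\<close>)

lemma ev_tdle:
  "tdle p m \<Longrightarrow> ev p x y = (\<Sum>u\<in>tri m. cf p (fst u) (snd u) * (x ^ fst u * y ^ snd u))"
  by (subst tp_of_tdle) (auto simp: ev_tp)

lemma tdle_exists: "\<exists>m. tdle p m"
proof -
  define m where "m = degree p + Max ((\<lambda>j. degree (coeff p j)) ` {..degree p})"
  have "i + j \<le> m" if "cf p i j \<noteq> 0" for i j
  proof -
    have j: "j \<le> degree p" using that unfolding cf_def by (metis coeff_0 le_degree)
    have "i \<le> degree (coeff p j)" using that unfolding cf_def by (metis le_degree)
    also have "\<dots> \<le> Max ((\<lambda>j. degree (coeff p j)) ` {..degree p})" using j by (intro Max_ge) auto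
    finally show ?thesis using j unfolding m_def by simp
  qed
  then show ?thesis unfolding tdle_def by blast
qed

definition tdeg :: "'a::zero poly poly \<Rightarrow> nat" where "tdeg p = (LEAST m. tdle p m)"

lemma tdle_tdeg: "tdle p (tdeg p)"
  unfolding tdeg_def using tdle_exists by (rule LeastI_ex)

lemma tdeg_le: "tdle p m \<Longrightarrow> tdeg p \<le> m"
  unfolding tdeg_def by (rule Least_le)

lemma tdle_iff_tdeg: "tdle p m \<longleftrightarrow> tdeg p \<le> m"
  using tdle_tdeg[of p] tdeg_le[of p m] unfolding tdle_def by (meson le_trans)

text \<open>The leading monomial for the graded order with ties broken by the exponent of x. Leading
  monomials multiply over a domain, which yields additivity of \<open>tdeg\<close> and the choice of
  B in the Bezout bound.\<close>

definition is_top :: "'a::zero poly poly \<Rightarrow> nat \<times> nat \<Rightarrow> bool"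
  where "is_top p u \<longleftrightarrow> cf p (fst u) (snd u) \<noteq> 0 \<and>
     (\<forall>i j. cf p i j \<noteq> 0 \<longrightarrow> i + j < fst u + snd u \<or> i + j = fst u + snd u \<and> i \<le> fst u)"

lemma is_top_exists:
  assumes "p \<noteq> 0" obtains u where "is_top p u"
proof -
  obtain i0 j0 where 0: "cf p i0 j0 \<noteq> 0" using assms poly2_eq_0_iff[of p] by auto
  \<comment> \<open>The pair of total degree and exponent of x as a single number: the second entry
    is at most \<open>tdeg p\<close>, so \<open>tdeg p + 1\<close> is a large enough base.\<close>
  define wt where "wt = (\<lambda>v. (fst v + snd v) * (tdeg p + 1) + fst v)"
  have "\<exists>u. cf p (fst u) (snd u) \<noteq> 0 \<and> (\<forall>v. cf p (fst v) (snd v) \<noteq> 0 \<longrightarrow> wt v \<le> wt u)"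
  proof (rule ex_has_greatest_nat[where k = "(i0, j0)" and b = "tdeg p * (tdeg p + 1) + tdeg p + 1"])
    show "\<forall>v. cf p (fst v) (snd v) \<noteq> 0 \<longrightarrow> wt v < tdeg p * (tdeg p + 1) + tdeg p + 1"
    proof (intro allI impI)
      fix v assume "cf p (fst v) (snd v) \<noteq> 0"
      then have s: "fst v + snd v \<le> tdeg p" using tdle_tdeg[of p] unfolding tdle_def by auto
      then have "(fst v + snd v) * (tdeg p + 1) \<le> tdeg p * (tdeg p + 1)" by (intro mult_right_mono) auto
      then show "wt v < tdeg p * (tdeg p + 1) + tdeg p + 1"
        using s unfolding wt_def by simp
    qed
  qed (use 0 in auto)
  then obtain u where u: "cf p (fst u) (snd u) \<noteq> 0" and
    max: "\<And>v. cf p (fst v) (snd v) \<noteq> 0 \<Longrightarrow>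
      (fst v + snd v) * (tdeg p + 1) + fst v \<le> (fst u + snd u) * (tdeg p + 1) + fst u"
    unfolding wt_def by blast
  have "i + j < fst u + snd u \<or> i + j = fst u + snd u \<and> i \<le> fst u" if "cf p i j \<noteq> 0" for i j
  proof -
    have le: "(i + j) * (tdeg p + 1) + i \<le> (fst u + snd u) * (tdeg p + 1) + fst u"
      using max[of "(i, j)"] that by simp
    have fu: "fst u \<le> tdeg p" using tdle_tdeg[of p] u unfolding tdle_def by fastforce
    have "\<not> i + j > fst u + snd u"
    proof
      assume "i + j > fst u + snd u"
      then have "(fst u + snd u + 1) * (tdeg p + 1) \<le> (i + j) * (tdeg p + 1)"
        by (intro mult_right_mono) auto
      then show False using le fu by (simp add: algebra_simps)
    qed
    then show ?thesis using le by (cases "i + j = fst u + snd u") auto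
  qed
  then show ?thesis using u that unfolding is_top_def by blast
qed

lemma tdeg_is_top: "is_top p u \<Longrightarrow> tdeg p = fst u + snd u"
proof -
  assume u: "is_top p u"
  have "tdle p (fst u + snd u)" unfolding tdle_def
  proof (intro allI impI)
    fix i j assume "cf p i j \<noteq> 0"
    then have "i + j < fst u + snd u \<or> i + j = fst u + snd u \<and> i \<le> fst u"
      using u unfolding is_top_def by blast
    then show "i + j \<le> fst u + snd u" by auto
  qed
  moreover have "fst u + snd u \<le> tdeg p"
    using tdle_tdeg[of p] u unfolding tdle_def is_top_def by blast
  ultimately show ?thesis by (simp add: antisym tdeg_le)
qed

lemma cf_mult:
  "cf (p * q) i j = (\<Sum>v\<in>{..i} \<times> {..j}. cf p (fst v) (snd v) * cf q (i - fst v) (j - snd v))"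
proof -
  have "cf (p * q) i j = (\<Sum>j'\<le>j. \<Sum>i'\<le>i. cf p i' j' * cf q (i - i') (j - j'))"
    unfolding cf_def by (simp add: coeff_mult coeff_sum)
  also have "\<dots> = (\<Sum>i'\<le>i. \<Sum>j'\<le>j. cf p i' j' * cf q (i - i') (j - j'))"
    by (rule sum.swap)
  also have "\<dots> = (\<Sum>v\<in>{..i} \<times> {..j}. cf p (fst v) (snd v) * cf q (i - fst v) (j - snd v))"
    by (simp add: sum.cartesian_product case_prod_unfold)
  finally show ?thesis .
qed

text \<open>The order is total and compatible with addition of exponents, so exactly one product of
  monomials reaches the sum of the two leading exponents and nothing can cancel it.\<close>

lemma is_top_mult:
  fixes p q :: "'a :: idom poly poly"
  assumes p: "is_top p u" and q: "is_top q v"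
  shows "is_top (p * q) (fst u + fst v, snd u + snd v)"
proof -
  let ?i = "fst u + fst v" and ?j = "snd u + snd v"
  have "cf (p * q) ?i ?j = (\<Sum>w\<in>{..?i} \<times> {..?j}. if w = u then cf p (fst u) (snd u) * cf q (fst v) (snd v) else 0)"
    unfolding cf_mult
  proof (rule sum.cong[OF refl])
    fix w assume w: "w \<in> {..?i} \<times> {..?j}"
    show "cf p (fst w) (snd w) * cf q (?i - fst w) (?j - snd w) =
       (if w = u then cf p (fst u) (snd u) * cf q (fst v) (snd v) else 0)"
    proof (cases "w = u")
      case False
      have "cf p (fst w) (snd w) = 0 \<or> cf q (?i - fst w) (?j - snd w) = 0"
      proof (rule ccontr)
        assume a: "\<not> ?thesis"
        then have nz: "cf p (fst w) (snd w) \<noteq> 0" "cf q (?i - fst w) (?j - snd w) \<noteq> 0" by auto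
        from nz(1) have 1: "fst w + snd w < fst u + snd u \<or> fst w + snd w = fst u + snd u \<and> fst w \<le> fst u"
          using p unfolding is_top_def by blast
        from nz(2) have 2: "?i - fst w + (?j - snd w) < fst v + snd v \<or>
           ?i - fst w + (?j - snd w) = fst v + snd v \<and> ?i - fst w \<le> fst v"
          using q unfolding is_top_def by blast
        have "fst w \<le> ?i" "snd w \<le> ?j" using w by auto
        with 1 2 have "fst w = fst u \<and> snd w = snd u" by linarith
        then show False using False by (simp add: prod_eq_iff)
      qed
      then show ?thesis using False by auto
    qed auto
  qed
  also have "\<dots> = cf p (fst u) (snd u) * cf q (fst v) (snd v)"
    by (cases u) simp
  finally have nz: "cf (p * q) ?i ?j \<noteq> 0" using p q unfolding is_top_def by simp
  have "i + j < ?i + ?j \<or> i + j = ?i + ?j \<and> i \<le> ?i" if cfnz: "cf (p * q) i j \<noteq> 0" for i j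
  proof -
    obtain w where w: "w \<in> {..i} \<times> {..j}" "cf p (fst w) (snd w) * cf q (i - fst w) (j - snd w) \<noteq> 0"
      using sum.not_neutral_contains_not_neutral[OF cfnz[unfolded cf_mult]] by blast
    then have nz: "cf p (fst w) (snd w) \<noteq> 0" "cf q (i - fst w) (j - snd w) \<noteq> 0" by auto
    from nz(1) have 1: "fst w + snd w < fst u + snd u \<or> fst w + snd w = fst u + snd u \<and> fst w \<le> fst u"
      using p unfolding is_top_def by blast
    from nz(2) have 2: "i - fst w + (j - snd w) < fst v + snd v \<or>
           i - fst w + (j - snd w) = fst v + snd v \<and> i - fst w \<le> fst v"
      using q unfolding is_top_def by blast
    have "fst w \<le> i" "snd w \<le> j" using w(1) by auto
    with 1 2 show ?thesis by linarith
  qed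
  then show ?thesis using nz unfolding is_top_def by auto
qed

lemma tdeg_mult:
  fixes p q :: "'a :: idom poly poly"
  assumes "p \<noteq> 0" "q \<noteq> 0" shows "tdeg (p * q) = tdeg p + tdeg q"
proof -
  obtain u where u: "is_top p u" using assms(1) by (rule is_top_exists)
  obtain v where v: "is_top q v" using assms(2) by (rule is_top_exists)
  show ?thesis
    using tdeg_is_top[OF u] tdeg_is_top[OF v] tdeg_is_top[OF is_top_mult[OF u v]] by simp
qed

lemma tdle_mult:
  fixes p q :: "'a :: idom poly poly"
  assumes "tdle p m" "tdle q k" shows "tdle (p * q) (m + k)"
proof (cases "p = 0 \<or> q = 0")
  case True
  then show ?thesis by (auto simp: tdle_def)
next
  case False
  then show ?thesis using assms unfolding tdle_iff_tdeg by (simp add: tdeg_mult)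
qed

text \<open>Bezout by a dimension count, without resultants or multiplicities. Given N = d * e + 1
  common zeros, three families are placed in the space of polynomials of degree at most m: multiples
  of f, multiples of g by the monomials in B, and one polynomial L P for each zero P that is nonzero
  at P only. There are too many of them, so a relation exists. Evaluation at the zeros removes the L
  P, which leaves a * f + b * g = 0; then f divides b, and B is chosen so that b = 0.\<close>

lemma bezout_prime:
  fixes f g :: "complex poly poly"
  assumes f: "prime_elem f" and ndvd: "\<not> f dvd g" and g: "tdle g e"
    and S: "finite S" "\<And>P. P \<in> S \<Longrightarrow> ev f (fst P) (snd P) = 0 \<and> ev g (fst P) (snd P) = 0"
  shows "card S \<le> tdeg f * e"
proof (rule ccontr)
  assume contra: "\<not> card S \<le> tdeg f * e"
  define d where "d = tdeg f"
  define N where "N = d * e + 1"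
  have "N \<le> card S" using contra unfolding N_def d_def by simp
  then obtain S0 where S0: "S0 \<subseteq> S" "card S0 = N" "finite S0"
    using obtain_subset_with_card_n by metis
  define m where "m = N + d + e"
  have f0: "f \<noteq> 0" using f by auto
  obtain t where t: "is_top f t" using f0 is_top_exists by blast
  have td: "fst t + snd t = d" using tdeg_is_top[OF t] unfolding d_def by simp
  \<comment> \<open>The monomials of degree at most N + d that are divisible by the leading monomial
    of f.\<close>
  define sh where "sh = (\<lambda>u. (fst t + fst u, snd t + snd u)) ` tri N"
  define A where "A = tri (N + e)"
  define B where "B = tri (N + d) - sh"
  have shsub: "sh \<subseteq> tri (N + d)" using td unfolding sh_def tri_def by auto
  have finB: "finite B" and finA: "finite A" unfolding A_def B_def by auto
  \<comment> \<open>A vertical or horizontal line through Q that avoids P, for distinct P and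
    Q.\<close>
  define sep :: "complex \<times> complex \<Rightarrow> complex \<times> complex \<Rightarrow> complex poly poly" where
    "sep = (\<lambda>P Q. if fst P \<noteq> fst Q then mon (1, 0) + con (- fst Q) else mon (0, 1) + con (- snd Q))"
  define L where "L = (\<lambda>P. \<Prod>Q\<in>S0 - {P}. sep P Q)"
  have tdsep: "tdle (sep P Q) 1" for P Q
    unfolding sep_def tdle_def by (auto simp: cf_mon cf_con split: if_splits)
  have tdL: "tdle (L P) m" for P
  proof -
    have "tdle (\<Prod>Q\<in>K. sep P Q) (card K)" if "finite K" for K
      using that
    proof (induction K rule: finite_induct)
      case empty
      have "cf (1 :: complex poly poly) i j = (if i = 0 \<and> j = 0 then 1 else 0)" for i j
        using cf_con[of "1::complex" i j] by (simp add: con_def pCons_one)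
      then show ?case by (auto simp: tdle_def split: if_splits)
    next
      case (insert Q K)
      then show ?case using tdle_mult[OF tdsep, of _ "card K"] by simp
    qed
    from this[of "S0 - {P}"] have "tdeg (L P) \<le> card (S0 - {P})"
      unfolding L_def tdle_iff_tdeg using S0(3) by simp
    also have "\<dots> \<le> m" using card_mono[of S0 "S0 - {P}"] S0 unfolding m_def by auto
    finally show ?thesis unfolding tdle_iff_tdeg .
  qed
  have evsep: "ev (sep P Q) (fst P) (snd P) \<noteq> 0" if "P \<noteq> Q" for P Q
  proof (cases "fst P = fst Q")
    case True
    then have "snd P \<noteq> snd Q" using that by (simp add: prod_eq_iff)
    then show ?thesis using True unfolding sep_def by simp
  qed (simp add: sep_def)
  have evL: "ev (L P) (fst P) (snd P) \<noteq> 0" if "P \<in> S0" for P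
  proof -
    have "\<not> (\<exists>Q\<in>S0 - {P}. ev (sep P Q) (fst P) (snd P) = 0)"
    proof
      assume "\<exists>Q\<in>S0 - {P}. ev (sep P Q) (fst P) (snd P) = 0"
      then obtain Q where "Q \<in> S0 - {P}" "ev (sep P Q) (fst P) (snd P) = 0" ..
      then show False using evsep[of P Q] by (metis DiffD2 singletonI)
    qed
    moreover have "finite (S0 - {P})" using S0(3) by (rule finite_Diff)
    ultimately show ?thesis unfolding L_def ev_prod by (simp only: prod_zero_iff not_False_eq_True)
  qed
  have evL0: "ev (L Q) (fst P) (snd P) = 0" if "P \<in> S0" "P \<noteq> Q" for P Q
  proof -
    have "ev (sep Q P) (fst P) (snd P) = 0" unfolding sep_def by simp
    then have "\<exists>R\<in>S0 - {Q}. ev (sep Q R) (fst P) (snd P) = 0"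
      using that by (intro bexI[of _ P] DiffI) auto
    moreover have "finite (S0 - {Q})" using S0(3) by (rule finite_Diff)
    ultimately show ?thesis unfolding L_def ev_prod by (simp only: prod_zero_iff)
  qed
  define J where "J = Inl ` (Inl ` A \<union> Inr ` B) \<union> Inr ` S0"
  define h :: "((nat \<times> nat) + (nat \<times> nat)) + (complex \<times> complex) \<Rightarrow> complex poly poly"
    where "h = (\<lambda>j. case j of Inl (Inl u) \<Rightarrow> mon u * f | Inl (Inr u) \<Rightarrow> mon u * g | Inr P \<Rightarrow> L P)"
  have finJ: "finite J" unfolding J_def using finA finB S0(3) by auto
  have "card J = card (Inl ` A \<union> Inr ` B) + card S0"
    unfolding J_def using finA finB S0(3)
    by (subst card_Un_disjoint) (auto simp: card_image)
  also have "card (Inl ` A \<union> Inr ` B) = card A + card B"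
    using finA finB by (subst card_Un_disjoint) (auto simp: card_image)
  finally have cJ: "card J = card A + card B + N" using S0 by simp
  have csh: "card sh = card (tri N)" unfolding sh_def
    by (rule card_image) (auto simp: inj_on_def prod_eq_iff)
  have cB: "card B + card (tri N) = card (tri (N + d))"
    using card_Diff_subset[of sh "tri (N + d)"] card_mono[OF finite_tri shsub] shsub csh
      finite_subset[OF shsub finite_tri] unfolding B_def by simp
  have "2 * card J + 2 * card (tri N) = 2 * card (tri (N + e)) + 2 * card (tri (N + d)) + 2 * N"
    using cJ cB unfolding A_def by simp
  then have "2 * card J + (N + 1) * (N + 2) = (N + e + 1) * (N + e + 2) + (N + d + 1) * (N + d + 2) + 2 * N"
    unfolding card_tri .
  moreover have "2 * card (tri m) = (N + d + e + 1) * (N + d + e + 2)"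
    unfolding card_tri m_def ..
  \<comment> \<open>With this identity the number of polynomials exceeds the dimension by N - d * e
    = 1.\<close>
  moreover have "(N + d + e + 1) * (N + d + e + 2) + (N + 1) * (N + 2)
     = (N + e + 1) * (N + e + 2) + (N + d + 1) * (N + d + 2) + 2 * (d * e)"
    by (simp add: algebra_simps)
  moreover have "d * e < N" unfolding N_def by simp
  ultimately have "card (tri m) < card J" by linarith
  from homogeneous_system_nontrivial[OF finite_tri finJ this, of "\<lambda>u j. cf (h j) (fst u) (snd u)"]
  obtain c where c: "\<exists>j\<in>J. c j \<noteq> 0"
    "\<And>u. u \<in> tri m \<Longrightarrow> (\<Sum>j\<in>J. cf (h j) (fst u) (snd u) * c j) = 0" by blast
  have tdmon: "tdle (mon u :: complex poly poly) k" if "u \<in> tri k" for u k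
    using that unfolding tdle_def tri_def by (auto simp: cf_mon split: if_splits)
  have tdh: "tdle (h j) m" if j: "j \<in> J" for j
  proof -
    have "tdle (mon u * f) m" if "u \<in> A" for u
    proof -
      have "tdle (mon u * f) ((N + e) + d)"
        using that tdle_tdeg[of f] unfolding A_def d_def by (intro tdle_mult tdmon)
      then show ?thesis unfolding m_def by (simp add: add_ac)
    qed
    moreover have "tdle (mon u * g) m" if "u \<in> B" for u
      using that g unfolding B_def m_def by (intro tdle_mult tdmon) auto
    ultimately show ?thesis using j tdL unfolding J_def h_def by auto
  qed
  have Z: "(\<Sum>j\<in>J. con (c j) * h j) = 0"
  proof (rule poly2_eqI)
    fix i j
    show "cf (\<Sum>j\<in>J. con (c j) * h j) i j = cf 0 i j"
    proof (cases "(i, j) \<in> tri m")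
      case True
      have "(\<Sum>k\<in>J. c k * cf (h k) i j) = (\<Sum>k\<in>J. cf (h k) i j * c k)"
        by (intro sum.cong refl) (rule mult.commute)
      then show ?thesis using c(2)[OF True] by (simp add: cf_sum)
    next
      case False
      then have "cf (h k) i j = 0" if "k \<in> J" for k
        using tdh[OF that] unfolding tdle_def tri_def by auto
      then show ?thesis by (simp add: cf_sum)
    qed
  qed
  define a where "a = tp A (\<lambda>u. c (Inl (Inl u)))"
  define b where "b = tp B (\<lambda>u. c (Inl (Inr u)))"
  have split: "(\<Sum>j\<in>J. con (c j) * h j) = a * f + b * g + (\<Sum>P\<in>S0. con (c (Inr P)) * L P)"
  proof -
    have "(\<Sum>j\<in>J. con (c j) * h j) = (\<Sum>j\<in>Inl ` (Inl ` A \<union> Inr ` B). con (c j) * h j)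
        + (\<Sum>j\<in>Inr ` S0. con (c j) * h j)"
      unfolding J_def using finA finB S0(3) by (intro sum.union_disjoint) auto
    also have "(\<Sum>j\<in>Inl ` (Inl ` A \<union> Inr ` B). con (c j) * h j)
        = (\<Sum>j\<in>Inl ` A \<union> Inr ` B. con (c (Inl j)) * h (Inl j))"
      by (simp add: sum.reindex)
    also have "\<dots> = (\<Sum>j\<in>Inl ` A. con (c (Inl j)) * h (Inl j)) + (\<Sum>j\<in>Inr ` B. con (c (Inl j)) * h (Inl j))"
      using finA finB by (intro sum.union_disjoint) auto
    also have "\<dots> = a * f + b * g"
      unfolding a_def b_def tp_def h_def by (simp add: sum.reindex sum_distrib_right mult.assoc)
    finally show ?thesis by (simp add: sum.reindex h_def)
  qed
  have cP: "c (Inr P) = 0" if P: "P \<in> S0" for P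
  proof -
    have "0 = ev (\<Sum>j\<in>J. con (c j) * h j) (fst P) (snd P)" using Z by simp
    also have "\<dots> = (\<Sum>Q\<in>S0. c (Inr Q) * ev (L Q) (fst P) (snd P))"
      unfolding split using S(2)[of P] P S0(1) by (auto simp: ev_sum)
    also have "\<dots> = (\<Sum>Q\<in>S0. if Q = P then c (Inr P) * ev (L P) (fst P) (snd P) else 0)"
      using evL0[OF P] by (intro sum.cong) auto
    also have "\<dots> = c (Inr P) * ev (L P) (fst P) (snd P)" using P S0(3) by simp
    finally show ?thesis using evL[OF P] by simp
  qed
  then have "(\<Sum>P\<in>S0. con (c (Inr P)) * L P) = 0"
    by (intro sum.neutral) (auto simp: con_def)
  then have ab: "a * f + b * g = 0" using Z split by simp
  then have bg: "b * g = f * (- a)" by (simp add: algebra_simps add_eq_0_iff2)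
  then have "f dvd b * g" by simp
  then have "f dvd b" using f ndvd by (simp add: prime_elem_dvd_mult_iff)
  then obtain q where q: "b = f * q" by (elim dvdE)
  \<comment> \<open>A nonzero multiple of f has a leading monomial divisible by that of f, but B
    contains no such monomial.\<close>
  have "b = 0"
  proof (rule ccontr)
    assume b0: "b \<noteq> 0"
    then have "q \<noteq> 0" using q by auto
    then obtain v where v: "is_top q v" using is_top_exists by blast
    have tv: "is_top b (fst t + fst v, snd t + snd v)" unfolding q by (rule is_top_mult[OF t v])
    have inB: "(fst t + fst v, snd t + snd v) \<in> B"
      using tv finB unfolding is_top_def b_def by (auto simp: cf_tp split: if_splits)
    then have "v \<in> tri N" using td unfolding B_def tri_def by (cases v) auto
    then have "(fst t + fst v, snd t + snd v) \<in> sh" unfolding sh_def by auto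
    then show False using inB unfolding B_def by auto
  qed
  then have "a = 0" using ab f0 by simp
  have "c (Inl (Inl u)) = 0" if "u \<in> A" for u
    using cf_tp[OF finA, of "\<lambda>u. c (Inl (Inl u))" "fst u" "snd u"] that \<open>a = 0\<close> unfolding a_def by simp
  moreover have "c (Inl (Inr u)) = 0" if "u \<in> B" for u
    using cf_tp[OF finB, of "\<lambda>u. c (Inl (Inr u))" "fst u" "snd u"] that \<open>b = 0\<close> unfolding b_def by simp
  ultimately show False using c(1) cP unfolding J_def by auto
qed

subsection \<open>Translations of plane curves by torsion points\<close>

text \<open>Componentwise multiplication of points. It makes \<open>P ^ n = 1\<close> the statement
  that P is a torsion point of the torus.\<close>

instantiation prod :: (comm_monoid_mult, comm_monoid_mult) comm_monoid_mult
begin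
definition times_prod_def: "P * Q = (fst P * fst Q, snd P * snd Q)"
definition one_prod_def: "1 = (1, 1)"
instance by standard (simp_all add: times_prod_def one_prod_def mult_ac)
end

lemma fst_times [simp]: "fst (P * Q) = fst P * fst Q"
  and snd_times [simp]: "snd (P * Q) = snd P * snd Q"
  and fst_one [simp]: "fst 1 = 1"
  and snd_one [simp]: "snd 1 = 1"
  by (simp_all add: times_prod_def one_prod_def)

lemma fst_power [simp]: "fst (P ^ k) = fst P ^ k"
  and snd_power [simp]: "snd (P ^ k) = snd P ^ k"
  by (induction k) simp_all

type_synonym cpt = "complex \<times> complex"

definition mv :: "cpt \<Rightarrow> nat \<times> nat \<Rightarrow> complex"
  where "mv P u = fst P ^ fst u * snd P ^ snd u"

lemma mv_simps [simp]: "mv (P * Q) u = mv P u * mv Q u" "mv 1 u = 1" "mv (P ^ k) u = mv P u ^ k"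
  unfolding mv_def by (simp_all add: power_mult_distrib mult_ac flip: power_mult)

definition cfp :: "complex poly poly \<Rightarrow> nat \<times> nat \<Rightarrow> complex"
  where "cfp p u = cf p (fst u) (snd u)"

definition pv :: "complex poly poly \<Rightarrow> cpt \<Rightarrow> complex"
  where "pv p P = ev p (fst P) (snd P)"

lemma pv_simps [simp]:
  "pv 0 P = 0" "pv 1 P = 1" "pv (p + q) P = pv p P + pv q P" "pv (p * q) P = pv p P * pv q P"
  "pv (con c) P = c" "pv (mon u) P = mv P u"
  unfolding pv_def mv_def by simp_all

lemma pv_sum: "pv (\<Sum>i\<in>I. f i) P = (\<Sum>i\<in>I. pv (f i) P)"
  unfolding pv_def by (rule ev_sum)

lemma pv_tdle: "tdle p d \<Longrightarrow> pv p P = (\<Sum>u\<in>tri d. cfp p u * mv P u)"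
  unfolding pv_def cfp_def mv_def by (rule ev_tdle)

lemma cfp_eqI: "(\<And>u. cfp p u = cfp q u) \<Longrightarrow> p = q"
  unfolding cfp_def by (rule poly2_eqI) (metis fst_conv snd_conv)

lemma cfp_0 [simp]: "cfp 0 u = 0" and cfp_con_mult [simp]: "cfp (con c * p) u = c * cfp p u"
  unfolding cfp_def by simp_all

lemma cfp_nonzero_iff: "p \<noteq> 0 \<longleftrightarrow> (\<exists>u. cfp p u \<noteq> 0)"
  using cfp_eqI[of p 0] by auto

lemma cfp_tp: "finite J \<Longrightarrow> cfp (tp J c) u = (if u \<in> J then c u else 0)"
  unfolding cfp_def by (simp add: cf_tp)

lemma pv_tp: "pv (tp J c) P = (\<Sum>u\<in>J. c u * mv P u)"
  unfolding pv_def mv_def by (rule ev_tp)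

lemma tdle_cfp: "tdle p d \<longleftrightarrow> (\<forall>u. cfp p u \<noteq> 0 \<longrightarrow> u \<in> tri d)"
  unfolding tdle_def cfp_def tri_def by auto

lemma cfp_tdeg: "cfp p u \<noteq> 0 \<Longrightarrow> u \<in> tri (tdeg p)"
  using tdle_tdeg[of p] unfolding tdle_cfp by blast

lemma pv_eqI:
  assumes "\<And>P. pv p P = pv q P" shows "p = q"
proof -
  have 1: "poly (p - q) [:y:] = 0" for y
  proof (rule ccontr)
    assume "poly (p - q) [:y:] \<noteq> 0"
    then have "finite {x. poly (poly (p - q) [:y:]) x = 0}" by (rule poly_roots_finite)
    moreover have "poly (poly p [:y:]) x = poly (poly q [:y:]) x" for x
      using assms[of "(x, y)"] unfolding pv_def ev_def by simp
    then have "{x. poly (poly (p - q) [:y:]) x = 0} = UNIV" by simp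
    ultimately show False using infinite_UNIV_char_0[where 'a = complex] by simp
  qed
  have "p - q = 0"
  proof (rule ccontr)
    assume "p - q \<noteq> 0"
    then have "finite {r. poly (p - q) r = 0}" by (rule poly_roots_finite)
    moreover have "range (\<lambda>y::complex. [:y:]) \<subseteq> {r. poly (p - q) r = 0}" using 1 by blast
    ultimately have "finite (range (\<lambda>y::complex. [:y:]))" by (rule finite_subset[rotated])
    moreover have "inj (\<lambda>y::complex. [:y:])" by (auto simp: inj_on_def)
    ultimately show False using infinite_UNIV_char_0[where 'a = complex] finite_imageD by blast
  qed
  then show ?thesis by simp
qed

section \<open>Translation of curves and equality of curves up to a scalar\<close>

text \<open>The substitution of \<alpha> * P for P, written on coefficients so that the support is
  visibly preserved for invertible \<alpha>.\<close>

definition translate :: "cpt \<Rightarrow> complex poly poly \<Rightarrow> complex poly poly"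
  where "translate \<alpha> p = tp (tri (tdeg p)) (\<lambda>u. cfp p u * mv \<alpha> u)"

lemma cfp_translate [simp]: "cfp (translate \<alpha> p) u = cfp p u * mv \<alpha> u"
  unfolding translate_def using cfp_tdeg[of p u] by (auto simp: cfp_tp)

lemma pv_translate [simp]: "pv (translate \<alpha> p) P = pv p (\<alpha> * P)"
  unfolding translate_def pv_tp pv_tdle[OF tdle_tdeg[of p]] by (simp add: mult_ac)

lemma translate_mult: "translate \<alpha> (p * q) = translate \<alpha> p * translate \<alpha> q"
  by (rule pv_eqI) simp

lemma translate_translate: "translate \<alpha> (translate \<beta> p) = translate (\<alpha> * \<beta>) p"
  by (rule cfp_eqI) simp

lemma translate_one [simp]: "translate 1 p = p"
  by (rule cfp_eqI) simp

lemma translate_con_mult: "translate \<alpha> (con c * p) = con c * translate \<alpha> p"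
  by (rule cfp_eqI) simp

lemma tdle_translate: "tdle p d \<Longrightarrow> tdle (translate \<alpha> p) d"
  unfolding tdle_cfp by auto

definition mvnz :: "cpt \<Rightarrow> bool" where "mvnz P \<longleftrightarrow> fst P \<noteq> 0 \<and> snd P \<noteq> 0"

lemma mv_nonzero: "mvnz P \<Longrightarrow> mv P u \<noteq> 0"
  unfolding mvnz_def mv_def by simp

lemma root_of_unity_mvnz: "P ^ n = 1 \<Longrightarrow> n > 0 \<Longrightarrow> mvnz P"
  unfolding mvnz_def by (auto simp: prod_eq_iff zero_power)

definition pinv :: "cpt \<Rightarrow> cpt" where "pinv P = (inverse (fst P), inverse (snd P))"

lemma pinv_mult [simp]: "mvnz P \<Longrightarrow> pinv P * P = 1" "mvnz P \<Longrightarrow> P * pinv P = 1"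
  unfolding pinv_def mvnz_def by (simp_all add: prod_eq_iff)

lemma pinv_mult_assoc [simp]: "mvnz P \<Longrightarrow> pinv P * (P * Q) = Q" "mvnz P \<Longrightarrow> P * (pinv P * Q) = Q"
  by (simp_all flip: mult.assoc)

lemma pinv_power_one: "P ^ n = 1 \<Longrightarrow> pinv P ^ n = 1"
  by (auto simp: prod_eq_iff pinv_def power_inverse)

lemma supp_translate: "mvnz \<alpha> \<Longrightarrow> {u. cfp (translate \<alpha> p) u \<noteq> 0} = {u. cfp p u \<noteq> 0}"
  using mv_nonzero by auto

lemma translate_nonzero: "mvnz \<alpha> \<Longrightarrow> p \<noteq> 0 \<Longrightarrow> translate \<alpha> p \<noteq> 0"
  unfolding cfp_nonzero_iff using mv_nonzero by auto

lemma tdeg_translate: "mvnz \<alpha> \<Longrightarrow> tdeg (translate \<alpha> p) = tdeg p"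
  unfolding tdeg_def tdle_cfp using mv_nonzero by simp

lemma prime_elem_translate:
  assumes "mvnz \<alpha>" "prime_elem f" shows "prime_elem (translate \<alpha> f)"
proof -
  have inv: "translate (pinv \<alpha>) (translate \<alpha> p) = p" "translate \<alpha> (translate (pinv \<alpha>) p) = p" for p
    using assms(1) by (simp_all add: translate_translate)
  have unit: "translate \<beta> 1 = 1" for \<beta> by (rule pv_eqI) simp
  have dvd: "translate \<beta> p dvd translate \<beta> q" if "p dvd q" for \<beta> p q
    using that by (auto simp: translate_mult elim!: dvdE)
  show ?thesis
  proof (rule prime_elemI)
    show "translate \<alpha> f \<noteq> 0" using translate_nonzero[OF assms(1)] assms(2) by auto
    show "\<not> is_unit (translate \<alpha> f)"
    proof
      assume "is_unit (translate \<alpha> f)"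
      then have "is_unit f" using dvd[of "translate \<alpha> f" 1 "pinv \<alpha>"] unit inv by metis
      then show False using assms(2) by auto
    qed
    fix a b assume "translate \<alpha> f dvd a * b"
    then have "f dvd translate (pinv \<alpha>) a * translate (pinv \<alpha>) b"
      using dvd[of "translate \<alpha> f" "a * b" "pinv \<alpha>"] inv by (simp add: translate_mult)
    then have "f dvd translate (pinv \<alpha>) a \<or> f dvd translate (pinv \<alpha>) b"
      using assms(2) by (rule prime_elem_dvd_multD[rotated])
    then show "translate \<alpha> f dvd a \<or> translate \<alpha> f dvd b" using dvd inv by metis
  qed
qed

definition proportional :: "complex poly poly \<Rightarrow> complex poly poly \<Rightarrow> bool"
  where "proportional p q \<longleftrightarrow> (\<exists>c. c \<noteq> 0 \<and> q = con c * p)"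

lemma con_mult_con: "con a * con b = con (a * b :: complex)"
  unfolding con_def by simp

lemma con_one [simp]: "con (1 :: complex) = 1"
  unfolding con_def by (simp add: pCons_one)

lemma proportional_refl [simp]: "proportional p p"
  unfolding proportional_def by (intro exI[of _ 1]) simp

lemma proportional_sym: "proportional p q \<Longrightarrow> proportional q p"
  unfolding proportional_def
  by (elim exE conjE, rule_tac x = "inverse c" in exI) (simp add: con_mult_con mult.assoc[symmetric])

lemma proportional_trans: "proportional p q \<Longrightarrow> proportional q r \<Longrightarrow> proportional p r"
  unfolding proportional_def
  by (elim exE conjE, rule_tac x = "ca * c" in exI) (simp add: con_mult_con mult.assoc[symmetric])

lemma proportional_translate: "proportional p q \<Longrightarrow> proportional (translate \<alpha> p) (translate \<alpha> q)"
  unfolding proportional_def by (auto simp: translate_con_mult)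

lemma proportional_pv: "proportional p q \<Longrightarrow> pv q P = 0 \<longleftrightarrow> pv p P = 0"
  unfolding proportional_def by auto

text \<open>Cross products of coefficients stay in Z[zeta n] although the scalar need not lie there;
  in this form proportionality can be carried through \<open>galois\<close>.\<close>

lemma proportional_crossI:
  assumes "p \<noteq> 0" "q \<noteq> 0" "\<And>u v. cfp p u * cfp q v = cfp p v * cfp q u"
  shows "proportional p q"
proof -
  obtain v where v: "cfp q v \<noteq> 0" using assms(2) cfp_nonzero_iff by blast
  have pv: "cfp p v \<noteq> 0"
  proof
    assume "cfp p v = 0"
    then have "cfp p u = 0" for u using assms(3)[of u v] v by simp
    then show False using assms(1) cfp_nonzero_iff by blast
  qed
  have "q = con (cfp q v / cfp p v) * p"
  proof (rule cfp_eqI)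
    fix u
    show "cfp q u = cfp (con (cfp q v / cfp p v) * p) u"
      using assms(3)[of u v] pv unfolding cfp_con_mult by (simp add: field_simps)
  qed
  then show ?thesis unfolding proportional_def using v pv by (intro exI[of _ "cfp q v / cfp p v"]) simp
qed

lemma proportional_crossD: "proportional p q \<Longrightarrow> cfp p u * cfp q v = cfp p v * cfp q u"
  unfolding proportional_def by auto

lemma tdeg_zero_con: "tdle q 0 \<Longrightarrow> q = con (cfp q (0, 0))"
  by (rule poly2_eqI) (auto simp: tdle_def cf_con cfp_def)

lemma dvd_proportional:
  assumes "f dvd g" "g \<noteq> 0" "tdle g (tdeg f)"
  shows "proportional f g"
proof -
  obtain q where q: "g = f * q" using assms(1) by (elim dvdE)
  then have nz: "f \<noteq> 0" "q \<noteq> 0" using assms(2) by auto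
  then have "tdeg f + tdeg q \<le> tdeg f" using assms(3) q by (simp add: tdeg_mult tdle_iff_tdeg)
  then have "tdle q 0" unfolding tdle_iff_tdeg by simp
  then obtain c where c: "q = con c" using tdeg_zero_con by blast
  then have "c \<noteq> 0" using nz(2) by (auto simp: con_def)
  then show ?thesis unfolding proportional_def q c by (intro exI[of _ c]) (simp add: mult.commute)
qed

definition square_subst :: "complex poly poly \<Rightarrow> complex poly poly"
  where "square_subst p = (\<Sum>u\<in>tri (tdeg p). con (cfp p u) * mon (2 * fst u, 2 * snd u))"

lemma pv_square_subst [simp]: "pv (square_subst p) P = pv p (P ^ 2)"
proof -
  have "mv P (2 * fst u, 2 * snd u) = (mv P u)\<^sup>2" for u
    unfolding mv_def by (simp add: power_mult_distrib flip: power_mult) (simp add: mult.commute)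
  then show ?thesis unfolding square_subst_def pv_sum pv_tdle[OF tdle_tdeg[of p]] by simp
qed

lemma tdle_square_subst: "tdle p d \<Longrightarrow> tdle (square_subst p) (2 * d)"
proof -
  assume d: "tdle p d"
  have "i + j \<le> 2 * d" if nz: "cf (square_subst p) i j \<noteq> 0" for i j
  proof -
    obtain u where u: "u \<in> tri (tdeg p)" "cf (con (cfp p u) * mon (2 * fst u, 2 * snd u)) i j \<noteq> 0"
      using sum.not_neutral_contains_not_neutral[OF nz[unfolded square_subst_def cf_sum]] by blast
    then have "cfp p u \<noteq> 0" "i = 2 * fst u" "j = 2 * snd u" by (auto simp: cf_mon split: if_splits)
    then show ?thesis using d unfolding tdle_def cfp_def by (metis distrib_left mult_le_mono2)
  qed
  then show ?thesis unfolding tdle_def by blast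
qed

lemma square_subst_nonzero: "p \<noteq> 0 \<Longrightarrow> square_subst p \<noteq> 0"
proof
  assume "p \<noteq> 0" "square_subst p = 0"
  have "pv p P = pv 0 P" for P
  proof -
    have "P = (csqrt (fst P), csqrt (snd P)) ^ 2" by (simp add: prod_eq_iff)
    then show ?thesis using pv_square_subst[of p "(csqrt (fst P), csqrt (snd P))"] \<open>square_subst p = 0\<close> by simp
  qed
  then have "p = 0" by (rule pv_eqI)
  then show False using \<open>p \<noteq> 0\<close> by simp
qed

text \<open>The support is not contained in a line, that is, the Newton polygon has positive area.
  In the collinear case the polynomial is a monomial times a polynomial in one Laurent
  monomial.\<close>

definition noncollinear :: "(nat \<times> nat) set \<Rightarrow> bool"
  where "noncollinear J \<longleftrightarrow> (\<exists>u\<in>J. \<exists>v\<in>J. \<exists>w\<in>J.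
    (int (fst v) - int (fst u)) * (int (snd w) - int (snd u))
      \<noteq> (int (fst w) - int (fst u)) * (int (snd v) - int (snd u)))"

text \<open>
  Translation by a point of \<open>stab J\<close> changes a polynomial with support \<open>J\<close> by a scalar only; for
  noncollinear \<open>J\<close> the group \<open>stab J\<close> is finite and has index 4 in \<open>sqstab J\<close>.
\<close>

definition two_primary :: "cpt \<Rightarrow> bool" where "two_primary \<alpha> \<longleftrightarrow> (\<exists>e. \<alpha> ^ (2 ^ e) = 1)"

definition stab :: "(nat \<times> nat) set \<Rightarrow> cpt set"
  where "stab J = {\<alpha>. two_primary \<alpha> \<and> (\<forall>u\<in>J. \<forall>v\<in>J. mv \<alpha> u = mv \<alpha> v)}"

definition sqstab :: "(nat \<times> nat) set \<Rightarrow> cpt set"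
  where "sqstab J = {\<beta>. \<beta> ^ 2 \<in> stab J}"

lemma two_primary_mvnz: "two_primary \<alpha> \<Longrightarrow> mvnz \<alpha>"
  unfolding two_primary_def by (elim exE) (erule root_of_unity_mvnz, simp)

lemma two_primary_one [simp]: "two_primary 1" unfolding two_primary_def by simp

lemma power_two_power_mono:
  fixes \<alpha> :: "'a :: comm_monoid_mult"
  assumes "\<alpha> ^ (2 ^ a) = 1" "a \<le> b" shows "\<alpha> ^ (2 ^ b) = 1"
proof -
  have "(2::nat) ^ b = 2 ^ a * 2 ^ (b - a)" using assms(2) by (simp flip: power_add)
  then show ?thesis using assms(1) by (simp add: power_mult)
qed

lemma two_primary_mult: "two_primary \<alpha> \<Longrightarrow> two_primary \<beta> \<Longrightarrow> two_primary (\<alpha> * \<beta>)"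
proof -
  assume "two_primary \<alpha>" "two_primary \<beta>"
  then obtain a b where "\<alpha> ^ (2 ^ a) = 1" "\<beta> ^ (2 ^ b) = 1" unfolding two_primary_def by auto
  then have "(\<alpha> * \<beta>) ^ (2 ^ max a b) = 1"
    using power_two_power_mono[of \<alpha> a "max a b"] power_two_power_mono[of \<beta> b "max a b"]
    by (simp add: power_mult_distrib)
  then show ?thesis unfolding two_primary_def by blast
qed

lemma two_primary_pinv: "two_primary \<alpha> \<Longrightarrow> two_primary (pinv \<alpha>)"
  unfolding two_primary_def using pinv_power_one by blast

lemma two_primary_square: "two_primary (\<beta> ^ 2) \<Longrightarrow> two_primary \<beta>"
proof -
  assume "two_primary (\<beta> ^ 2)"
  then obtain e where "(\<beta> ^ 2) ^ (2 ^ e) = 1" unfolding two_primary_def by auto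
  then have "\<beta> ^ (2 ^ Suc e) = 1" by (simp only: power_mult[symmetric] power_Suc)
  then show ?thesis unfolding two_primary_def by blast
qed

lemma stabI: "two_primary \<alpha> \<Longrightarrow> (\<And>u v. u \<in> J \<Longrightarrow> v \<in> J \<Longrightarrow> mv \<alpha> u = mv \<alpha> v) \<Longrightarrow> \<alpha> \<in> stab J"
  unfolding stab_def by blast

lemma stab_two_primary: "\<alpha> \<in> stab J \<Longrightarrow> two_primary \<alpha>"
  unfolding stab_def by blast

lemma stab_eq: "\<alpha> \<in> stab J \<Longrightarrow> u \<in> J \<Longrightarrow> v \<in> J \<Longrightarrow> mv \<alpha> u = mv \<alpha> v"
  unfolding stab_def by blast

lemma stab_one [simp]: "1 \<in> stab J" by (rule stabI) simp_all

lemma stab_mult: "\<alpha> \<in> stab J \<Longrightarrow> \<beta> \<in> stab J \<Longrightarrow> \<alpha> * \<beta> \<in> stab J"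
  by (rule stabI, intro two_primary_mult stab_two_primary) (assumption | simp only: mv_simps, metis stab_eq)+

lemma stab_power: "\<alpha> \<in> stab J \<Longrightarrow> \<alpha> ^ k \<in> stab J"
  by (induction k) (simp_all add: stab_mult)

lemma mv_pinv: "mv (pinv \<alpha>) u = inverse (mv \<alpha> u)"
  unfolding mv_def pinv_def by (simp add: power_inverse)

lemma stab_pinv: "\<alpha> \<in> stab J \<Longrightarrow> pinv \<alpha> \<in> stab J"
  by (rule stabI, intro two_primary_pinv stab_two_primary) (assumption | simp only: mv_pinv, metis stab_eq)+

lemma stab_subset_sqstab: "stab J \<subseteq> sqstab J"
  unfolding sqstab_def using stab_power by blast

lemma sqstab_two_primary: "\<beta> \<in> sqstab J \<Longrightarrow> two_primary \<beta>"
  unfolding sqstab_def using two_primary_square stab_two_primary by blast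

lemma power_int_eq_one_imp:
  fixes x :: complex
  assumes "x powi k = 1" "k \<noteq> 0" shows "x ^ nat \<bar>k\<bar> = 1"
proof (cases "k \<ge> 0")
  case True
  then show ?thesis using assms by (simp add: power_int_def)
next
  case False
  then have "inverse x ^ nat (- k) = 1" using assms by (simp add: power_int_def)
  then have "inverse (x ^ nat (- k)) = 1" by (simp add: power_inverse)
  then have "x ^ nat (- k) = 1" by (metis inverse_1 inverse_inverse_eq)
  then show ?thesis using False by (simp add: abs_if)
qed

lemma mv_eq_powi:
  assumes "mvnz \<alpha>" "mv \<alpha> u = mv \<alpha> v"
  shows "fst \<alpha> powi (int (fst v) - int (fst u)) * snd \<alpha> powi (int (snd v) - int (snd u)) = 1"
proof -
  have nz: "fst \<alpha> \<noteq> 0" "snd \<alpha> \<noteq> 0" using assms(1) unfolding mvnz_def by auto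
  have "fst \<alpha> powi (int (fst v) - int (fst u)) * snd \<alpha> powi (int (snd v) - int (snd u))
     = mv \<alpha> v / mv \<alpha> u"
    using nz unfolding mv_def by (simp add: power_int_diff field_simps)
  then show ?thesis using assms mv_nonzero[OF assms(1)] by simp
qed

text \<open>Cramer's rule in multiplicative form: two relations between x and y bound both orders by
  the determinant of the exponents. For three noncollinear exponents this determinant is nonzero,
  which makes \<open>stab J\<close> finite.\<close>

lemma powi_det:
  fixes x y :: complex
  assumes nz: "x \<noteq> 0" "y \<noteq> 0" and 1: "x powi p * y powi q = 1" and 2: "x powi r * y powi s = 1"
  shows "x powi (p * s - q * r) = 1" "y powi (p * s - q * r) = 1"
proof -
  have "(x powi p * y powi q) powi s = x powi (p * s) * y powi (q * s)"
    "(x powi r * y powi s) powi q = x powi (q * r) * y powi (q * s)"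
    "(x powi p * y powi q) powi r = x powi (p * r) * y powi (q * r)"
    "(x powi r * y powi s) powi p = x powi (p * r) * y powi (p * s)"
    by (simp_all add: power_int_mult_distrib power_int_mult[symmetric] mult.commute)
  then have e: "x powi (p * s) * y powi (q * s) = 1" "x powi (q * r) * y powi (q * s) = 1"
    "x powi (p * r) * y powi (q * r) = 1" "x powi (p * r) * y powi (p * s) = 1"
    unfolding 1 2 by simp_all
  have "x powi (p * s) = x powi (q * r)" using e(1,2) nz
    by (metis mult_right_cancel power_int_eq_0_iff)
  moreover have "y powi (p * s) = y powi (q * r)" using e(3,4) nz
    by (metis mult_left_cancel power_int_eq_0_iff)
  ultimately show "x powi (p * s - q * r) = 1" "y powi (p * s - q * r) = 1"
    using nz by (simp_all add: power_int_diff)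
qed

lemma finite_roots_of_unity: "k > 0 \<Longrightarrow> finite {z::complex. z ^ k = 1}"
  by (rule finite_roots_unity) simp

lemma finite_stab:
  assumes "noncollinear J" shows "finite (stab J)"
proof -
  obtain u v w where uvw: "u \<in> J" "v \<in> J" "w \<in> J"
    and det: "(int (fst v) - int (fst u)) * (int (snd w) - int (snd u))
      \<noteq> (int (fst w) - int (fst u)) * (int (snd v) - int (snd u))"
    using assms unfolding noncollinear_def by blast
  define D where "D = (int (fst v) - int (fst u)) * (int (snd w) - int (snd u))
      - (int (snd v) - int (snd u)) * (int (fst w) - int (fst u))"
  have D: "D \<noteq> 0" using det unfolding D_def by (simp add: mult.commute)
  define N where "N = nat \<bar>D\<bar>"
  have "stab J \<subseteq> {z. z ^ N = 1} \<times> {z. z ^ N = 1}"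
  proof
    fix \<alpha> assume a: "\<alpha> \<in> stab J"
    then have mz: "mvnz \<alpha>" by (intro two_primary_mvnz stab_two_primary)
    then have nz: "fst \<alpha> \<noteq> 0" "snd \<alpha> \<noteq> 0" unfolding mvnz_def by auto
    have eq: "mv \<alpha> u = mv \<alpha> v" "mv \<alpha> u = mv \<alpha> w" using stab_eq[OF a] uvw by blast+
    from powi_det[OF nz mv_eq_powi[OF mz eq(1)] mv_eq_powi[OF mz eq(2)]]
    have "fst \<alpha> powi D = 1" "snd \<alpha> powi D = 1" unfolding D_def by auto
    then have "fst \<alpha> ^ N = 1" "snd \<alpha> ^ N = 1"
      using power_int_eq_one_imp D unfolding N_def by auto
    then show "\<alpha> \<in> {z. z ^ N = 1} \<times> {z. z ^ N = 1}" by (cases \<alpha>) auto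
  qed
  moreover have "finite {z::complex. z ^ N = 1}" using D unfolding N_def by (intro finite_roots_of_unity) auto
  ultimately show ?thesis by (meson finite_SigmaI finite_subset)
qed

lemma stab_exponent:
  assumes "noncollinear J" obtains w where "\<And>\<alpha>. \<alpha> \<in> stab J \<Longrightarrow> \<alpha> ^ (2 ^ w) = 1"
proof -
  have "\<exists>w. \<forall>\<alpha>\<in>K. \<alpha> ^ (2 ^ w) = 1" if "finite K" "K \<subseteq> {\<alpha>. two_primary \<alpha>}" for K
    using that
  proof (induction K rule: finite_induct)
    case (insert a K)
    then obtain w e where w: "\<forall>\<alpha>\<in>K. \<alpha> ^ (2 ^ w) = 1" "a ^ (2 ^ e) = 1" unfolding two_primary_def by auto
    have "\<forall>\<alpha>\<in>insert a K. \<alpha> ^ (2 ^ max w e) = 1"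
      using w power_two_power_mono[of a e "max w e"] power_two_power_mono[of _ w "max w e"] by auto
    then show ?case by blast
  qed simp
  from this[OF finite_stab[OF assms]] show ?thesis using that stab_two_primary by blast
qed

lemma card_square_roots:
  assumes "mvnz a" shows "finite {\<beta>::cpt. \<beta> ^ 2 = a} \<and> card {\<beta>::cpt. \<beta> ^ 2 = a} = 4"
proof -
  have "{\<beta>::cpt. \<beta> ^ 2 = a} = {x. x ^ 2 = fst a} \<times> {y. y ^ 2 = snd a}"
    by (auto simp: prod_eq_iff)
  moreover have "card {z::complex. z ^ 2 = c} = 2" "finite {z::complex. z ^ 2 = c}" if "c \<noteq> 0" for c
    using card_nth_roots[OF that, of 2] finite_nth_roots[of 2 c] by auto
  ultimately show ?thesis using assms unfolding mvnz_def by (simp add: card_cartesian_product)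
qed

lemma card_sqstab:
  assumes "noncollinear J" shows "finite (sqstab J)" "card (sqstab J) = 4 * card (stab J)"
proof -
  have eq: "sqstab J = (\<Union>a\<in>stab J. {\<beta>. \<beta> ^ 2 = a})" unfolding sqstab_def by auto
  have nz: "mvnz a" if "a \<in> stab J" for a using that by (intro two_primary_mvnz stab_two_primary)
  show "finite (sqstab J)" unfolding eq using finite_stab[OF assms] card_square_roots[OF nz] by auto
  have "card (sqstab J) = (\<Sum>a\<in>stab J. card {\<beta>::cpt. \<beta> ^ 2 = a})"
    unfolding eq using finite_stab[OF assms] card_square_roots[OF nz]
    by (intro card_UN_disjoint) auto
  also have "\<dots> = (\<Sum>a\<in>stab J. 4)" using card_square_roots[OF nz] by (intro sum.cong) auto
  finally show "card (sqstab J) = 4 * card (stab J)" by simp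
qed

text \<open>Cosets of \<open>stab J\<close> partition \<open>sqstab J\<close> into classes of equal
  size, and squaring is four to one, so there are four cosets.\<close>

lemma sqstab_transversal:
  assumes J: "noncollinear J"
  obtains R where "card R = 4" "R \<subseteq> sqstab J" "1 \<in> R"
    "\<And>\<beta>. \<beta> \<in> sqstab J \<Longrightarrow> \<exists>\<rho>\<in>R. \<exists>a\<in>stab J. \<beta> = \<rho> * a"
    "\<And>\<rho> \<rho>' a. \<rho> \<in> R \<Longrightarrow> \<rho>' \<in> R \<Longrightarrow> a \<in> stab J \<Longrightarrow> \<rho> = \<rho>' * a \<Longrightarrow> \<rho> = \<rho>'"
proof -
  define cl where "cl = (\<lambda>\<beta>. (\<lambda>a. \<beta> * a) ` stab J)"
  have fin: "finite (stab J)" "finite (sqstab J)" using finite_stab[OF J] card_sqstab[OF J] by auto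
  have nzB: "mvnz \<beta>" if "\<beta> \<in> sqstab J" for \<beta> using that sqstab_two_primary two_primary_mvnz by blast
  have nzA: "mvnz \<beta>" if "\<beta> \<in> stab J" for \<beta> using that nzB stab_subset_sqstab by blast
  have self: "\<beta> \<in> cl \<beta>" for \<beta> unfolding cl_def using stab_one[of J] by (metis image_eqI mult_1_right)
  have eqcl: "cl (\<beta> * a) = cl \<beta>" if "a \<in> stab J" for \<beta> a
  proof -
    have "cl (\<beta> * a) \<subseteq> cl \<beta>" if "a \<in> stab J" for \<beta> a
      unfolding cl_def using stab_mult[OF that] by (auto simp: mult.assoc)
    from this[OF that, of \<beta>] this[OF stab_pinv[OF that], of "\<beta> * a"]
    show ?thesis using nzA[OF that] by (simp add: mult.assoc)
  qed
  have eqcl': "cl x = cl b" if x: "x \<in> cl b" for x b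
  proof -
    obtain a where "a \<in> stab J" "x = b * a" using x unfolding cl_def by (elim imageE)
    then show ?thesis using eqcl by simp
  qed
  have subB: "cl \<beta> \<subseteq> sqstab J" if "\<beta> \<in> sqstab J" for \<beta>
  proof
    fix x assume "x \<in> cl \<beta>"
    then obtain a where a: "a \<in> stab J" "x = \<beta> * a" unfolding cl_def by auto
    have "\<beta> ^ 2 * a ^ 2 \<in> stab J" 
      using stab_mult[OF _ stab_power[OF a(1), of 2], of "\<beta> ^ 2"] that unfolding sqstab_def by simp
    then show "x \<in> sqstab J" unfolding sqstab_def a(2) by (simp add: power_mult_distrib)
  qed
  have cardcl: "card (cl \<beta>) = card (stab J)" if "\<beta> \<in> sqstab J" for \<beta>
    unfolding cl_def
  proof (rule card_image, rule inj_onI)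
    fix x y assume "\<beta> * x = \<beta> * y"
    then show "x = y" by (metis nzB[OF that] pinv_mult_assoc(1))
  qed
  define C where "C = cl ` sqstab J"
  have disj: "c1 \<inter> c2 = {}" if c12: "c1 \<in> C" "c2 \<in> C" "c1 \<noteq> c2" for c1 c2
  proof (rule ccontr)
    assume "c1 \<inter> c2 \<noteq> {}"
    then obtain x where x: "x \<in> c1" "x \<in> c2" by auto
    obtain b1 where b1: "c1 = cl b1" using c12(1) unfolding C_def by (elim imageE)
    obtain b2 where b2: "c2 = cl b2" using c12(2) unfolding C_def by (elim imageE)
    have "cl x = cl b1" "cl x = cl b2" using x eqcl' unfolding b1 b2 by blast+
    then show False using c12(3) b1 b2 by simp
  qed
  have UC: "\<Union>C = sqstab J" unfolding C_def using subB self by blast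
  have finC: "finite C" unfolding C_def using fin by simp
  have "card (stab J) * card C = card (\<Union>C)"
    using disj UC fin cardcl by (intro card_partition finC) (auto simp: C_def)
  then have "card (stab J) * card C = card (stab J) * 4"
    unfolding UC card_sqstab(2)[OF J] by (simp only: mult.commute)
  moreover have "stab J \<noteq> {}" using stab_one[of J] by blast
  then have "card (stab J) \<noteq> 0" using fin(1) by simp
  ultimately have cC: "card C = 4" by simp
  \<comment> \<open>The trivial coset is represented by 1, so the members of R other than 1
    represent the nontrivial cosets.\<close>
  define pick where "pick = (\<lambda>c. if 1 \<in> c then (1::cpt) else (SOME x. x \<in> c))"
  have pick: "pick c \<in> c" if "c \<in> C" for c
  proof -
    obtain b where "c = cl b" using \<open>c \<in> C\<close> unfolding C_def by (elim imageE)
    then have "b \<in> c" using self by simp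
    then show ?thesis unfolding pick_def by (auto intro: someI)
  qed
  have inj: "inj_on pick C"
    using pick disj by (intro inj_onI) (metis disjoint_iff)
  define R where "R = pick ` C"
  have "card R = 4" unfolding R_def using card_image[OF inj] cC by simp
  moreover have "R \<subseteq> sqstab J" unfolding R_def using pick UC by blast
  moreover have "1 \<in> R"
  proof -
    have "cl 1 \<in> C" unfolding C_def using stab_subset_sqstab[of J] stab_one[of J] by blast
    moreover have "pick (cl 1) = 1" unfolding pick_def using self[of 1] by simp
    ultimately show ?thesis unfolding R_def by force
  qed
  moreover have "\<exists>\<rho>\<in>R. \<exists>a\<in>stab J. \<beta> = \<rho> * a" if b: "\<beta> \<in> sqstab J" for \<beta>
  proof -
    have "cl \<beta> \<in> C" using b unfolding C_def by simp
    then have r: "pick (cl \<beta>) \<in> R" "pick (cl \<beta>) \<in> cl \<beta>" using pick unfolding R_def by auto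
    then obtain a where a: "a \<in> stab J" "pick (cl \<beta>) = \<beta> * a" unfolding cl_def by blast
    then have "\<beta> = pick (cl \<beta>) * pinv a" using nzA by (simp add: mult.assoc)
    then show ?thesis using r(1) stab_pinv[OF a(1)] by blast
  qed
  moreover have "\<rho> = \<rho>'" if rr: "\<rho> \<in> R" "\<rho>' \<in> R" "a \<in> stab J" "\<rho> = \<rho>' * a" for \<rho> \<rho>' a
  proof -
    obtain c c' where c: "c \<in> C" "c' \<in> C" "\<rho> = pick c" "\<rho>' = pick c'"
      using rr(1,2) unfolding R_def by (elim imageE)
    have "cl (pick c) = c" if cC: "c \<in> C" for c
    proof -
      obtain b where b: "c = cl b" using cC unfolding C_def by (elim imageE)
      show ?thesis using pick[OF cC] eqcl'[of "pick c" b] unfolding b by simp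
    qed
    then have "c = c'" using eqcl[OF rr(3), of \<rho>'] rr(4) c by metis
    then show ?thesis using c by simp
  qed
  ultimately show ?thesis using that by blast
qed

lemma translate_stab:
  assumes "a \<in> stab J" "{u. cfp p u \<noteq> 0} \<subseteq> J"
  shows "proportional p (translate a p)"
proof (cases "p = 0")
  case True
  have "translate a p = p" unfolding True by (rule cfp_eqI) simp
  then show ?thesis by simp
next
  case False
  have "mvnz a" using assms(1) by (intro two_primary_mvnz stab_two_primary)
  obtain v where v: "cfp p v \<noteq> 0" using False cfp_nonzero_iff by blast
  have "translate a p = con (mv a v) * p"
  proof (rule cfp_eqI)
    fix u
    show "cfp (translate a p) u = cfp (con (mv a v) * p) u"
    proof (cases "cfp p u = 0")
      case False
      then have "mv a u = mv a v" using v assms(2) by (intro stab_eq[OF assms(1)]) auto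
      then show ?thesis by simp
    qed simp
  qed
  then show ?thesis unfolding proportional_def using mv_nonzero[OF \<open>mvnz a\<close>] by blast
qed

lemma stab_of_proportional:
  assumes "two_primary \<alpha>" "proportional p (translate \<alpha> p)" "{u. cfp p u \<noteq> 0} = J"
  shows "\<alpha> \<in> stab J"
proof -
  obtain c where c: "translate \<alpha> p = con c * p" using assms(2) unfolding proportional_def by auto
  have "mv \<alpha> u = c" if "u \<in> J" for u
  proof -
    have "cfp (translate \<alpha> p) u = cfp (con c * p) u" unfolding c ..
    then show ?thesis using that assms(3) by auto
  qed
  then show ?thesis by (intro stabI assms(1)) simp
qed

subsection \<open>Galois conjugation\<close>

text \<open>The ring Z[zeta n] is used rather than its field of fractions: its elements are values
  of integer polynomials, and conjugation is a substitution in such a polynomial.\<close>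

definition Z_zeta :: "nat \<Rightarrow> complex set" where "Z_zeta n = range (\<lambda>q. int_eval q (zeta n))"

text \<open>
  For \<open>k\<close> coprime to \<open>n\<close> conjugate roots of unity satisfy the same integer polynomials, so the choice
  of \<open>q\<close> does not matter.
\<close>

definition galois :: "nat \<Rightarrow> nat \<Rightarrow> complex \<Rightarrow> complex"
  where "galois n k c = int_eval (SOME q. int_eval q (zeta n) = c) (zeta n ^ k)"

lemma Z_zetaI: "int_eval q (zeta n) \<in> Z_zeta n" unfolding Z_zeta_def by blast

lemma Z_zeta_ring:
  "0 \<in> Z_zeta n" "1 \<in> Z_zeta n" "x \<in> Z_zeta n \<Longrightarrow> y \<in> Z_zeta n \<Longrightarrow> x + y \<in> Z_zeta n"
  "x \<in> Z_zeta n \<Longrightarrow> y \<in> Z_zeta n \<Longrightarrow> x * y \<in> Z_zeta n" "x \<in> Z_zeta n \<Longrightarrow> - x \<in> Z_zeta n"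
proof -
  show "0 \<in> Z_zeta n" "1 \<in> Z_zeta n" using Z_zetaI[of 0 n] Z_zetaI[of 1 n] by simp_all
  show "x \<in> Z_zeta n \<Longrightarrow> y \<in> Z_zeta n \<Longrightarrow> x + y \<in> Z_zeta n"
    unfolding Z_zeta_def by (elim rangeE) (metis int_eval_add rangeI)
  show "x \<in> Z_zeta n \<Longrightarrow> y \<in> Z_zeta n \<Longrightarrow> x * y \<in> Z_zeta n"
    unfolding Z_zeta_def by (elim rangeE) (metis int_eval_mult rangeI)
  show "x \<in> Z_zeta n \<Longrightarrow> - x \<in> Z_zeta n"
    unfolding Z_zeta_def by (elim rangeE) (metis int_eval_uminus rangeI)
qed

lemma Z_zeta_root:
  assumes "n > 0" "w ^ n = 1" shows "w \<in> Z_zeta n"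
proof -
  obtain j where "w = zeta n ^ j" using root_of_unity_zeta_power[OF assms] by blast
  then have "w = int_eval (Polynomial.monom 1 j) (zeta n)" by simp
  then show ?thesis using Z_zetaI by metis
qed

lemma Z_zeta_mv:
  assumes "n > 0" "P ^ n = 1" shows "mv P u \<in> Z_zeta n"
proof (rule Z_zeta_root[OF assms(1)])
  show "mv P u ^ n = 1" using arg_cong[OF assms(2), of "\<lambda>P. mv P u"] by simp
qed

locale galois_conj =
  fixes n k :: nat
  assumes n: "n > 0" and k: "k > 0" and cop: "coprime k n"
begin

lemma galois_int_eval: "galois n k (int_eval q (zeta n)) = int_eval q (zeta n ^ k)"
proof -
  define r where "r = (SOME r. int_eval r (zeta n) = int_eval q (zeta n))"
  have "int_eval r (zeta n) = int_eval q (zeta n)" unfolding r_def by (rule someI) (rule refl)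
  then have "int_eval (r - q) (zeta n) = 0" by simp
  from conjugate_root[OF cop k zeta_pow_self[OF n] n this]
  show ?thesis unfolding galois_def r_def[symmetric] by simp
qed

lemma galois_0 [simp]: "galois n k 0 = 0"
  using galois_int_eval[of 0] by simp

lemma galois_add: "x \<in> Z_zeta n \<Longrightarrow> y \<in> Z_zeta n \<Longrightarrow> galois n k (x + y) = galois n k x + galois n k y"
  unfolding Z_zeta_def by (elim rangeE) (metis int_eval_add galois_int_eval)

lemma galois_mult: "x \<in> Z_zeta n \<Longrightarrow> y \<in> Z_zeta n \<Longrightarrow> galois n k (x * y) = galois n k x * galois n k y"
  unfolding Z_zeta_def by (elim rangeE) (metis int_eval_mult galois_int_eval)

lemma galois_sum: "(\<And>i. i \<in> I \<Longrightarrow> f i \<in> Z_zeta n) \<Longrightarrow>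
    galois n k (\<Sum>i\<in>I. f i) = (\<Sum>i\<in>I. galois n k (f i)) \<and> (\<Sum>i\<in>I. f i) \<in> Z_zeta n"
  by (induction I rule: infinite_finite_induct) (auto simp: galois_add Z_zeta_ring)

lemma galois_root: "w ^ n = 1 \<Longrightarrow> galois n k w = w ^ k"
proof -
  assume "w ^ n = 1"
  then obtain j where w: "w = zeta n ^ j" using root_of_unity_zeta_power[OF n] by blast
  then have "w = int_eval (Polynomial.monom 1 j) (zeta n)" by simp
  then have "galois n k w = (zeta n ^ k) ^ j" using galois_int_eval[of "Polynomial.monom 1 j"] by simp
  then show ?thesis unfolding w by (simp flip: power_mult add: mult.commute)
qed

lemma galois_mv:
  assumes "P ^ n = 1" shows "galois n k (mv P u) = mv (P ^ k) u"
  using galois_root[of "mv P u"] arg_cong[OF assms, of "\<lambda>P. mv P u"] by simp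

lemma galois_closed: "x \<in> Z_zeta n \<Longrightarrow> galois n k x \<in> Z_zeta n"
proof -
  assume "x \<in> Z_zeta n"
  then obtain q where q: "x = int_eval q (zeta n)" unfolding Z_zeta_def by auto
  have "int_eval q (zeta n ^ k) = int_eval (q \<circ>\<^sub>p Polynomial.monom 1 k) (zeta n)" by (simp add: int_eval_pcompose)
  then show ?thesis unfolding q galois_int_eval using Z_zetaI by metis
qed

lemma galois_cong:
  assumes "[k = l] (mod n)" "x \<in> Z_zeta n" shows "galois n k x = galois n l x"
  using power_cong_root_of_unity[OF zeta_pow_self[OF n] assms(1)] unfolding galois_def by simp

end

lemma galois_galois:
  assumes "n > 0" "k > 0" "l > 0" "coprime k n" "coprime l n" "x \<in> Z_zeta n"
  shows "galois n k (galois n l x) = galois n (k * l) x"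
proof -
  interpret k: galois_conj n k using assms by unfold_locales
  interpret l: galois_conj n l using assms by unfold_locales
  interpret kl: galois_conj n "k * l" using assms by unfold_locales auto
  obtain q where q: "x = int_eval q (zeta n)" using assms(6) unfolding Z_zeta_def by auto
  have e: "int_eval q (zeta n ^ l) = int_eval (q \<circ>\<^sub>p Polynomial.monom 1 l) (zeta n)" by (simp add: int_eval_pcompose)
  have "galois n k (int_eval q (zeta n ^ l)) = int_eval (q \<circ>\<^sub>p Polynomial.monom 1 l) (zeta n ^ k)"
    unfolding e by (rule k.galois_int_eval)
  then show ?thesis unfolding q l.galois_int_eval kl.galois_int_eval
    by (simp add: int_eval_pcompose power_mult)
qed

lemma galois_one:
  assumes "n > 0" "x \<in> Z_zeta n" shows "galois n 1 x = x"
proof -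
  interpret galois_conj n 1 using assms by unfold_locales auto
  obtain q where q: "x = int_eval q (zeta n)" using assms(2) unfolding Z_zeta_def by auto
  show ?thesis unfolding q galois_int_eval by simp
qed

text \<open>Injectivity, from the inverse automorphism that belongs to the inverse of k modulo n. It
  shows that conjugation preserves supports.\<close>

lemma (in galois_conj) galois_eq_0: "x \<in> Z_zeta n \<Longrightarrow> galois n k x = 0 \<Longrightarrow> x = 0"
proof -
  assume x: "x \<in> Z_zeta n" and 0: "galois n k x = 0"
  obtain k' where k': "coprime k' n" "k' > 0" "[k * k' = 1] (mod n)"
    using exists_inverse_mod[OF cop n] by metis
  interpret k': galois_conj n k' using n k' by unfold_locales
  interpret kk': galois_conj n "k' * k" using n k k' cop by unfold_locales auto
  have "galois n k' (galois n k x) = galois n (k' * k) x"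
    using galois_galois[OF n k'(2) k k'(1) cop x] .
  also have "\<dots> = galois n 1 x" using k'(3) by (intro kk'.galois_cong x) (simp add: mult.commute)
  finally show ?thesis using galois_one[OF n x] 0 by simp
qed

section \<open>Conjugation of the coefficients of a curve\<close>

definition conj_poly :: "nat \<Rightarrow> nat \<Rightarrow> complex poly poly \<Rightarrow> complex poly poly"
  where "conj_poly n k p = tp (tri (tdeg p)) (\<lambda>u. galois n k (cfp p u))"

definition Z_zeta_poly :: "nat \<Rightarrow> complex poly poly \<Rightarrow> bool" where "Z_zeta_poly n p \<longleftrightarrow> (\<forall>u. cfp p u \<in> Z_zeta n)"

lemma proportional_supp:
  "proportional p q \<Longrightarrow> {u. cfp q u \<noteq> 0} = {u. cfp p u \<noteq> 0}"
  unfolding proportional_def by auto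

context galois_conj
begin

lemma cfp_conj_poly [simp]: "cfp (conj_poly n k p) u = galois n k (cfp p u)"
  using cfp_tdeg[of p u] by (cases "cfp p u = 0") (simp_all add: conj_poly_def cfp_tp)

lemma supp_conj_poly: "Z_zeta_poly n p \<Longrightarrow> {u. cfp (conj_poly n k p) u \<noteq> 0} = {u. cfp p u \<noteq> 0}"
  unfolding Z_zeta_poly_def using galois_eq_0 galois_0 by (metis cfp_conj_poly)

lemma Z_zeta_poly_conj_poly: "Z_zeta_poly n p \<Longrightarrow> Z_zeta_poly n (conj_poly n k p)"
  unfolding Z_zeta_poly_def using galois_closed by simp

lemma tdle_conj_poly: "tdle p d \<Longrightarrow> tdle (conj_poly n k p) d"
  unfolding tdle_cfp using galois_0 by (metis cfp_conj_poly)

text \<open>The automorphism is applied to the whole relation p(P) = 0: the coefficients become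
  conjugate, while the torsion point P becomes the power P^k. Every new curve through a torsion
  point comes from this.\<close>

lemma pv_conj_poly_zero:
  assumes "Z_zeta_poly n p" "P ^ n = 1" "pv p P = 0" shows "pv (conj_poly n k p) (P ^ k) = 0"
proof -
  have Z: "cfp p u * mv P u \<in> Z_zeta n" for u
    using assms(1) Z_zeta_mv[OF n assms(2)] unfolding Z_zeta_poly_def by (blast intro: Z_zeta_ring(4))
  have "0 = galois n k (pv p P)" using assms(3) by simp
  also have "\<dots> = (\<Sum>u\<in>tri (tdeg p). galois n k (cfp p u * mv P u))"
    unfolding pv_tdle[OF tdle_tdeg[of p]] by (rule galois_sum[THEN conjunct1, OF Z])
  also have "\<dots> = (\<Sum>u\<in>tri (tdeg p). cfp (conj_poly n k p) u * mv (P ^ k) u)"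
    using assms(1) Z_zeta_mv[OF n assms(2)] galois_mv[OF assms(2)] unfolding Z_zeta_poly_def
    by (intro sum.cong refl) (simp only: galois_mult cfp_conj_poly)
  also have "\<dots> = pv (conj_poly n k p) (P ^ k)"
    using pv_tdle[OF tdle_conj_poly[OF tdle_tdeg[of p]]] by simp
  finally show ?thesis by simp
qed

lemma conj_poly_translate: "Z_zeta_poly n p \<Longrightarrow> \<alpha> ^ n = 1 \<Longrightarrow> conj_poly n k (translate \<alpha> p) = translate (\<alpha> ^ k) (conj_poly n k p)"
  using galois_mv[of \<alpha>] Z_zeta_mv[OF n, of \<alpha>] unfolding Z_zeta_poly_def
  by (intro cfp_eqI) (simp only: cfp_conj_poly cfp_translate galois_mult)

lemma conj_poly_nonzero: "Z_zeta_poly n p \<Longrightarrow> p \<noteq> 0 \<Longrightarrow> conj_poly n k p \<noteq> 0"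
  using supp_conj_poly unfolding cfp_nonzero_iff by blast

lemma proportional_conj_poly:
  assumes "proportional p q" "Z_zeta_poly n p" "Z_zeta_poly n q" "p \<noteq> 0"
  shows "proportional (conj_poly n k p) (conj_poly n k q)"
proof (rule proportional_crossI)
  have "q \<noteq> 0" 
    using proportional_supp[OF assms(1)] assms(4) unfolding cfp_nonzero_iff by blast
  then show "conj_poly n k q \<noteq> 0" "conj_poly n k p \<noteq> 0" using conj_poly_nonzero assms by auto
  fix u v
  have "galois n k (cfp p u * cfp q v) = galois n k (cfp p v * cfp q u)"
    using proportional_crossD[OF assms(1)] by simp
  then show "cfp (conj_poly n k p) u * cfp (conj_poly n k q) v = cfp (conj_poly n k p) v * cfp (conj_poly n k q) u"
    using assms(2,3) unfolding Z_zeta_poly_def by (simp add: galois_mult)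
qed

lemma conj_poly_cong: "[k = l] (mod n) \<Longrightarrow> Z_zeta_poly n p \<Longrightarrow> conj_poly n k p = conj_poly n l p"
proof -
  assume "[k = l] (mod n)" "Z_zeta_poly n p"
  then have "galois n k (cfp p u) = galois n l (cfp p u)" for u
    unfolding Z_zeta_poly_def using galois_cong by blast
  then show ?thesis unfolding conj_poly_def by (simp only:)
qed

end

lemma Z_zeta_poly_translate: "n > 0 \<Longrightarrow> Z_zeta_poly n p \<Longrightarrow> \<alpha> ^ n = 1 \<Longrightarrow> Z_zeta_poly n (translate \<alpha> p)"
  unfolding Z_zeta_poly_def cfp_translate using Z_zeta_mv[of n \<alpha>] by (blast intro: Z_zeta_ring(4))

lemma conj_poly_conj_poly:
  assumes "n > 0" "k > 0" "l > 0" "coprime k n" "coprime l n" "Z_zeta_poly n p"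
  shows "conj_poly n k (conj_poly n l p) = conj_poly n (k * l) p"
proof -
  interpret k: galois_conj n k using assms by unfold_locales
  interpret l: galois_conj n l using assms by unfold_locales
  interpret kl: galois_conj n "k * l" using assms by unfold_locales auto
  show ?thesis
    using assms(6) galois_galois[OF assms(1-5)] unfolding Z_zeta_poly_def
    by (intro cfp_eqI) (simp only: k.cfp_conj_poly l.cfp_conj_poly kl.cfp_conj_poly)
qed

subsection \<open>Torsion points on plane curves\<close>

lemma card_le_of_cover:
  fixes f :: "complex poly poly"
  assumes f: "prime_elem f" and T: "finite T" "\<And>P. P \<in> T \<Longrightarrow> pv f P = 0"
    and I: "finite I" "\<And>i. i \<in> I \<Longrightarrow> \<not> f dvd g i \<and> tdle (g i) e"
    and cover: "\<And>P. P \<in> T \<Longrightarrow> \<exists>i\<in>I. pv (g i) P = 0"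
  shows "card T \<le> card I * (tdeg f * e)"
proof -
  have "T \<subseteq> (\<Union>i\<in>I. {P\<in>T. pv (g i) P = 0})" using cover by blast
  then have "card T \<le> card (\<Union>i\<in>I. {P\<in>T. pv (g i) P = 0})"
    using T(1) I(1) by (intro card_mono) auto
  also have "\<dots> \<le> (\<Sum>i\<in>I. card {P\<in>T. pv (g i) P = 0})" using I(1) by (rule card_UN_le)
  also have "\<dots> \<le> (\<Sum>i\<in>I. tdeg f * e)"
    using I(2) T unfolding pv_def by (intro sum_mono bezout_prime[OF f]) auto
  finally show ?thesis by simp
qed

lemma not_dvd_of_not_proportional:
  assumes "\<not> proportional f g" "g \<noteq> 0" "tdle g (tdeg f)" shows "\<not> f dvd g"
  using dvd_proportional assms by blast

lemma pv_stab_coset: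
  assumes "a \<in> stab J" "{u. cfp p u \<noteq> 0} \<subseteq> J"
  shows "pv p (\<rho> * a * P) = 0 \<longleftrightarrow> pv p (\<rho> * P) = 0"
proof -
  have "\<rho> * a * P = a * (\<rho> * P)" by (simp add: mult_ac)
  then have "pv p (\<rho> * a * P) = pv (translate a p) (\<rho> * P)" by simp
  then show ?thesis using proportional_pv[OF translate_stab[OF assms]] by simp
qed

text \<open>Let p(x^2, y^2) = f * q; then q has degree at most that of f. Translation by \<gamma> in
  \<open>sqstab J\<close> changes p(x^2, y^2) by a scalar only, but for a nontrivial coset it moves
  the prime f, so f divides the translate of q and by degree is proportional to it. Two different
  nontrivial cosets then make their quotient a stabiliser of f, which is impossible.\<close>

lemma not_dvd_square_subst:
  assumes f: "prime_elem f" and supp: "{u. cfp f u \<noteq> 0} = J" "{u. cfp p u \<noteq> 0} = J"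
    and J: "noncollinear J"
  shows "\<not> f dvd square_subst p"
proof
  assume "f dvd square_subst p"
  then obtain q where q: "square_subst p = f * q" by (elim dvdE)
  obtain R where R: "card R = 4" "R \<subseteq> sqstab J" "1 \<in> R"
    and Rinj: "\<And>\<rho> \<rho>' a. \<rho> \<in> R \<Longrightarrow> \<rho>' \<in> R \<Longrightarrow> a \<in> stab J \<Longrightarrow> \<rho> = \<rho>' * a \<Longrightarrow> \<rho> = \<rho>'"
    using sqstab_transversal[OF J] by metis
  have f0: "f \<noteq> 0" using f by auto
  then have p0: "p \<noteq> 0" unfolding cfp_nonzero_iff using supp by blast
  have h0: "square_subst p \<noteq> 0" using square_subst_nonzero[OF p0] .
  then have q0: "q \<noteq> 0" using q by auto
  have tdp: "tdle p (tdeg f)"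
    using supp cfp_tdeg[of f] unfolding tdle_cfp by blast
  have "tdeg f + tdeg q \<le> 2 * tdeg f"
    using tdle_square_subst[OF tdp] unfolding q tdle_iff_tdeg tdeg_mult[OF f0 q0] .
  then have tdq: "tdle q (tdeg f)" unfolding tdle_iff_tdeg by simp
  have step: "proportional f (translate \<gamma> q)" if \<gamma>: "\<gamma> \<in> R" "\<gamma> \<noteq> 1" for \<gamma>
  proof -
    have B: "\<gamma> \<in> sqstab J" using \<gamma> R(2) by auto
    have nz: "mvnz \<gamma>" using two_primary_mvnz[OF sqstab_two_primary[OF B]] .
    have "\<gamma> ^ 2 \<in> stab J" using B unfolding sqstab_def by simp
    then obtain c where c: "c \<noteq> 0" "translate (\<gamma> ^ 2) p = con c * p"
      using translate_stab[of "\<gamma> ^ 2" J p] supp unfolding proportional_def by blast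
    have "translate \<gamma> (square_subst p) = con c * square_subst p"
    proof (rule pv_eqI)
      fix P
      have "pv (translate \<gamma> (square_subst p)) P = pv (translate (\<gamma> ^ 2) p) (P ^ 2)" by (simp add: power_mult_distrib)
      then show "pv (translate \<gamma> (square_subst p)) P = pv (con c * square_subst p) P" unfolding c(2) by simp
    qed
    then have "f dvd translate \<gamma> f * translate \<gamma> q"
      unfolding translate_mult[symmetric] q[symmetric] using q by simp
    moreover have "\<not> f dvd translate \<gamma> f"
    proof
      assume "f dvd translate \<gamma> f"
      then have "proportional f (translate \<gamma> f)"
        using translate_nonzero[OF nz f0] tdle_translate[OF tdle_tdeg[of f]] by (rule dvd_proportional)
      then have "\<gamma> \<in> stab J" using stab_of_proportional[OF sqstab_two_primary[OF B]] supp(1) by blast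
      then show False using Rinj[OF \<gamma>(1) R(3), of \<gamma>] \<gamma>(2) by simp
    qed
    ultimately have "f dvd translate \<gamma> q" using prime_elem_dvd_multD[OF f] by blast
    then show ?thesis using translate_nonzero[OF nz q0] tdle_translate[OF tdq] by (rule dvd_proportional)
  qed
  \<comment> \<open>Three representatives remain after removing 1, so two distinct ones can be
    compared.\<close>
  have "\<not> R - {1} \<subseteq> {x}" for x
  proof
    assume "R - {1} \<subseteq> {x}"
    then have "R \<subseteq> {1, x}" by blast
    then have "card R \<le> card {1, x}" by (intro card_mono) auto
    then show False using R(1) by (simp add: card_insert_if split: if_splits)
  qed
  then obtain \<gamma>1 \<gamma>2 where g12: "\<gamma>1 \<in> R" "\<gamma>1 \<noteq> 1" "\<gamma>2 \<in> R" "\<gamma>2 \<noteq> 1" "\<gamma>1 \<noteq> \<gamma>2" by blast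
  have B: "\<gamma>1 \<in> sqstab J" "\<gamma>2 \<in> sqstab J" using g12 R(2) by auto
  have nz: "mvnz \<gamma>2" using two_primary_mvnz[OF sqstab_two_primary[OF B(2)]] .
  define \<delta> where "\<delta> = pinv \<gamma>2 * \<gamma>1"
  have g1: "\<gamma>1 = \<gamma>2 * \<delta>" unfolding \<delta>_def using nz by simp
  have "proportional (translate \<delta> f) (translate \<delta> (translate \<gamma>2 q))" by (rule proportional_translate[OF step[OF g12(3,4)]])
  moreover have "translate \<delta> (translate \<gamma>2 q) = translate \<gamma>1 q" unfolding translate_translate g1 by (simp add: mult.commute)
  ultimately have "proportional f (translate \<delta> f)"
    using proportional_trans[OF step[OF g12(1,2)]] proportional_sym by metis
  moreover have "two_primary \<delta>" unfolding \<delta>_def using B by (intro two_primary_mult two_primary_pinv sqstab_two_primary)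
  ultimately have "\<delta> \<in> stab J" using stab_of_proportional supp(1) by blast
  then show False using Rinj[OF g12(1,3) _ g1] g12(5) by blast
qed

lemma cong_add_mult_self: "[a + D * i = a] (mod D)" for a D i :: nat
  unfolding cong_def by simp

text \<open>
  The argument of Beukers and Smyth. Let \<open>P\<close> be a torsion point on the curve \<open>f = 0\<close> and apply an
  automorphism \<open>zeta n \<mapsto> zeta n ^ k\<close>. A suitable \<open>k\<close> sends \<open>P\<close> to \<open>\<beta> * P\<close> or to \<open>\<beta> * P ^ 2\<close> with
  \<open>\<beta> \<in> sqstab J\<close>. Modulo the stabiliser there are four \<open>\<beta>\<close>, so \<open>P\<close> lies on one of three translates of
  the curve or on one of four curves of degree at most \<open>2 * tdeg f\<close>, and Bezout gives
  \<open>3 + 4 * 2 = 11\<close> times the square of the degree. The conjugated curve may coincide with a translate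
  of the original one; then \<open>f\<close> is replaced by a translate that is fixed by more automorphisms, which
  is the induction on \<open>r\<close> below.
\<close>

locale descent =
  fixes J :: "(nat \<times> nat) set" and m w s0 :: nat
  assumes J: "noncollinear J" and m: "odd m" and w: "\<And>\<alpha>. \<alpha> \<in> stab J \<Longrightarrow> \<alpha> ^ (2 ^ w) = 1"
begin

text \<open>The coefficients and points live at level 2 ^ s0 * m; the further factor 2 ^ w makes
  room for the torsion points \<alpha> of \<open>torsion_root\<close>.\<close>

definition n :: nat where "n = 2 ^ (s0 + w) * m"

lemma n_pos: "n > 0" unfolding n_def using m by (auto intro!: Nat.gr0I)

lemma coprime_n:
  assumes "odd k" "coprime k m" shows "coprime k n"
  using assms unfolding n_def by simp

lemma coprime_one_plus:
  assumes "e \<ge> 1" shows "coprime (1 + m * 2 ^ e) n"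
proof (rule coprime_n)
  show "odd (1 + m * 2 ^ e)" using assms by simp
  have "gcd (1 + m * 2 ^ e) m = 1" by (metis coprime_1_left coprime_iff_gcd_eq_1 gcd_add_mult mult.commute add.commute gcd.commute)
  then show "coprime (1 + m * 2 ^ e) m" by (simp add: coprime_iff_gcd_eq_1)
qed

text \<open>A root of exponent 2 ^ (r - 1) is extracted in each coordinate; the odd exponent m is
  undone by its inverse modulo the resulting power of 2. Since \<beta>^2 lies in
  \<open>stab J\<close>, the order of \<alpha> divides 2 ^ (r + w).\<close>

lemma torsion_root:
  assumes "\<beta> \<in> sqstab J" "r \<le> s0" "r \<ge> 1"
  obtains \<alpha> where "\<alpha> ^ (m * 2 ^ (r - 1)) = \<beta>" "\<alpha> ^ n = 1" "two_primary \<alpha>"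
proof -
  define N where "N = (2::nat) ^ (r - 1)"
  have N: "N > 0" unfolding N_def by simp
  have root: "\<exists>x. x ^ N = c" if "c \<noteq> 0" for c :: complex
  proof -
    have "card {x. x ^ N = c} \<noteq> 0" using card_nth_roots[OF that N] N by simp
    then have "{x. x ^ N = c} \<noteq> {}" by (metis card.empty)
    then show ?thesis by blast
  qed
  have "mvnz \<beta>" using assms(1) by (intro two_primary_mvnz sqstab_two_primary)
  then obtain x y where x: "x ^ N = fst \<beta>" and y: "y ^ N = snd \<beta>"
    using root unfolding mvnz_def by metis
  define \<gamma> :: cpt where "\<gamma> = (x, y)"
  have g: "\<gamma> ^ N = \<beta>" unfolding \<gamma>_def by (simp add: prod_eq_iff x y)
  have "(\<beta> ^ 2) ^ (2 ^ w) = 1" using assms(1) w unfolding sqstab_def by simp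
  then have "\<gamma> ^ (N * 2 * 2 ^ w) = 1" unfolding g[symmetric] by (simp only: power_mult)
  moreover have "N * 2 * 2 ^ w = 2 ^ (r + w)"
    unfolding N_def using assms(3) by (cases r) (simp_all add: power_add)
  ultimately have g2: "\<gamma> ^ (2 ^ (r + w)) = 1" by simp
  have cop: "coprime m (2 ^ (r + w))" using m by simp
  then obtain m' where m': "[m * m' = 1] (mod 2 ^ (r + w))"
    using cong_solve_coprime_nat[OF cop] by auto
  define \<alpha> where "\<alpha> = \<gamma> ^ m'"
  have am: "\<alpha> ^ m = \<gamma>"
  proof -
    have "x' ^ (m * m') = x' ^ 1" if "x' ^ (2 ^ (r + w)) = 1" for x' :: complex
      by (rule power_cong_root_of_unity[OF that m'])
    from this[of x] this[of y] show ?thesis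
      using g2 unfolding \<alpha>_def \<gamma>_def by (simp add: prod_eq_iff mult.commute flip: power_mult)
  qed
  have 1: "\<alpha> ^ (m * 2 ^ (r - 1)) = \<beta>" using am g unfolding N_def by (simp add: power_mult)
  have a2: "\<alpha> ^ (2 ^ (r + w)) = 1"
    unfolding \<alpha>_def by (subst power_mult[symmetric], subst mult.commute, subst power_mult) (simp add: g2)
  then have 3: "two_primary \<alpha>" unfolding two_primary_def by blast
  have "\<alpha> ^ (2 ^ (s0 + w)) = 1" using power_two_power_mono[OF a2] assms(2) by simp
  then have 2: "\<alpha> ^ n = 1" unfolding n_def by (simp add: power_mult)
  show ?thesis using that 1 2 3 by blast
qed

text \<open>The count separated from the arithmetic. The family G is
  \<open>square_subst (translate \<rho> g)\<close> at the bottom of the descent and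
  \<open>translate \<rho> g\<close> above it, for a conjugate g of f.\<close>

lemma card_torsion_points_of_cover:
  assumes f: "prime_elem f" "{u. cfp f u \<noteq> 0} = J"
    and T: "finite T" "\<And>P. P \<in> T \<Longrightarrow> pv f P = 0"
    and R: "card R = 4" "R \<subseteq> sqstab J" "1 \<in> R"
      "\<And>\<beta>. \<beta> \<in> sqstab J \<Longrightarrow> \<exists>\<rho>\<in>R. \<exists>a\<in>stab J. \<beta> = \<rho> * a"
      "\<And>\<rho> \<rho>' a. \<rho> \<in> R \<Longrightarrow> \<rho>' \<in> R \<Longrightarrow> a \<in> stab J \<Longrightarrow> \<rho> = \<rho>' * a \<Longrightarrow> \<rho> = \<rho>'"
    and G: "\<And>\<rho>. \<rho> \<in> R \<Longrightarrow> \<not> f dvd G \<rho> \<and> tdle (G \<rho>) e" "e \<le> 2 * tdeg f"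
    and cover: "\<And>P. P \<in> T \<Longrightarrow> (\<exists>\<beta>\<in>sqstab J. \<beta> \<notin> stab J \<and> pv f (\<beta> * P) = 0)
      \<or> (\<exists>\<rho>\<in>R. pv (G \<rho>) P = 0)"
  shows "card T \<le> 11 * (tdeg f)\<^sup>2"
proof -
  have finR: "finite R" using R(1) by (metis card.infinite zero_neq_numeral)
  have f0: "f \<noteq> 0" using f by auto
  define T1 where "T1 = {P\<in>T. \<exists>\<beta>\<in>sqstab J. \<beta> \<notin> stab J \<and> pv f (\<beta> * P) = 0}"
  define T2 where "T2 = {P\<in>T. \<exists>\<rho>\<in>R. pv (G \<rho>) P = 0}"
  have "card T1 \<le> card (R - {1}) * (tdeg f * tdeg f)"
  proof (rule card_le_of_cover[OF f(1), where g = "\<lambda>\<rho>. translate \<rho> f"])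
    fix \<rho> assume r: "\<rho> \<in> R - {1}"
    then have B: "\<rho> \<in> sqstab J" using R(2) by auto
    have "\<not> proportional f (translate \<rho> f)"
    proof
      assume "proportional f (translate \<rho> f)"
      then have "\<rho> \<in> stab J" using stab_of_proportional[OF sqstab_two_primary[OF B]] f(2) by blast
      then show False using R(5)[of \<rho> 1 \<rho>] r R(3) by simp
    qed
    then show "\<not> f dvd translate \<rho> f \<and> tdle (translate \<rho> f) (tdeg f)"
      using translate_nonzero[OF two_primary_mvnz[OF sqstab_two_primary[OF B]] f0] tdle_translate[OF tdle_tdeg[of f], of \<rho>]
      by (intro conjI not_dvd_of_not_proportional)
  next
    fix P assume "P \<in> T1"
    then obtain \<beta> where b: "\<beta> \<in> sqstab J" "\<beta> \<notin> stab J" "pv f (\<beta> * P) = 0" unfolding T1_def by blast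
    obtain \<rho> a where ra: "\<rho> \<in> R" "a \<in> stab J" "\<beta> = \<rho> * a" using R(4)[OF b(1)] by blast
    have "\<rho> \<noteq> 1" using b(2) ra by auto
    moreover have "pv (translate \<rho> f) P = 0" using b(3) pv_stab_coset[OF ra(2), of f \<rho> P] f(2) unfolding ra(3) by simp
    ultimately show "\<exists>\<rho>\<in>R - {1}. pv (translate \<rho> f) P = 0" using ra(1) by blast
  qed (use T finR in \<open>auto simp: T1_def\<close>)
  then have 1: "card T1 \<le> 3 * (tdeg f)\<^sup>2" using R(1,3) finR by (simp add: power2_eq_square)
  have "card T2 \<le> card R * (tdeg f * e)"
    by (rule card_le_of_cover[OF f(1), where g = G]) (use T finR G in \<open>auto simp: T2_def\<close>)
  also have "\<dots> \<le> 4 * (tdeg f * (2 * tdeg f))" unfolding R(1) using G(2) by simp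
  finally have 2: "card T2 \<le> 8 * (tdeg f)\<^sup>2" by (simp add: power2_eq_square)
  have "T = T1 \<union> T2" unfolding T1_def T2_def using cover by blast
  then have "card T \<le> card T1 + card T2" by (simp add: card_Un_le)
  then show ?thesis using 1 2 by simp
qed

text \<open>The level r measures invariance: automorphisms with k = 1 modulo 2 ^ r * m preserve the
  curve. At r = 1 the exponent k = m + 2 produces squares. For r > 1 the exponent k = 1 + m * 2 ^ (r
  - 1) produces a conjugate g; either no translate of g by \<open>sqstab J\<close> is the curve
  itself and Bezout applies, or a translate of f is invariant at level r - 1.\<close>

lemma card_torsion_points_descent:
  assumes "r \<ge> 1" "r \<le> s0"
  shows "prime_elem f \<Longrightarrow> {u. cfp f u \<noteq> 0} = J \<Longrightarrow> Z_zeta_poly n f \<Longrightarrow> finite T \<Longrightarrow>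
    (\<And>P. P \<in> T \<Longrightarrow> P ^ n = 1 \<and> pv f P = 0) \<Longrightarrow>
    (\<And>k. coprime k n \<Longrightarrow> k > 0 \<Longrightarrow> [k = 1] (mod 2 ^ r * m) \<Longrightarrow> proportional f (conj_poly n k f)) \<Longrightarrow>
    card T \<le> 11 * (tdeg f)\<^sup>2"
  using assms
proof (induction r arbitrary: f T)
  case 0
  then show ?case by simp
next
  case (Suc r')
  define r where "r = Suc r'"
  note f = Suc.prems(1,2) and Z = Suc.prems(3) and T = Suc.prems(4,5)
    and inv = Suc.prems(6)[folded r_def] and r = Suc.prems(7,8)[folded r_def]
  obtain R where R: "card R = 4" "R \<subseteq> sqstab J" "1 \<in> R"
      "\<And>\<beta>. \<beta> \<in> sqstab J \<Longrightarrow> \<exists>\<rho>\<in>R. \<exists>a\<in>stab J. \<beta> = \<rho> * a"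
      "\<And>\<rho> \<rho>' a. \<rho> \<in> R \<Longrightarrow> \<rho>' \<in> R \<Longrightarrow> a \<in> stab J \<Longrightarrow> \<rho> = \<rho>' * a \<Longrightarrow> \<rho> = \<rho>'"
    by (rule sqstab_transversal[OF J]) (rule that)
  have f0: "f \<noteq> 0" using f by auto
  have pv0: "pv f P = 0" if "P \<in> T" for P using T(2)[OF that] by simp
  \<comment> \<open>Here \<beta> = P^(m * 2^e) for the last e at which this power is outside
    \<open>stab J\<close>; thus \<beta>^2 is inside. As e is at least r, the exponent 1 + m * 2^e
    preserves the curve and sends P to \<beta> * P.\<close>
  have large: "\<exists>\<beta>\<in>sqstab J. \<beta> \<notin> stab J \<and> pv f (\<beta> * P) = 0"
    if P: "P \<in> T" "P ^ (m * 2 ^ r) \<notin> stab J" for P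
  proof -
    have "P ^ (m * 2 ^ (s0 + w)) = 1" using T(2)[OF P(1)] unfolding n_def by (simp add: mult.commute)
    then have ex: "P ^ (m * 2 ^ (s0 + w)) \<in> stab J" by simp
    define s where "s = (LEAST s. P ^ (m * 2 ^ s) \<in> stab J)"
    have s: "P ^ (m * 2 ^ s) \<in> stab J" unfolding s_def by (rule LeastI[of _ "s0 + w"]) (rule ex)
    have sr: "s > r"
    proof (rule ccontr)
      assume "\<not> s > r"
      then have "m * 2 ^ r = (m * 2 ^ s) * 2 ^ (r - s)" by (simp flip: power_add)
      then have "P ^ (m * 2 ^ r) = (P ^ (m * 2 ^ s)) ^ (2 ^ (r - s))" by (simp only: power_mult)
      then show False using P(2) stab_power[OF s, of "2 ^ (r - s)"] by simp
    qed
    define e where "e = s - 1"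
    have e: "s = Suc e" "e \<ge> r" using sr unfolding e_def by auto
    define \<beta> where "\<beta> = P ^ (m * 2 ^ e)"
    have "\<beta> ^ 2 = P ^ (m * 2 ^ s)" unfolding \<beta>_def e(1) by (simp add: mult_ac flip: power_mult)
    then have "\<beta> \<in> sqstab J" using s unfolding sqstab_def by simp
    moreover have "\<beta> \<notin> stab J"
    proof -
      have "e < (LEAST s. P ^ (m * 2 ^ s) \<in> stab J)" using e(1) unfolding s_def by simp
      then show ?thesis unfolding \<beta>_def by (rule not_less_Least)
    qed
    moreover have "pv f (\<beta> * P) = 0"
    proof -
      define k where "k = 1 + m * 2 ^ e"
      have k: "coprime k n" "k > 0" unfolding k_def using coprime_one_plus[of e] e(2) r(1) by simp_all
      interpret gc: galois_conj n k using n_pos k by unfold_locales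
      have "2 ^ r * m dvd m * 2 ^ e" using e(2) by (simp add: le_imp_power_dvd mult.commute)
      then obtain i where "m * 2 ^ e = 2 ^ r * m * i" by (elim dvdE)
      then have "[k = 1] (mod 2 ^ r * m)" unfolding k_def using cong_add_mult_self by metis
      then have "proportional f (conj_poly n k f)" using inv k by blast
      moreover have "pv (conj_poly n k f) (P ^ k) = 0" using gc.pv_conj_poly_zero[OF Z] T(2)[OF P(1)] by blast
      moreover have "P ^ k = \<beta> * P" unfolding k_def \<beta>_def by (simp add: power_add mult.commute)
      ultimately show ?thesis using proportional_pv by metis
    qed
    ultimately show ?thesis by blast
  qed
  show ?case
  proof (cases "r' = 0")
    case True
    then have r1: "r = 1" unfolding r_def by simp
    \<comment> \<open>Odd and coprime to m because m is odd, and P^k = P^m * P^2, where P^m lies in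
      \<open>sqstab J\<close> once P^(2 * m) lies in \<open>stab J\<close>.\<close>
    define k where "k = m + 2"
    have "gcd (m + 2) m = gcd 2 m" by (metis gcd_add1 add.commute)
    moreover have "gcd 2 m = 1" using m by (metis coprime_iff_gcd_eq_1 coprime_left_2_iff_odd)
    ultimately have "coprime k m" unfolding k_def coprime_iff_gcd_eq_1 by simp
    then have k: "coprime k n" "k > 0" unfolding k_def using m by (auto intro!: coprime_n)
    interpret gc: galois_conj n k using n_pos k by unfold_locales
    define g where "g = conj_poly n k f"
    have suppg: "{u. cfp g u \<noteq> 0} = J" unfolding g_def using gc.supp_conj_poly[OF Z] f(2) by simp
    show ?thesis
    proof (rule card_torsion_points_of_cover[OF f T(1) pv0 R, where G = "\<lambda>\<rho>. square_subst (translate \<rho> g)" and e = "2 * tdeg f"])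
      fix \<rho> assume "\<rho> \<in> R"
      then have nz: "mvnz \<rho>" using R(2) two_primary_mvnz sqstab_two_primary by blast
      have supp: "{u. cfp (translate \<rho> g) u \<noteq> 0} = J" using supp_translate[OF nz] suppg by simp
      then have "tdle (translate \<rho> g) (tdeg f)" using f(2) cfp_tdeg[of f] unfolding tdle_cfp by blast
      then show "\<not> f dvd square_subst (translate \<rho> g) \<and> tdle (square_subst (translate \<rho> g)) (2 * tdeg f)"
        using not_dvd_square_subst[OF f supp J] tdle_square_subst by blast
    next
      fix P assume P: "P \<in> T"
      show "(\<exists>\<beta>\<in>sqstab J. \<beta> \<notin> stab J \<and> pv f (\<beta> * P) = 0) \<or> (\<exists>\<rho>\<in>R. pv (square_subst (translate \<rho> g)) P = 0)"
      proof (cases "P ^ (m * 2 ^ r) \<in> stab J")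
        case False
        then show ?thesis using large[OF P] by blast
      next
        case True
        define \<beta> where "\<beta> = P ^ m"
        have "\<beta> ^ 2 = P ^ (m * 2 ^ r)" unfolding \<beta>_def r1 by (simp flip: power_mult)
        then have B: "\<beta> \<in> sqstab J" using True unfolding sqstab_def by simp
        obtain \<rho> a where ra: "\<rho> \<in> R" "a \<in> stab J" "\<beta> = \<rho> * a" using R(4)[OF B] by blast
        have "pv g (P ^ k) = 0" unfolding g_def using gc.pv_conj_poly_zero[OF Z] T(2)[OF P] by blast
        moreover have "P ^ k = \<rho> * a * P ^ 2" unfolding k_def ra(3)[symmetric] \<beta>_def by (simp only: power_add)
        ultimately have "pv g (\<rho> * P ^ 2) = 0" using pv_stab_coset[OF ra(2), of g \<rho>] suppg by simp
        then show ?thesis using ra(1) by auto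
      qed
    qed simp_all
  next
    case False
    then have r': "r' \<ge> 1" "r' < s0" using r unfolding r_def by auto
    \<comment> \<open>The nontrivial class modulo 2 ^ r * m among the exponents that are 1 modulo 2
      ^ r' * m; k is odd because r' is positive.\<close>
    define k where "k = 1 + m * 2 ^ r'"
    have k: "coprime k n" "k > 0" unfolding k_def using coprime_one_plus[of r'] r' by simp_all
    interpret gc: galois_conj n k using n_pos k by unfold_locales
    define g where "g = conj_poly n k f"
    have suppg: "{u. cfp g u \<noteq> 0} = J" unfolding g_def using gc.supp_conj_poly[OF Z] f(2) by simp
    have g0: "g \<noteq> 0" unfolding g_def using gc.conj_poly_nonzero[OF Z f0] .
    show ?thesis
    proof (cases "\<exists>\<rho>\<in>sqstab J. proportional f (translate \<rho> g)")
      case False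
      show ?thesis
      proof (rule card_torsion_points_of_cover[OF f T(1) pv0 R, where G = "\<lambda>\<rho>. translate \<rho> g" and e = "tdeg f"])
        fix \<rho> assume r: "\<rho> \<in> R"
        then have nz: "mvnz \<rho>" using R(2) two_primary_mvnz sqstab_two_primary by blast
        have td: "tdle (translate \<rho> g) (tdeg f)"
          unfolding g_def by (intro tdle_translate gc.tdle_conj_poly tdle_tdeg)
        then show "\<not> f dvd translate \<rho> g \<and> tdle (translate \<rho> g) (tdeg f)"
          using not_dvd_of_not_proportional[OF _ translate_nonzero[OF nz g0] td] False r R(2) by blast
      next
        fix P assume P: "P \<in> T"
        show "(\<exists>\<beta>\<in>sqstab J. \<beta> \<notin> stab J \<and> pv f (\<beta> * P) = 0) \<or> (\<exists>\<rho>\<in>R. pv (translate \<rho> g) P = 0)"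
        proof (cases "P ^ (m * 2 ^ r) \<in> stab J")
          case False
          then show ?thesis using large[OF P] by blast
        next
          case True
          define \<beta> where "\<beta> = P ^ (m * 2 ^ r')"
          have "\<beta> ^ 2 = P ^ (m * 2 ^ r)" unfolding \<beta>_def r_def by (simp add: mult_ac flip: power_mult)
          then have B: "\<beta> \<in> sqstab J" using True unfolding sqstab_def by simp
          obtain \<rho> a where ra: "\<rho> \<in> R" "a \<in> stab J" "\<beta> = \<rho> * a" using R(4)[OF B] by blast
          have "pv g (P ^ k) = 0" unfolding g_def using gc.pv_conj_poly_zero[OF Z] T(2)[OF P] by blast
          moreover have "P ^ k = \<rho> * a * P"
            unfolding k_def ra(3)[symmetric] \<beta>_def by (simp add: power_add mult.commute)
          ultimately have "pv g (\<rho> * P) = 0" using pv_stab_coset[OF ra(2), of g \<rho>] suppg by simp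
          then show ?thesis using ra(1) by auto
        qed
      qed simp_all
    next
      case True
      then obtain \<beta> where b: "\<beta> \<in> sqstab J" "proportional f (translate \<beta> g)" by blast
      \<comment> \<open>This \<alpha> absorbs the discrepancy \<beta> between f and g: raising
        \<alpha> to the exponent 1 + m * 2^r' multiplies it by exactly \<beta>, so translating f by
        \<alpha> makes it invariant at level r'.\<close>
      obtain \<alpha> where a: "\<alpha> ^ (m * 2 ^ (r - 1)) = \<beta>" "\<alpha> ^ n = 1" "two_primary \<alpha>"
        using torsion_root[OF b(1)] r by metis
      have ab: "\<alpha> ^ (m * 2 ^ r') = \<beta>" using a(1) unfolding r_def by simp
      have nz: "mvnz \<alpha>" using two_primary_mvnz[OF a(3)] .
      define f' where "f' = translate \<alpha> f"
      define T' where "T' = (\<lambda>P. pinv \<alpha> * P) ` T"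
      have "card T' = card T" unfolding T'_def
      proof (rule card_image, rule inj_onI)
        fix x y assume "pinv \<alpha> * x = pinv \<alpha> * y"
        then show "x = y" by (metis nz pinv_mult_assoc(2))
      qed
      moreover have "card T' \<le> 11 * (tdeg f')\<^sup>2"
      proof (rule Suc.IH)
        show "prime_elem f'" unfolding f'_def by (rule prime_elem_translate[OF nz f(1)])
        show "{u. cfp f' u \<noteq> 0} = J" unfolding f'_def using supp_translate[OF nz] f(2) by simp
        show "Z_zeta_poly n f'" unfolding f'_def by (rule Z_zeta_poly_translate[OF n_pos Z a(2)])
        show "finite T'" unfolding T'_def using T(1) by simp
        show "1 \<le> r'" "r' \<le> s0" using r' by auto
        fix P assume "P \<in> T'"
        then obtain Q where Q: "Q \<in> T" "P = pinv \<alpha> * Q" unfolding T'_def by blast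
        show "P ^ n = 1 \<and> pv f' P = 0"
          unfolding f'_def Q(2) using T(2)[OF Q(1)] pinv_power_one[OF a(2)] nz
          by (simp add: power_mult_distrib)
      next
        fix l assume l: "coprime l n" "l > 0" "[l = 1] (mod 2 ^ r' * m)"
        interpret l: galois_conj n l using n_pos l by unfold_locales
        have "2 ^ r' * m dvd l - 1" using l(3) by (rule cong_to_1_nat)
        then obtain j where "l - 1 = 2 ^ r' * m * j" by (elim dvdE)
        then have j: "l = 1 + m * 2 ^ r' * j" using l(2) by (simp add: mult_ac)
        have al: "\<alpha> ^ l = \<alpha> * \<beta> ^ j" unfolding j using ab by (simp add: power_add power_mult)
        have sgt: "conj_poly n l f' = translate (\<alpha> ^ l) (conj_poly n l f)" unfolding f'_def by (rule l.conj_poly_translate[OF Z a(2)])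
        have b2: "\<beta> ^ 2 \<in> stab J" using b(1) unfolding sqstab_def by simp
        show "proportional f' (conj_poly n l f')"
        proof (cases "even j")
          case True
          then obtain i where i: "j = 2 * i" by (elim evenE)
          have "l = 1 + (2 ^ r * m) * i" unfolding j i r_def by (simp add: mult_ac)
          then have "[l = 1] (mod 2 ^ r * m)" using cong_add_mult_self by metis
          then have "proportional f (conj_poly n l f)" using inv l by blast
          then have 1: "proportional (translate (\<alpha> * \<beta> ^ j) f) (conj_poly n l f')"
            unfolding sgt al by (rule proportional_translate)
          have "\<beta> ^ j \<in> stab J" unfolding i power_mult by (rule stab_power[OF b2])
          from proportional_translate[OF translate_stab[OF this], of f \<alpha>] f(2)
          have "proportional f' (translate (\<alpha> * \<beta> ^ j) f)" unfolding f'_def translate_translate by simp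
          then show ?thesis using 1 by (rule proportional_trans)
        next
          \<comment> \<open>For odd j the exponent l equals k modulo 2 ^ r * m, so l is k times an
            exponent l1 that already preserves f. The conjugate of f is then proportional to g, and
            \<beta>^j differs from \<beta> by an element of \<open>stab J\<close>.\<close>
          case False
          then obtain i where i: "j = 2 * i + 1" by (elim oddE)
          obtain k' where k': "coprime k' n" "k' > 0" "[k * k' = 1] (mod n)"
            using exists_inverse_mod[OF k(1) n_pos] by metis
          define l1 where "l1 = l * k'"
          have dvdn: "2 ^ r * m dvd n" unfolding n_def using r(2) by (simp add: le_imp_power_dvd mult_dvd_mono)
          have "l = k + (2 ^ r * m) * i" unfolding j i k_def r_def by (simp add: algebra_simps)
          then have "[l = k] (mod 2 ^ r * m)" using cong_add_mult_self by metis
          then have "[l1 = k * k'] (mod 2 ^ r * m)" unfolding l1_def by (rule cong_scalar_right)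
          moreover have "[k * k' = 1] (mod 2 ^ r * m)" using k'(3) dvdn by (rule cong_dvd_modulus_nat)
          ultimately have "[l1 = 1] (mod 2 ^ r * m)" by (rule cong_trans)
          moreover have l1: "coprime l1 n" "l1 > 0" unfolding l1_def using l k' by auto
          ultimately have "proportional f (conj_poly n l1 f)" using inv by blast
          moreover have "Z_zeta_poly n (conj_poly n l1 f)"
          proof -
            interpret l1: galois_conj n l1 using n_pos l1 by unfold_locales
            show ?thesis by (rule l1.Z_zeta_poly_conj_poly[OF Z])
          qed
          ultimately have "proportional g (conj_poly n k (conj_poly n l1 f))"
            unfolding g_def using gc.proportional_conj_poly Z f0 by blast
          moreover have "conj_poly n k (conj_poly n l1 f) = conj_poly n l f"
          proof -
            interpret kl: galois_conj n "k * l1" using n_pos k l1 by unfold_locales auto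
            have "[l * (k * k') = l * 1] (mod n)" using k'(3) by (rule cong_scalar_left)
            then have "[k * l1 = l] (mod n)" unfolding l1_def by (simp add: mult_ac)
            then show ?thesis using conj_poly_conj_poly[OF n_pos k(2) l1(2) k(1) l1(1) Z] kl.conj_poly_cong[OF _ Z] by simp
          qed
          ultimately have gl: "proportional g (conj_poly n l f)" by simp
          have 1: "proportional (translate (\<alpha> * \<beta> ^ j) g) (conj_poly n l f')"
            unfolding sgt al using gl by (rule proportional_translate)
          have "(\<beta> ^ 2) ^ i \<in> stab J" by (rule stab_power[OF b2])
          from proportional_translate[OF translate_stab[OF this], of g "\<alpha> * \<beta>"] suppg
          moreover have "\<alpha> * \<beta> * (\<beta> ^ 2) ^ i = \<alpha> * \<beta> ^ j"
            unfolding i power_add power_mult by (simp add: mult_ac)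
          ultimately have 2: "proportional (translate (\<alpha> * \<beta>) g) (translate (\<alpha> * \<beta> ^ j) g)"
            unfolding translate_translate by simp
          have "proportional f' (translate (\<alpha> * \<beta>) g)"
            unfolding f'_def translate_translate[symmetric] using b(2) by (rule proportional_translate)
          then show ?thesis using 1 2 proportional_trans by blast
        qed
      qed
      ultimately show ?thesis unfolding f'_def tdeg_translate[OF nz] by simp
    qed
  qed
qed

end

section \<open>From invariant curves to arbitrary complex curves\<close>

lemma two_power_odd_decomposition:
  assumes "N > (0::nat)" obtains e m where "N = 2 ^ e * m" "odd m"
proof -
  have "\<exists>e m. N = 2 ^ e * m \<and> odd m"
    using assms
  proof (induction N rule: less_induct)
    case (less N)
    show ?case
    proof (cases "even N")
      case True
      then obtain M where M: "N = 2 * M" by (elim evenE)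
      then obtain e m where "M = 2 ^ e * m \<and> odd m" using less by fastforce
      then show ?thesis unfolding M by (intro exI[of _ "Suc e"] exI[of _ m]) simp
    next
      case False
      then show ?thesis by (intro exI[of _ 0] exI[of _ N]) simp
    qed
  qed
  then show ?thesis using that by blast
qed

lemma zeta_mult_power: "b > 0 \<Longrightarrow> zeta (a * b) ^ b = zeta a"
  by (subst zeta_power_eq) (simp add: zeta_def)

lemma tdeg_cong_supp: "{u. cfp p u \<noteq> 0} = {u. cfp q u \<noteq> 0} \<Longrightarrow> tdeg p = tdeg q"
  unfolding tdeg_def tdle_cfp by (metis (mono_tags, lifting) mem_Collect_eq)

lemma tp_supp: "f = tp {u. cfp f u \<noteq> 0} (cfp f)"
proof -
  have "finite {u. cfp f u \<noteq> 0}"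
    by (rule finite_subset[OF _ finite_tri[of "tdeg f"]]) (use cfp_tdeg in blast)
  then show ?thesis by (intro cfp_eqI) (simp add: cfp_tp)
qed

text \<open>The descent needs coefficients in some Z[zeta n0], but f is an arbitrary complex
  polynomial. If the bound fails, T has more than (tdeg f)^2 points. Passing through T is a linear
  system over Z[zeta n0] solved by the coefficients of f, so it has a nonzero solution f' in that
  ring with support in J. Bezout gives f dvd f', and the degrees make them proportional.\<close>

theorem torsion_points_bound:
  assumes f: "prime_elem f" and nc: "noncollinear {u. cfp f u \<noteq> 0}"
    and T: "finite T" and N: "N > 0" and TN: "\<And>P. P \<in> T \<Longrightarrow> P ^ N = 1 \<and> pv f P = 0"
  shows "card T \<le> 11 * (tdeg f)\<^sup>2"
proof (rule ccontr)
  assume contra: "\<not> ?thesis"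
  then have big: "card T > tdeg f * tdeg f" by (simp add: power2_eq_square)
  define J where "J = {u. cfp f u \<noteq> 0}"
  have finJ: "finite J"
    unfolding J_def by (rule finite_subset[OF _ finite_tri[of "tdeg f"]]) (use cfp_tdeg in blast)
  have f0: "f \<noteq> 0" using f by auto
  obtain e m where em: "N = 2 ^ e * m" "odd m" using two_power_odd_decomposition[OF N] by blast
  \<comment> \<open>One more than the exponent of 2 in N, so that the starting level is positive
    even when N is odd.\<close>
  define s0 where "s0 = Suc e"
  obtain w where w: "\<And>\<alpha>. \<alpha> \<in> stab J \<Longrightarrow> \<alpha> ^ (2 ^ w) = 1"
    using stab_exponent[OF nc] unfolding J_def by metis
  interpret desc: descent J m w s0
    using nc em(2) w by unfold_locales (simp_all add: J_def)
  define n0 where "n0 = 2 ^ s0 * m"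
  have n0: "n0 > 0" "n0 = N * 2" "desc.n = n0 * 2 ^ w"
  proof -
    show "n0 > 0" "n0 = N * 2" unfolding n0_def s0_def em(1) using N em by (auto intro!: Nat.gr0I)
    show "desc.n = n0 * 2 ^ w" unfolding n0_def desc.n_def by (simp add: power_add)
  qed
  have Tn0: "P ^ n0 = 1" "pv f P = 0" if "P \<in> T" for P
    using TN[OF that] unfolding n0(2) by (simp_all add: power_mult)
  have "\<exists>c'. (\<forall>u\<in>J. c' u \<in> Z_zeta n0) \<and> (\<exists>u\<in>J. c' u \<noteq> 0) \<and> (\<forall>P\<in>T. (\<Sum>u\<in>J. mv P u * c' u) = 0)"
  proof (rule homogeneous_system_subring[where c = "cfp f"])
    show "\<exists>u\<in>J. cfp f u \<noteq> 0" using f0 unfolding J_def cfp_nonzero_iff by blast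
    fix P assume P: "P \<in> T"
    show "(\<Sum>u\<in>J. mv P u * cfp f u) = 0"
      using Tn0(2)[OF P] pv_tp[of J "cfp f" P] tp_supp[of f] unfolding J_def by (simp add: mult.commute)
  next
    fix P u assume "P \<in> T"
    then show "mv P u \<in> Z_zeta n0" using Z_zeta_mv[OF n0(1)] Tn0(1) by blast
  qed (use finJ Z_zeta_ring in auto)
  then obtain c' where c': "\<And>u. u \<in> J \<Longrightarrow> c' u \<in> Z_zeta n0" "\<exists>u\<in>J. c' u \<noteq> 0"
    "\<And>P. P \<in> T \<Longrightarrow> (\<Sum>u\<in>J. mv P u * c' u) = 0" by blast
  define f' where "f' = tp J c'"
  have cf': "cfp f' u = (if u \<in> J then c' u else 0)" for u unfolding f'_def using finJ by (rule cfp_tp)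
  have Zf': "cfp f' u \<in> Z_zeta n0" for u unfolding cf' using c'(1) Z_zeta_ring(1) by simp
  have f'0: "f' \<noteq> 0" unfolding cfp_nonzero_iff cf' using c'(2) by auto
  have tf': "tdle f' (tdeg f)" unfolding tdle_cfp cf' using cfp_tdeg[of f] unfolding J_def by auto
  have pf': "pv f' P = 0" if "P \<in> T" for P
    using c'(3)[OF that] unfolding f'_def pv_tp by (simp add: mult.commute)
  have "f dvd f'"
  proof (rule ccontr)
    assume "\<not> f dvd f'"
    from bezout_prime[OF f this tf' T] have "card T \<le> tdeg f * tdeg f"
      using Tn0(2) pf' unfolding pv_def by blast
    then show False using big by simp
  qed
  then have pr: "proportional f f'" using f'0 tf' by (rule dvd_proportional)
  then obtain c where c: "c \<noteq> 0" "f' = con c * f" unfolding proportional_def by blast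
  have "con c * con (inverse c) = 1" using c(1) by (simp add: con_mult_con)
  then have "is_unit (con c)" by (metis dvd_triv_left)
  then have primef': "prime_elem f'" unfolding c(2) using f by (simp add: prime_elem_mult_unit_left)
  have suppf': "{u. cfp f' u \<noteq> 0} = J" unfolding J_def by (rule proportional_supp[OF pr])
  have Znn: "Z_zeta n0 \<subseteq> Z_zeta desc.n"
  proof
    fix x assume "x \<in> Z_zeta n0"
    then obtain q where "x = int_eval q (zeta n0)" unfolding Z_zeta_def by blast
    also have "\<dots> = int_eval (q \<circ>\<^sub>p Polynomial.monom 1 (2 ^ w)) (zeta desc.n)"
      unfolding n0(3) by (simp add: int_eval_pcompose zeta_mult_power)
    finally show "x \<in> Z_zeta desc.n" using Z_zetaI by metis
  qed
  have "card T \<le> 11 * (tdeg f')\<^sup>2"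
  proof (rule desc.card_torsion_points_descent[of s0])
    show "1 \<le> s0" "s0 \<le> s0" unfolding s0_def by auto
    show "prime_elem f'" "{u. cfp f' u \<noteq> 0} = J" "finite T" by (fact primef' suppf' T)+
    show "Z_zeta_poly desc.n f'" unfolding Z_zeta_poly_def using Zf' Znn by blast
    fix P assume "P \<in> T"
    then show "P ^ desc.n = 1 \<and> pv f' P = 0"
      using pf' Tn0(1) unfolding n0(3) by (simp add: power_mult)
  next
    fix k assume k: "coprime k desc.n" "k > 0" "[k = 1] (mod 2 ^ s0 * m)"
    interpret gc: galois_conj desc.n k using desc.n_pos k by unfold_locales
    \<comment> \<open>An exponent that is 1 modulo n0 fixes \<open>zeta n0\<close> and with it every
      coefficient, so invariance at the starting level s0 holds with equality.\<close>
    have "conj_poly desc.n k f' = f'"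
    proof (rule cfp_eqI)
      fix u
      obtain q where q: "cfp f' u = int_eval q (zeta n0)" using Zf'[of u] unfolding Z_zeta_def by blast
      also have "\<dots> = int_eval (q \<circ>\<^sub>p Polynomial.monom 1 (2 ^ w)) (zeta desc.n)"
        unfolding n0(3) by (simp add: int_eval_pcompose zeta_mult_power)
      finally have e: "cfp f' u = int_eval (q \<circ>\<^sub>p Polynomial.monom 1 (2 ^ w)) (zeta desc.n)" .
      have "galois desc.n k (cfp f' u) = int_eval (q \<circ>\<^sub>p Polynomial.monom 1 (2 ^ w)) (zeta desc.n ^ k)"
        unfolding e by (rule gc.galois_int_eval)
      also have "\<dots> = int_eval q ((zeta desc.n ^ k) ^ (2 ^ w))" by (simp add: int_eval_pcompose)
      also have "(zeta desc.n ^ k) ^ (2 ^ w) = (zeta desc.n ^ (2 ^ w)) ^ k" by (simp flip: power_mult add: mult.commute)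
      also have "zeta desc.n ^ (2 ^ w) = zeta n0" unfolding n0(3) by (simp add: zeta_mult_power)
      also have "zeta n0 ^ k = zeta n0 ^ 1"
        using zeta_pow_self[OF n0(1)] k(3) unfolding n0_def by (rule power_cong_root_of_unity)
      finally show "cfp (conj_poly desc.n k f') u = cfp f' u" using q by simp
    qed
    then show "proportional f' (conj_poly desc.n k f')" by simp
  qed
  moreover have "tdeg f' = tdeg f" using suppf' unfolding J_def by (rule tdeg_cong_supp)
  ultimately show False using contra by simp
qed

text \<open>Degrees add, so when a product carries more than K times its degree of points, one of
  the two factors does as well. The induction ends at a prime because a unit has no zeros.\<close>

lemma many_points_on_prime_factor:
  assumes "f \<noteq> 0" "finite T" "\<And>P. P \<in> T \<Longrightarrow> pv f P = 0" "card T > K * tdeg f"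
  obtains g where "prime_elem g" "tdeg g \<le> tdeg f" "card {P\<in>T. pv g P = 0} > K * tdeg g"
proof -
  have "\<exists>g. prime_elem g \<and> tdeg g \<le> tdeg f \<and> card {P\<in>T. pv g P = 0} > K * tdeg g"
    using assms
  proof (induction f arbitrary: T rule: prime_divisors_induct)
    case zero
    then show ?case by simp
  next
    case (unit f)
    then obtain h where h: "1 = f * h" by (elim dvdE)
    obtain P where "P \<in> T" using unit.prems by (metis all_not_in_conv card.empty not_less0)
    then have "pv (f * h) P = 0" using unit.prems(3) by simp
    then show ?case unfolding h[symmetric] by simp
  next
    case (factor p f)
    have p: "prime_elem p" using factor.hyps by blast
    then have p0: "p \<noteq> 0" "f \<noteq> 0" using factor.prems(1) by auto
    have deg: "tdeg (p * f) = tdeg p + tdeg f" using p0 by (rule tdeg_mult)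
    define T1 where "T1 = {P\<in>T. pv p P = 0}"
    define T2 where "T2 = {P\<in>T. pv f P = 0}"
    have "T = T1 \<union> T2" unfolding T1_def T2_def using factor.prems(3) by auto
    then have "card T \<le> card T1 + card T2" by (simp add: card_Un_le)
    then have "K * tdeg p + K * tdeg f < card T1 + card T2"
      using factor.prems(4) unfolding deg by (simp add: distrib_left)
    then have "card T1 > K * tdeg p \<or> card T2 > K * tdeg f" by linarith
    then show ?case
    proof
      assume "card T1 > K * tdeg p"
      then show ?case using p deg unfolding T1_def by (intro exI[of _ p]) simp
    next
      assume c: "card T2 > K * tdeg f"
      have "\<exists>g. prime_elem g \<and> tdeg g \<le> tdeg f \<and> card {P\<in>T2. pv g P = 0} > K * tdeg g"
        using factor.prems(2) c by (intro factor.IH[OF p0(2)]) (auto simp: T2_def)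
      then obtain g where g: "prime_elem g" "tdeg g \<le> tdeg f" "card {P\<in>T2. pv g P = 0} > K * tdeg g"
        by blast
      have "card {P\<in>T2. pv g P = 0} \<le> card {P\<in>T. pv g P = 0}"
        using factor.prems(2) by (intro card_mono) (auto simp: T2_def)
      then show ?case using g deg by (intro exI[of _ g]) simp
    qed
  qed
  then show ?thesis using that by blast
qed

section \<open>Curves with collinear support and binomial relations\<close>

lemma collinear_parametrization:
  fixes J :: "(nat \<times> nat) set"
  assumes "\<not> noncollinear J" "u0 \<in> J" "u1 \<in> J" "u0 \<noteq> u1"
  obtains a b :: int where "coprime a b" "a \<ge> 0"
    "\<And>u. u \<in> J \<Longrightarrow> \<exists>t::int. int (fst u) = int (fst u0) + t * a \<and> int (snd u) = int (snd u0) + t * b"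
proof -
  define x where "x = int (fst u1) - int (fst u0)"
  define y where "y = int (snd u1) - int (snd u0)"
  have xy: "x \<noteq> 0 \<or> y \<noteq> 0" using assms(4) unfolding x_def y_def by (auto simp: prod_eq_iff)
  obtain a0 b0 where ab0: "x = gcd x y * a0" "y = gcd x y * b0" "coprime a0 b0"
    using gcd_coprime_exists[of x y] xy by (auto simp: mult.commute)
  define sgn where "sgn = (if a0 \<ge> 0 then 1 else -1 :: int)"
  define a where "a = sgn * a0"
  define b where "b = sgn * b0"
  have s2: "sgn * sgn = 1" unfolding sgn_def by simp
  have cop: "coprime a b" using ab0(3) unfolding a_def b_def sgn_def by auto
  have a0: "a \<ge> 0" unfolding a_def sgn_def by simp
  have g0: "gcd x y \<noteq> 0" using xy by simp
  have "\<exists>t::int. int (fst u) = int (fst u0) + t * a \<and> int (snd u) = int (snd u0) + t * b"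
    if u: "u \<in> J" for u
  proof -
    define p where "p = int (fst u) - int (fst u0)"
    define q where "q = int (snd u) - int (snd u0)"
    have "x * q = p * y"
      using assms(1-3) u unfolding noncollinear_def x_def y_def p_def q_def by blast
    then have "gcd x y * (a0 * q) = gcd x y * (p * b0)" using ab0(1,2) by (metis mult.assoc mult.left_commute)
    then have "a0 * q = p * b0" using g0 by (metis mult_left_cancel)
    then have eq: "a * q = p * b" unfolding a_def b_def by (simp add: mult_ac)
    have "a dvd p * b" using eq by (metis dvd_triv_left)
    then have "a dvd p" using cop by (metis coprime_dvd_mult_left_iff)
    then obtain t where t: "p = a * t" by (elim dvdE)
    show ?thesis
    proof (cases "a = 0")
      case False
      then have "q = t * b" using eq t by simp
      then show ?thesis using t unfolding p_def q_def by (intro exI[of _ t]) (simp add: algebra_simps)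
    next
      case True
      \<comment> \<open>In the vertical direction b is 1 or -1 and equals its own inverse, hence the
        witness q * b.\<close>
      then have "p = 0" "b = 1 \<or> b = -1" using t cop by auto
      then show ?thesis using True unfolding p_def q_def
        by (intro exI[of _ "q * b"]) (auto simp: q_def)
    qed
  qed
  then show ?thesis using that cop a0 by blast
qed

lemma root_count_collinear:
  fixes c :: "'u \<Rightarrow> complex" and t :: "'u \<Rightarrow> nat" and mx :: nat
  assumes "finite J" "J \<noteq> {}" "\<And>u. u \<in> J \<Longrightarrow> c u \<noteq> 0" "inj_on t J"
    "\<And>u. u \<in> J \<Longrightarrow> t u \<le> mx"
  obtains Rt where "finite Rt" "card Rt \<le> mx" "\<And>x. (\<Sum>u\<in>J. c u * x ^ t u) = 0 \<Longrightarrow> x \<in> Rt"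
proof -
  define q where "q = (\<Sum>u\<in>J. Polynomial.monom (c u) (t u))"
  have ev: "poly q x = (\<Sum>u\<in>J. c u * x ^ t u)" for x
    unfolding q_def by (simp add: poly_sum poly_monom)
  obtain v where v: "v \<in> J" using assms(2) by blast
  have "coeff q (t v) = (\<Sum>u\<in>J. if u = v then c v else 0)"
    unfolding q_def coeff_sum using assms(4) v by (intro sum.cong) (auto simp: inj_on_def)
  then have "coeff q (t v) = c v" using assms(1) v by simp
  then have q0: "q \<noteq> 0" using assms(3)[OF v] by auto
  have "degree q \<le> mx" unfolding q_def
    using assms(1,5) by (intro degree_sum_le) (auto intro: order_trans[OF degree_monom_le])
  then show ?thesis
    using that[of "{x. poly q x = 0}"] poly_roots_finite[OF q0] poly_roots_degree[OF q0] unfolding ev by simp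
qed

lemma large_fibre:
  fixes h :: "'p \<Rightarrow> 'x" and k :: nat
  assumes "finite T" "finite Rt" "\<And>P. P \<in> T \<Longrightarrow> h P \<in> Rt" "card T > card Rt * k"
  obtains x where "card {P\<in>T. h P = x} > k"
proof -
  have "\<exists>x. card {P\<in>T. h P = x} > k"
  proof (rule ccontr)
    assume "\<not> ?thesis"
    then have le: "card {P\<in>T. h P = x} \<le> k" for x by (simp add: not_less)
    have "T = (\<Union>x\<in>Rt. {P\<in>T. h P = x})" using assms(3) by blast
    then have "card T \<le> (\<Sum>x\<in>Rt. card {P\<in>T. h P = x})" using card_UN_le[OF assms(2)] by metis
    also have "\<dots> \<le> card Rt * k" using le sum_mono[of Rt "\<lambda>x. card {P\<in>T. h P = x}" "\<lambda>_. k"] by simp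
    finally show False using assms(4) by simp
  qed
  then show ?thesis using that by blast
qed

text \<open>The alternatives are x^a y^b = const and x^a = const * y^b, written as a comparison of
  pairs of points so that the constant is not named. The thresholds d * (a + b) and d * max a b are
  the degrees in the parameter t that a polynomial of degree d can reach on such a curve.\<close>

definition on_binomial :: "nat \<Rightarrow> cpt set \<Rightarrow> bool" where
  "on_binomial d T \<longleftrightarrow> (\<exists>a b. coprime a b \<and>
     ((\<exists>T'\<subseteq>T. card T' > d * (a + b) \<and>
         (\<forall>P\<in>T'. \<forall>Q\<in>T'. fst P ^ a * snd P ^ b = fst Q ^ a * snd Q ^ b)) \<or>
      (\<exists>T'\<subseteq>T. card T' > d * max a b \<and>
         (\<forall>P\<in>T'. \<forall>Q\<in>T'. fst P ^ a * snd Q ^ b = fst Q ^ a * snd P ^ b))))"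

text \<open>Up to a monomial, g is a polynomial of degree at most mx in h = x^a y^b, where (a, b) is
  the primitive direction of the support. Hence h takes at most mx values on T, and since mx * e is
  at most \<open>tdeg g\<close>, some fibre of h has more than d * e points.\<close>

lemma collinear_on_binomial:
  assumes nc: "\<not> noncollinear {u. cfp g u \<noteq> 0}" and g0: "g \<noteq> 0"
    and T: "finite T" "\<And>P. P \<in> T \<Longrightarrow> mvnz P \<and> pv g P = 0" "card T > d * tdeg g"
  shows "on_binomial d T"
proof -
  define J where "J = {u. cfp g u \<noteq> 0}"
  have finJ: "finite J"
    unfolding J_def by (rule finite_subset[OF _ finite_tri[of "tdeg g"]]) (use cfp_tdeg in blast)
  have J0: "J \<noteq> {}" using g0 unfolding cfp_nonzero_iff J_def by blast
  have pvJ: "pv g P = (\<Sum>u\<in>J. cfp g u * mv P u)" for P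
    using tp_supp[of g] pv_tp[of J "cfp g" P] unfolding J_def by simp
  obtain v0 where v0: "v0 \<in> J" using J0 by blast
  obtain Q where Q: "Q \<in> T" using T(3) by (metis all_not_in_conv card.empty not_less0)
  have "\<exists>v1\<in>J. v1 \<noteq> v0"
  proof (rule ccontr)
    assume "\<not> (\<exists>v1\<in>J. v1 \<noteq> v0)"
    then have "J = {v0}" using v0 by blast
    then have "pv g Q = cfp g v0 * mv Q v0" using pvJ by simp
    then show False using T(2)[OF Q] mv_nonzero v0 unfolding J_def by simp
  qed
  then obtain v1 where v1: "v1 \<in> J" "v0 \<noteq> v1" by blast
  obtain a b :: int where ab: "coprime a b" "a \<ge> 0"
    and ex: "\<And>u. u \<in> J \<Longrightarrow> \<exists>s::int. int (fst u) = int (fst v0) + s * a \<and> int (snd u) = int (snd v0) + s * b"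
    using collinear_parametrization[OF nc[folded J_def] v0 v1] by metis
  obtain s where s: "\<And>u. u \<in> J \<Longrightarrow> int (fst u) = int (fst v0) + s u * a \<and> int (snd u) = int (snd v0) + s u * b"
    using ex by metis
  have "Min (s ` J) \<in> s ` J" "Max (s ` J) \<in> s ` J" using finJ J0 by auto
  then obtain um uM where um: "um \<in> J" "s um = Min (s ` J)" and uM: "uM \<in> J" "s uM = Max (s ` J)" by auto
  have bnd: "s um \<le> s u" "s u \<le> s uM" if "u \<in> J" for u using that finJ um(2) uM(2) by auto
  define t where "t = (\<lambda>u. nat (s u - s um))"
  define mx where "mx = t uM"
  have t: "int (fst u) = int (fst um) + int (t u) * a" "int (snd u) = int (snd um) + int (t u) * b"
    if "u \<in> J" for u
    using s[OF that] s[OF um(1)] bnd[OF that] unfolding t_def by (auto simp: algebra_simps)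
  have tmu: "t u \<le> mx" if "u \<in> J" for u using bnd[OF that] unfolding mx_def t_def by simp
  have inj: "inj_on t J"
    using t by (intro inj_onI) (metis of_nat_eq_iff prod_eq_iff)
  have c0: "cfp g u \<noteq> 0" if "u \<in> J" for u using that unfolding J_def by simp
  obtain Rt where Rt: "finite Rt" "card Rt \<le> mx"
    "\<And>x. (\<Sum>u\<in>J. cfp g u * x ^ t u) = 0 \<Longrightarrow> x \<in> Rt"
    by (rule root_count_collinear[where c = "cfp g", OF finJ J0 c0 inj tmu]) (assumption, assumption, rule that)
  define h where "h = (\<lambda>P::cpt. fst P powi a * snd P powi b)"
  have mvt: "mv P u = mv P um * h P ^ t u" if "u \<in> J" "mvnz P" for P u
  proof -
    have nz: "fst P \<noteq> 0" "snd P \<noteq> 0" using that(2) unfolding mvnz_def by auto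
    have "mv P u = fst P powi int (fst u) * snd P powi int (snd u)" unfolding mv_def by simp
    also have "\<dots> = fst P powi int (fst um) * snd P powi int (snd um) *
        ((fst P powi a) powi int (t u) * (snd P powi b) powi int (t u))"
      unfolding t[OF that(1)] using nz
      by (simp add: power_int_add power_int_mult[symmetric] mult_ac del: power_int_of_nat)
    also have "\<dots> = mv P um * h P ^ t u"
      unfolding mv_def h_def by (simp add: power_mult_distrib)
    finally show ?thesis .
  qed
  have hX: "h P \<in> Rt" if P: "P \<in> T" for P
  proof (rule Rt(3))
    have nz: "mvnz P" using T(2)[OF P] by simp
    have "0 = (\<Sum>u\<in>J. cfp g u * mv P u)" using T(2)[OF P] pvJ by simp
    also have "\<dots> = (\<Sum>u\<in>J. mv P um * (cfp g u * h P ^ t u))"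
      using mvt[OF _ nz] by (intro sum.cong refl) (simp add: mult_ac)
    finally have "mv P um * (\<Sum>u\<in>J. cfp g u * h P ^ t u) = 0" by (simp add: sum_distrib_left)
    then show "(\<Sum>u\<in>J. cfp g u * h P ^ t u) = 0" using mv_nonzero[OF nz] by simp
  qed
  \<comment> \<open>The degree of the binomial, depending on the sign of b. The two ends of the
    support differ by mx * (a, b) and have nonnegative coordinates, which bounds mx * e by the
    degree of g.\<close>
  define e where "e = (if b \<ge> 0 then nat a + nat b else max (nat a) (nat (- b)))"
  have emu: "mx * e \<le> tdeg g"
  proof -
    have top: "fst uM + snd uM \<le> tdeg g" "fst um + snd um \<le> tdeg g"
      using cfp_tdeg[OF c0[OF uM(1)]] cfp_tdeg[OF c0[OF um(1)]] unfolding tri_def by auto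
    have tM: "int (fst uM) = int (fst um) + int mx * a" "int (snd uM) = int (snd um) + int mx * b"
      using t[OF uM(1)] unfolding mx_def by auto
    show ?thesis
    proof (cases "b \<ge> 0")
      case True
      then have "int (mx * e) = int mx * a + int mx * b" unfolding e_def using ab(2) by (simp add: distrib_left)
      also have "\<dots> \<le> int (fst uM + snd uM)" using tM by simp
      finally show ?thesis using top by linarith
    next
      case False
      have "int (mx * nat a) \<le> int (fst uM)" using tM(1) ab(2) by simp
      then have 1: "mx * nat a \<le> tdeg g" using top by linarith
      have "int (mx * nat (- b)) \<le> int (snd um)" using tM(2) False by simp
      then have 2: "mx * nat (- b) \<le> tdeg g" using top by linarith
      show ?thesis using 1 2 False unfolding e_def by (simp add: max_def)
    qed
  qed
  have "card Rt * (d * e) \<le> mx * (d * e)" using Rt(2) by simp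
  also have "\<dots> \<le> d * tdeg g" using emu by (metis mult.left_commute mult_le_mono2)
  finally have lt: "card Rt * (d * e) < card T" using T(3) by (rule le_less_trans)
  obtain x where x: "card {P\<in>T. h P = x} > d * e"
    by (rule large_fibre[where h = h, OF T(1) Rt(1) hX lt]) (assumption, rule that)
  define T' where "T' = {P\<in>T. h P = x}"
  have nzT: "fst P \<noteq> 0" "snd P \<noteq> 0" if "P \<in> T'" for P
    using that T(2) unfolding T'_def mvnz_def by auto
  have hT: "h P = h Q" if "P \<in> T'" "Q \<in> T'" for P Q using that unfolding T'_def by simp
  show ?thesis
  proof (cases "b \<ge> 0")
    case True
    have "coprime (nat a) (nat b)" using ab True by (simp add: coprime_nat_abs_left_iff flip: coprime_int_iff)
    moreover have "fst P ^ nat a * snd P ^ nat b = fst Q ^ nat a * snd Q ^ nat b" if "P \<in> T'" "Q \<in> T'" for P Q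
      using hT[OF that] True ab(2) unfolding h_def power_int_def by simp
    moreover have "card T' > d * (nat a + nat b)" using x True unfolding T'_def e_def by simp
    moreover have "T' \<subseteq> T" unfolding T'_def by blast
    ultimately show ?thesis unfolding on_binomial_def by blast
  next
    case False
    have "coprime (nat a) (nat (- b))" using ab False by (simp flip: coprime_int_iff)
    moreover have "fst P ^ nat a * snd Q ^ nat (- b) = fst Q ^ nat a * snd P ^ nat (- b)"
      if "P \<in> T'" "Q \<in> T'" for P Q
      using hT[OF that] False ab(2) nzT[OF that(1)] nzT[OF that(2)]
      unfolding h_def power_int_def by (simp add: power_inverse field_simps)
    moreover have "card T' > d * max (nat a) (nat (- b))" using x False unfolding T'_def e_def by simp
    moreover have "T' \<subseteq> T" unfolding T'_def by blast
    ultimately show ?thesis unfolding on_binomial_def by blast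
  qed
qed

lemma on_binomial_mono: "on_binomial d T \<Longrightarrow> T \<subseteq> T1 \<Longrightarrow> on_binomial d T1"
  unfolding on_binomial_def by (meson order_trans)

text \<open>The prime factor g is chosen with more than 11 * d * tdeg g points. This number is at
  least 11 * (tdeg g)^2, which excludes noncollinear support, and at least d * tdeg g, which is what
  the collinear case asks for.\<close>

theorem torsion_points_on_binomial:
  assumes f: "f \<noteq> 0" "tdle f d" and T: "finite T" and N: "N > 0"
    and TN: "\<And>P. P \<in> T \<Longrightarrow> P ^ N = 1 \<and> pv f P = 0" and card: "card T > 11 * d\<^sup>2"
  shows "on_binomial d T"
proof -
  have td: "tdeg f \<le> d" using f(2) unfolding tdle_iff_tdeg .
  have "11 * d * tdeg f \<le> 11 * d\<^sup>2" using td by (simp add: power2_eq_square)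
  then have "card T > 11 * d * tdeg f" using card by linarith
  then obtain g where g: "prime_elem g" "tdeg g \<le> tdeg f" "card {P\<in>T. pv g P = 0} > 11 * d * tdeg g"
    using many_points_on_prime_factor[OF f(1) T, of "11 * d"] TN by blast
  define T1 where "T1 = {P\<in>T. pv g P = 0}"
  have T1: "finite T1" "T1 \<subseteq> T" "\<And>P. P \<in> T1 \<Longrightarrow> P ^ N = 1 \<and> pv g P = 0"
    unfolding T1_def using T TN by auto
  have "\<not> noncollinear {u. cfp g u \<noteq> 0}"
  proof
    assume "noncollinear {u. cfp g u \<noteq> 0}"
    then have "card T1 \<le> 11 * (tdeg g)\<^sup>2"
      using torsion_points_bound[OF g(1) _ T1(1) N T1(3)] by blast
    also have "\<dots> \<le> 11 * d * tdeg g" using g(2) td by (simp add: power2_eq_square)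
    finally show False using g(3) unfolding T1_def by simp
  qed
  moreover have "g \<noteq> 0" using g(1) by auto
  moreover have "mvnz P \<and> pv g P = 0" if "P \<in> T1" for P
    using T1(3)[OF that] root_of_unity_mvnz N by blast
  moreover have "d * tdeg g < card T1"
  proof -
    have "d * tdeg g \<le> 11 * d * tdeg g" by simp
    then show ?thesis using g(3) unfolding T1_def by linarith
  qed
  ultimately have "on_binomial d T1" using collinear_on_binomial T1(1) by blast
  then show ?thesis using T1(2) by (rule on_binomial_mono)
qed

subsection \<open>Points of finite order over a field\<close>

context field
begin

lemma eval_map_rev:
  assumes "\<And>i. i < n \<Longrightarrow> h i \<in> carrier R" "t \<in> carrier R"
  shows "eval (map h (rev [0..<n])) t = (\<Oplus>i\<in>{..<n}. h i \<otimes> t [^] i)"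
  using assms(1)
proof (induction n)
  case 0
  then show ?case by simp
next
  case (Suc n)
  have "eval (map h (rev [0..<Suc n])) t = h n \<otimes> t [^] n \<oplus> eval (map h (rev [0..<n])) t"
    by simp
  also have "\<dots> = (\<Oplus>i\<in>insert n {..<n}. h i \<otimes> t [^] i)"
    using Suc assms(2) by (subst finsum_insert) (auto simp: Pi_def)
  finally show ?case by (simp add: lessThan_Suc)
qed

text \<open>The coefficient function is turned into a normalised coefficient list, leading
  coefficient first, so that the root count for list polynomials applies.\<close>

lemma polynomial_function_zero:
  assumes h: "\<And>i. i \<le> D \<Longrightarrow> h i \<in> carrier R"
    and S: "finite S" "S \<subseteq> carrier R" "card S > D"
    and zero: "\<And>t. t \<in> S \<Longrightarrow> (\<Oplus>i\<in>{..D}. h i \<otimes> t [^] i) = \<zero>"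
    and i: "i \<le> D"
  shows "h i = \<zero>"
proof -
  define l where "l = map h (rev [0..<Suc D])"
  define p where "p = normalize l"
  have setl: "set l \<subseteq> carrier R" unfolding l_def using h by auto
  have p: "p \<in> carrier (poly_ring R)"
    unfolding p_def univ_poly_carrier[symmetric] using normalize_gives_polynomial[OF setl] .
  have root: "eval p t = \<zero>" if t: "t \<in> S" for t
  proof -
    have tR: "t \<in> carrier R" using t S(2) by auto
    have "eval p t = eval l t" unfolding p_def by (rule eval_normalize[OF setl tR])
    also have "\<dots> = (\<Oplus>i\<in>{..<Suc D}. h i \<otimes> t [^] i)"
      unfolding l_def using h tR by (intro eval_map_rev) auto
    finally show ?thesis using zero[OF t] by (simp add: lessThan_Suc_atMost)
  qed
  have size_le: "card (set_mset M) \<le> size M" for M :: "'a multiset"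
    by (induction M) (auto simp: card_insert_if)
  have "p = []"
  proof (rule ccontr)
    assume "p \<noteq> []"
    then have "S \<subseteq> set_mset (roots p)"
      using root S(2) roots_mem_iff_is_root[OF p] unfolding is_root_def by auto
    then have "card S \<le> card (set_mset (roots p))" by (intro card_mono) auto
    also have "\<dots> \<le> size (roots p)" by (rule size_le)
    also have "\<dots> \<le> length p - 1" by (rule size_roots_le_degree[OF p])
    also have "\<dots> \<le> D" using normalize_length_le[of l] unfolding p_def l_def by simp
    finally show False using S(3) by simp
  qed
  then have "l = replicate (length l) \<zero>"
    using normalize_def'(1)[of l] unfolding p_def by simp
  then have "\<forall>x\<in>set l. x = \<zero>" by (metis in_set_replicate)
  moreover have "h i \<in> set l"
    unfolding l_def set_map set_rev set_upt using i by (intro imageI) simp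
  ultimately show ?thesis by blast
qed

lemma card_roots_of_unity_le:
  assumes "finite S" "c > 0" "\<And>t. t \<in> S \<Longrightarrow> t \<in> carrier R \<and> t [^] (c::nat) = \<one>"
  shows "card S \<le> c"
proof (rule ccontr)
  assume contra: "\<not> card S \<le> c"
  define h where "h = (\<lambda>i. if i = c then \<one> else if i = 0 then \<ominus> \<one> else \<zero>)"
  have "h c = \<zero>"
  proof (rule polynomial_function_zero[where S = S and D = c])
    fix t assume "t \<in> S"
    then have t: "t \<in> carrier R" "t [^] c = \<one>" using assms(3) by auto
    have "(\<Oplus>i\<in>{..c}. h i \<otimes> t [^] i) = (\<Oplus>i\<in>{0, c}. h i \<otimes> t [^] i)"
      using t(1) by (intro add.finprod_mono_neutral_cong_right) (auto simp: h_def)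
    also have "\<dots> = \<zero>"
      using t assms(2) by (simp add: h_def r_neg l_neg)
    finally show "(\<Oplus>i\<in>{..c}. h i \<otimes> t [^] i) = \<zero>" .
  qed (use assms contra in \<open>auto simp: h_def\<close>)
  then show False unfolding h_def by simp
qed

lemma mult_of_comm_group: "comm_group (Multiplicative_Group.mult_of R)"
  by (rule group.group_comm_groupI[OF field_mult_group]) (auto simp: m_comm)

end

lemma (in comm_group) ord_mult_coprime:
  assumes x: "x \<in> carrier G" and y: "y \<in> carrier G" and cop: "coprime (ord x) (ord y)"
  shows "ord (x \<otimes> y) = ord x * ord y"
proof (rule dvd_antisym)
  show "ord (x \<otimes> y) dvd ord x * ord y" by (rule abelian_ord_mul_divides[OF x y])
  define k where "k = ord (x \<otimes> y)"
  have xy: "x [^] k \<otimes> y [^] k = \<one>"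
    unfolding k_def pow_mult_distrib[OF m_comm[OF x y] x y, symmetric] using x y by simp
  have dvd: "ord u dvd k" if u: "u \<in> carrier G" and v: "v \<in> carrier G" and uv: "u [^] k \<otimes> v [^] k = \<one>"
    and c: "coprime (ord u) (ord v)" for u v
  proof -
    have "\<one> = (u [^] k \<otimes> v [^] k) [^] ord v" unfolding uv by simp
    also have "\<dots> = (u [^] k) [^] ord v \<otimes> (v [^] k) [^] ord v"
      using u v by (intro pow_mult_distrib m_comm) auto
    also have "(v [^] k) [^] ord v = \<one>"
      using v by (metis mult.commute nat_pow_pow nat_pow_one pow_ord_eq_1)
    finally have "u [^] (k * ord v) = \<one>" using u by (simp add: nat_pow_pow)
    then have "ord u dvd k * ord v" using pow_eq_id[OF u] by simp
    then show ?thesis using c by (simp add: coprime_dvd_mult_left_iff)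
  qed
  have "ord x dvd k" using dvd[OF x y xy cop] .
  moreover have "ord y dvd k"
    using dvd[OF y x] xy cop x y by (simp add: m_comm coprime_commute)
  ultimately show "ord x * ord y dvd ord (x \<otimes> y)" unfolding k_def using cop by (rule semiring_gcd_class.divides_mult)
qed

context field
begin

text \<open>Let w have the largest order among the elements whose order divides N. If ord x did not
  divide ord w, some prime would occur in ord x with a higher power, and combining the two elements
  would give a larger order. Thus x is a root of X^(ord w) - 1, whose roots are already exhausted by
  the powers of w.\<close>

lemma common_generator:
  assumes S: "finite S" "S \<subseteq> carrier (Multiplicative_Group.mult_of R)" "\<And>x. x \<in> S \<Longrightarrow> group.ord (Multiplicative_Group.mult_of R) x > 0"
  obtains w where "w \<in> carrier (Multiplicative_Group.mult_of R)" "group.ord (Multiplicative_Group.mult_of R) w > 0"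
    "group.ord (Multiplicative_Group.mult_of R) w \<le> (\<Prod>x\<in>S. group.ord (Multiplicative_Group.mult_of R) x)"
    "\<And>x. x \<in> S \<Longrightarrow> \<exists>i < group.ord (Multiplicative_Group.mult_of R) w. x = w [^] i"
proof -
  interpret mg: comm_group "Multiplicative_Group.mult_of R" by (rule mult_of_comm_group)
  have pow: "x [^]\<^bsub>Multiplicative_Group.mult_of R\<^esub> i = x [^] i" for x and i :: nat by (simp add: Multiplicative_Group.nat_pow_mult_of)
  define N where "N = (\<Prod>x\<in>S. mg.ord x)"
  have N: "N > 0" unfolding N_def using S by (simp add: prod_pos)
  define Os where "Os = mg.ord ` {y \<in> carrier (Multiplicative_Group.mult_of R). mg.ord y dvd N}"
  have finO: "finite Os" unfolding Os_def
    by (rule finite_subset[of _ "{..N}"]) (use N in \<open>auto dest: dvd_imp_le\<close>)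
  have "\<one> \<in> {y \<in> carrier (Multiplicative_Group.mult_of R). mg.ord y dvd N}"
    using mg.one_closed mg.ord_id by simp
  then have "Os \<noteq> {}" unfolding Os_def by blast
  then have "Max Os \<in> Os" using finO by simp
  then obtain w where w: "w \<in> carrier (Multiplicative_Group.mult_of R)" "mg.ord w dvd N" "mg.ord w = Max Os"
    unfolding Os_def by auto
  have wpos: "mg.ord w > 0" using w(2) N by (auto intro!: Nat.gr0I)
  have max: "mg.ord v \<le> mg.ord w" if "v \<in> carrier (Multiplicative_Group.mult_of R)" "mg.ord v dvd N" for v
    unfolding w(3) using finO that by (intro Max_ge) (auto simp: Os_def)
  have gen: "\<exists>i < mg.ord w. x = w [^] i" if x: "x \<in> S" for x
  proof -
    have xc: "x \<in> carrier (Multiplicative_Group.mult_of R)" "mg.ord x > 0" using x S by auto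
    have xN: "mg.ord x dvd N" unfolding N_def using S(1) x by (rule dvd_prodI)
    have "mg.ord x dvd mg.ord w"
    proof (rule ccontr)
      assume ndvd: "\<not> mg.ord x dvd mg.ord w"
      obtain p where p: "Factorial_Ring.prime p" "multiplicity p (mg.ord w) < multiplicity p (mg.ord x)"
        using multiplicity_le_imp_dvd[of "mg.ord x" "mg.ord w"] ndvd xc(2) by (metis not_le neq0_conv)
      define e where "e = multiplicity p (mg.ord w)"
      define f where "f = multiplicity p (mg.ord x)"
      obtain m0 where m0: "mg.ord w = p ^ e * m0" "\<not> p dvd m0"
        using multiplicity_decompose'[of "mg.ord w" p] wpos p(1) unfolding e_def
        by (metis mult.commute neq0_conv not_prime_unit)
      obtain y0 where y0: "mg.ord x = p ^ f * y0" "\<not> p dvd y0"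
        using multiplicity_decompose'[of "mg.ord x" p] xc(2) p(1) unfolding f_def
        by (metis mult.commute neq0_conv not_prime_unit)
      have pos: "m0 > 0" "y0 > 0" "p > 0"
        using m0 y0 wpos xc(2) prime_gt_0_nat[OF p(1)] by (auto intro!: Nat.gr0I)
      have ow: "mg.ord (w [^]\<^bsub>Multiplicative_Group.mult_of R\<^esub> (p ^ e)) = m0"
        using mg.ord_pow[OF w(1), of "p ^ e"] m0(1) pos by simp
      have oy: "mg.ord (x [^]\<^bsub>Multiplicative_Group.mult_of R\<^esub> y0) = p ^ f"
        using mg.ord_pow[OF xc(1), of y0] y0(1) pos by simp
      have cop: "coprime m0 (p ^ f)"
        using m0(2) p(1) by (metis coprime_commute coprime_power_left_iff prime_imp_coprime)
      \<comment> \<open>The p-free part of w times the p-part of x: the orders are coprime, so they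
        multiply to more than ord w.\<close>
      define v where "v = w [^]\<^bsub>Multiplicative_Group.mult_of R\<^esub> (p ^ e) \<otimes>\<^bsub>Multiplicative_Group.mult_of R\<^esub> x [^]\<^bsub>Multiplicative_Group.mult_of R\<^esub> y0"
      have v: "v \<in> carrier (Multiplicative_Group.mult_of R)"
        unfolding v_def using w(1) xc(1) by (intro mg.m_closed mg.nat_pow_closed)
      have o: "mg.ord v = m0 * p ^ f" unfolding v_def
        using mg.ord_mult_coprime[of "w [^]\<^bsub>Multiplicative_Group.mult_of R\<^esub> (p ^ e)" "x [^]\<^bsub>Multiplicative_Group.mult_of R\<^esub> y0"]
          mg.nat_pow_closed[OF w(1)] mg.nat_pow_closed[OF xc(1)] ow oy cop by metis
      have "m0 dvd N" using w(2) unfolding m0(1) by (metis dvd_mult_right)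
      moreover have "p ^ f dvd N" using xN unfolding y0(1) by (metis dvd_mult_left)
      ultimately have "mg.ord v dvd N" unfolding o using cop by (rule semiring_gcd_class.divides_mult)
      then have "m0 * p ^ f \<le> mg.ord w" using max[OF v] o by simp
      moreover have "p ^ e < p ^ f"
        using p(2) prime_gt_1_nat[OF p(1)] unfolding e_def f_def by (intro power_strict_increasing)
      ultimately show False using m0(1) pos(1) by (simp add: mult.commute)
    qed
    then have xw: "x [^] mg.ord w = \<one>" using mg.pow_eq_id[OF xc(1)] pow by simp
    define Q where "Q = (\<lambda>i. w [^]\<^bsub>Multiplicative_Group.mult_of R\<^esub> i) ` {0..mg.ord w - 1}"
    have cQ: "card Q = mg.ord w"
      unfolding Q_def using card_image[OF mg.ord_inj[OF w(1)]] wpos by simp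
    have Qroot: "t \<in> carrier R \<and> t [^] mg.ord w = \<one>" if tQ: "t \<in> Q" for t
    proof -
      obtain i :: nat where i: "t = w [^]\<^bsub>Multiplicative_Group.mult_of R\<^esub> i" using tQ unfolding Q_def by blast
      have t: "t \<in> carrier (Multiplicative_Group.mult_of R)" unfolding i by (rule mg.nat_pow_closed[OF w(1)])
      have "t [^]\<^bsub>Multiplicative_Group.mult_of R\<^esub> mg.ord w = \<one>\<^bsub>Multiplicative_Group.mult_of R\<^esub>"
        unfolding i using w(1) by (metis mg.nat_pow_one mg.nat_pow_pow mg.pow_ord_eq_1 mult.commute)
      then show ?thesis using t pow by simp
    qed
    have "x \<in> Q"
    proof (rule ccontr)
      assume "x \<notin> Q"
      then have "card (insert x Q) = Suc (mg.ord w)" using cQ unfolding Q_def by simp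
      moreover have "card (insert x Q) \<le> mg.ord w"
        by (rule card_roots_of_unity_le) (use wpos Qroot xw xc in \<open>auto simp: Q_def\<close>)
      ultimately show False by simp
    qed
    then obtain i where "i \<in> {0..mg.ord w - 1}" "x = w [^]\<^bsub>Multiplicative_Group.mult_of R\<^esub> i" unfolding Q_def by blast
    then show ?thesis using wpos pow by (intro exI[of _ i]) auto
  qed
  have "mg.ord w \<le> N" using w(2) N by (rule dvd_imp_le)
  then show ?thesis using that[OF w(1) wpos _ gen] unfolding N_def by blast
qed

section \<open>Evaluation of integer polynomials in an abstract field\<close>

definition ring_int :: "int \<Rightarrow> 'a" where "ring_int k = add_pow R k \<one>"

lemma ring_int_closed [simp]: "ring_int k \<in> carrier R"
  unfolding ring_int_def by simp

lemma ring_int_add: "ring_int (a + b) = ring_int a \<oplus> ring_int b"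
  unfolding ring_int_def by (rule add.int_pow_mult) simp

lemma ring_int_mult: "ring_int (a * b) = ring_int a \<otimes> ring_int b"
proof -
  have "ring_int a \<otimes> ring_int b = add_pow R a (\<one> \<otimes> ring_int b)"
    unfolding ring_int_def by (rule add_pow_ldistr_int) simp_all
  also have "\<dots> = add_pow R a (add_pow R b \<one>)" unfolding ring_int_def by simp
  also have "\<dots> = add_pow R (b * a) \<one>" by (rule add.int_pow_pow) simp
  finally show ?thesis unfolding ring_int_def by (simp add: mult.commute)
qed

lemma ring_int_0 [simp]: "ring_int 0 = \<zero>" and ring_int_1 [simp]: "ring_int 1 = \<one>"
  unfolding ring_int_def by (simp_all add: add_pow_def int_pow_def nat_pow_def)

lemma ring_int_eq_zero_dvd:
  assumes "Factorial_Ring.prime (p::nat)" "ring_int (int p) = \<zero>" "ring_int k = \<zero>"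
  shows "int p dvd k"
proof (rule ccontr)
  assume "\<not> int p dvd k"
  then have "coprime (int p) k" using assms(1) by (simp add: prime_imp_coprime)
  then obtain u v where "u * int p + v * k = 1" using bezout_int[of "int p" k] by auto
  then have "ring_int 1 = ring_int u \<otimes> ring_int (int p) \<oplus> ring_int v \<otimes> ring_int k" by (metis ring_int_add ring_int_mult)
  then show False using assms by simp
qed

text \<open>The counterpart of \<open>int_eval\<close>: one and the same integer polynomial can be
  evaluated at \<open>zeta n\<close> and at an element of the field.\<close>

definition ring_eval :: "'a \<Rightarrow> int poly \<Rightarrow> 'a"
  where "ring_eval z q = fold_coeffs (\<lambda>a r. ring_int a \<oplus> z \<otimes> r) q \<zero>"

lemma ring_eval_0 [simp]: "ring_eval z 0 = \<zero>"
  unfolding ring_eval_def by simp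

lemma ring_eval_pCons:
  assumes "z \<in> carrier R" shows "ring_eval z (pCons a q) = ring_int a \<oplus> z \<otimes> ring_eval z q"
proof (cases "a = 0 \<and> q = 0")
  case True
  then show ?thesis using assms by simp
next
  case False
  then show ?thesis unfolding ring_eval_def by (cases "q = 0") simp_all
qed

lemma ring_eval_closed [simp]: "z \<in> carrier R \<Longrightarrow> ring_eval z q \<in> carrier R"
  by (induction q) (simp_all add: ring_eval_pCons)

lemma ring_eval_add: "z \<in> carrier R \<Longrightarrow> ring_eval z (p + q) = ring_eval z p \<oplus> ring_eval z q"
proof (induction p q rule: poly_induct2)
  case (pCons a p b q)
  then show ?case by (simp add: ring_eval_pCons ring_int_add r_distr a_ac)
qed simp

lemma ring_eval_smult: "z \<in> carrier R \<Longrightarrow> ring_eval z (Polynomial.smult a q) = ring_int a \<otimes> ring_eval z q"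
  by (induction q) (simp_all add: ring_eval_pCons ring_int_mult r_distr m_lcomm)

lemma ring_eval_mult: "z \<in> carrier R \<Longrightarrow> ring_eval z (p * q) = ring_eval z p \<otimes> ring_eval z q"
  by (induction p) (simp_all add: ring_eval_pCons ring_eval_add ring_eval_smult l_distr m_assoc)

lemma ring_eval_1 [simp]: "z \<in> carrier R \<Longrightarrow> ring_eval z 1 = \<one>"
  using ring_eval_pCons[of z 1 0] by (simp add: pCons_one)

lemma ring_eval_monom: "z \<in> carrier R \<Longrightarrow> ring_eval z (Polynomial.monom 1 k) = z [^] k"
proof (induction k)
  case (Suc k)
  then show ?case by (simp add: monom_Suc ring_eval_pCons m_comm)
qed (simp add: monom_0 ring_eval_pCons)

lemma ring_eval_const: "z \<in> carrier R \<Longrightarrow> ring_eval z [:a:] = ring_int a"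
  by (simp add: ring_eval_pCons)

lemma ring_eval_prod:
  assumes "z \<in> carrier R" "finite I" "ring_eval z (\<Prod>i\<in>I. f i) = \<zero>"
  shows "\<exists>i\<in>I. ring_eval z (f i) = \<zero>"
  using assms(2,3)
proof (induction I rule: finite_induct)
  case (insert i I)
  then have "ring_eval z (f i) \<otimes> ring_eval z (prod f I) = \<zero>" using ring_eval_mult[OF assms(1)] by simp
  then have "ring_eval z (f i) = \<zero> \<or> ring_eval z (prod f I) = \<zero>" using integral assms(1) by simp
  then show ?case using insert.IH by blast
qed (use assms(1) in simp)

end

text \<open>
  The entry at \<open>(u, v)\<close> of the Gram matrix is \<open>\<Sum>i. conj (P i) ^ u * P i ^ v\<close> for the points
  \<open>P i = zeta n ^ es i\<close>: since the exponents matter modulo \<open>n\<close> only, the factor \<open>n - 1\<close> expresses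
  complex conjugation by an integer polynomial.
\<close>

definition dot :: "nat \<times> nat \<Rightarrow> nat \<times> nat \<Rightarrow> nat"
  where "dot u e = fst u * fst e + snd u * snd e"

definition gram :: "nat \<Rightarrow> (nat \<Rightarrow> nat \<times> nat) \<Rightarrow> nat \<Rightarrow> nat \<Rightarrow> (nat \<Rightarrow> nat \<times> nat) \<Rightarrow> int poly mat"
  where "gram M us n N es = mat M M (\<lambda>(k, j). \<Sum>i<N.
     Polynomial.monom 1 ((n - 1) * dot (us k) (es i)) * Polynomial.monom 1 (dot (us j) (es i)))"

section \<open>Gram determinants in the field and over the complex numbers\<close>

lemma gram_carrier [simp]: "gram M us n N es \<in> carrier_mat M M"
  unfolding gram_def by simp

text \<open>The functional L pairs a row with c. It kills every evaluation row, hence every row of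
  the Gram matrix, which is a combination of them. Multiplying by the adjugate leaves det G * c l =
  0. With L the matrix stays over the integer polynomials and only the pairing takes values in the
  field.\<close>

lemma (in field) gram_det_zero:
  assumes z: "z \<in> carrier R" and c: "\<And>j. j < M \<Longrightarrow> c j \<in> carrier R"
    and nz: "l < M" "c l \<noteq> \<zero>"
    and zero: "\<And>i. i < N \<Longrightarrow> (\<Oplus>j\<in>{..<M}. z [^] dot (us j) (es i) \<otimes> c j) = \<zero>"
  shows "ring_eval z (det (gram M us n N es)) = \<zero>"
proof -
  define L where "L = (\<lambda>v. \<Oplus>j\<in>{..<M}. ring_eval z (v j) \<otimes> c j)"
  have L_add: "L (\<lambda>j. v j + w j) = L v \<oplus> L w" for v w
  proof -
    have "L (\<lambda>j. v j + w j) = (\<Oplus>j\<in>{..<M}. ring_eval z (v j) \<otimes> c j \<oplus> ring_eval z (w j) \<otimes> c j)"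
      unfolding L_def using z c by (intro finsum_cong') (auto simp: ring_eval_add l_distr)
    also have "\<dots> = L v \<oplus> L w" unfolding L_def using z c by (intro finsum_addf) auto
    finally show ?thesis .
  qed
  have L_closed: "L v \<in> carrier R" for v unfolding L_def using z c by (intro finsum_closed) auto
  have L_mult: "L (\<lambda>j. q * v j) = ring_eval z q \<otimes> L v" for v q
    unfolding L_def using z c
    by (subst finsum_rdistr) (auto simp: ring_eval_mult m_assoc Pi_def intro!: finsum_cong')
  have L_sum: "L (\<lambda>j. \<Sum>i\<in>I. v i j) = \<zero>" if "finite I" "\<And>i. i \<in> I \<Longrightarrow> L (v i) = \<zero>" for I :: "nat set" and v
    using that
  proof (induction I rule: finite_induct)
    case empty
    have "L (\<lambda>j. 0) = ring_eval z 0 \<otimes> L (\<lambda>j. 0)" using L_mult[of 0 "\<lambda>j. 0"] by simp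
    then show ?case using L_closed by simp
  next
    case (insert i I)
    then show ?case using L_add[of "v i" "\<lambda>j. \<Sum>i\<in>I. v i j"] by simp
  qed
  define G where "G = gram M us n N es"
  have G: "G \<in> carrier_mat M M" unfolding G_def by simp
  have row: "L (\<lambda>j. Polynomial.monom 1 (dot (us j) (es i))) = \<zero>" if "i < N" for i
    unfolding L_def using zero[OF that] z c by (simp add: ring_eval_monom)
  have Lcong: "L v = L w" if "\<And>j. j < M \<Longrightarrow> v j = w j" for v w
    unfolding L_def using that z c by (intro finsum_cong') auto
  have LG: "L (\<lambda>j. G $$ (k, j)) = \<zero>" if k: "k < M" for k
  proof -
    have "L (\<lambda>j. G $$ (k, j)) = L (\<lambda>j. \<Sum>i<N.
       Polynomial.monom 1 ((n - 1) * dot (us k) (es i)) * Polynomial.monom 1 (dot (us j) (es i)))"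
      using k by (intro Lcong) (simp add: G_def gram_def)
    also have "\<dots> = \<zero>" using row z by (intro L_sum) (simp_all add: L_mult)
    finally show ?thesis .
  qed
  define A where "A = adj_mat G"
  have A: "A \<in> carrier_mat M M" "A * G = det G \<cdot>\<^sub>m 1\<^sub>m M"
    unfolding A_def using adj_mat(1,3)[OF G] by auto
  have "(\<Sum>k<M. A $$ (l, k) * G $$ (k, j)) = (if l = j then det G else 0)" if j: "j < M" for j
  proof -
    have "(A * G) $$ (l, j) = (\<Sum>k<M. A $$ (l, k) * G $$ (k, j))"
      using A(1) G nz(1) j by (simp add: scalar_prod_def atLeast0LessThan)
    then show ?thesis unfolding A(2) using nz(1) j by auto
  qed
  then have "L (\<lambda>j. if l = j then det G else 0) = L (\<lambda>j. \<Sum>k<M. A $$ (l, k) * G $$ (k, j))"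
    by (intro Lcong) simp
  also have "\<dots> = \<zero>" using LG z by (intro L_sum) (simp_all add: L_mult)
  finally have "(\<Oplus>j\<in>{..<M}. ring_eval z (if l = j then det G else 0) \<otimes> c j) = \<zero>" unfolding L_def .
  also have "(\<Oplus>j\<in>{..<M}. ring_eval z (if l = j then det G else 0) \<otimes> c j) =
      (\<Oplus>j\<in>{..<M}. if l = j then ring_eval z (det G) \<otimes> c j else \<zero>)"
    using z c by (intro finsum_cong') auto
  also have "\<dots> = ring_eval z (det G) \<otimes> c l"
    using nz(1) z c by (intro add.finprod_singleton) auto
  finally show ?thesis using integral[of "ring_eval z (det G)" "c l"] nz z c unfolding G_def by auto
qed

lemma comm_ring_hom_int_eval: "comm_ring_hom (\<lambda>q. int_eval q w)"
  by unfold_locales simp_all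

text \<open>Leibniz formula with entries that are sums of N numbers of modulus 1. The bound does not
  involve n or the exponents, so the norm grows at most like a fixed constant to the power
  n.\<close>

lemma gram_det_bound:
  assumes "norm w = 1"
  shows "norm (int_eval (det (gram M us n N es)) w) \<le> fact M * real N ^ M"
proof -
  define G where "G = map_mat (\<lambda>q. int_eval q w) (gram M us n N es)"
  have G: "G \<in> carrier_mat M M" unfolding G_def by simp
  have "int_eval (det (gram M us n N es)) w = det G"
    unfolding G_def using comm_ring_hom.hom_det[OF comm_ring_hom_int_eval, of w] by simp
  have ent: "norm (G $$ (k, j)) \<le> real N" if "k < M" "j < M" for k j
  proof -
    have "G $$ (k, j) = (\<Sum>i<N. w ^ ((n - 1) * dot (us k) (es i)) * w ^ dot (us j) (es i))"
      unfolding G_def gram_def using that by (simp add: int_eval_sum)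
    also have "norm \<dots> \<le> (\<Sum>i<N. 1)"
      by (rule sum_norm_le) (simp add: norm_mult norm_power assms)
    finally show ?thesis by simp
  qed
  have "norm (det G) \<le> (\<Sum>p\<in>{p. p permutes {0..<M}}. norm (signof p * (\<Prod>i = 0..<M. G $$ (i, p i))))"
    unfolding det_def'[OF G] by (rule norm_sum)
  also have "\<dots> \<le> (\<Sum>p\<in>{p. p permutes {0..<M}}. real N ^ M)"
  proof (rule sum_mono)
    fix p assume "p \<in> {p. p permutes {0..<M}}"
    then have p: "p permutes {0..<M}" by simp
    have "norm (signof p * (\<Prod>i = 0..<M. G $$ (i, p i))) = (\<Prod>i = 0..<M. norm (G $$ (i, p i)))"
      by (simp add: norm_mult prod_norm sign_def)
    also have "\<dots> \<le> (\<Prod>i = 0..<M. real N)"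
      using permutes_in_image[OF p] by (intro prod_mono) (auto intro!: ent)
    finally show "norm (signof p * (\<Prod>i = 0..<M. G $$ (i, p i))) \<le> real N ^ M" by simp
  qed
  also have "\<dots> = fact M * real N ^ M"
    by (simp add: card_permutations)
  finally show ?thesis unfolding \<open>int_eval (det (gram M us n N es)) w = det G\<close> .
qed

lemma zeta_power_conj:
  assumes "n > 0" shows "zeta n ^ ((n - 1) * k) = cnj (zeta n ^ k)"
proof -
  have "zeta n ^ (n - 1) * zeta n = 1" using zeta_pow_self[OF assms] assms by (metis power_minus_mult)
  moreover have "cnj (zeta n) * zeta n = 1"
    using complex_norm_square[of "zeta n"] by (simp add: mult.commute)
  ultimately have "zeta n ^ (n - 1) = cnj (zeta n)" by (metis mult_right_cancel zeta_nonzero)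
  then show ?thesis by (simp add: power_mult)
qed

text \<open>At \<open>zeta n\<close> the Gram matrix is A* A for the evaluation matrix A. A kernel
  vector c gives c* A* A c = 0, a sum of squared absolute values, so A c = 0.\<close>

lemma gram_kernel:
  assumes n: "n > 0" and 0: "int_eval (det (gram M us n N es)) (zeta n) = 0"
  obtains c :: "nat \<Rightarrow> complex" where "\<exists>j<M. c j \<noteq> 0"
    "\<And>i. i < N \<Longrightarrow> (\<Sum>j<M. c j * zeta n ^ dot (us j) (es i)) = 0"
proof -
  define G where "G = map_mat (\<lambda>q. int_eval q (zeta n)) (gram M us n N es)"
  have G: "G \<in> carrier_mat M M" unfolding G_def by simp
  have "det G = 0"
    unfolding G_def using comm_ring_hom.hom_det[OF comm_ring_hom_int_eval, of "zeta n"] 0 by simp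
  then obtain v where v: "v \<in> carrier_vec M" "v \<noteq> 0\<^sub>v M" "G *\<^sub>v v = 0\<^sub>v M"
    using det_0_iff_vec_prod_zero_field[OF G] by blast
  define c where "c = (\<lambda>j. v $ j)"
  define e where "e = (\<lambda>i. \<Sum>j<M. c j * zeta n ^ dot (us j) (es i))"
  have ent: "G $$ (k, j) = (\<Sum>i<N. cnj (zeta n ^ dot (us k) (es i)) * zeta n ^ dot (us j) (es i))"
    if "k < M" "j < M" for k j
    unfolding G_def gram_def using that by (simp add: int_eval_sum zeta_power_conj[OF n, unfolded One_nat_def] del: complex_cnj_power)
  have Gv: "(\<Sum>j<M. G $$ (k, j) * c j) = 0" if "k < M" for k
  proof -
    have "(G *\<^sub>v v) $ k = (\<Sum>j<M. G $$ (k, j) * c j)"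
      using that G v(1) unfolding c_def by (simp add: scalar_prod_def atLeast0LessThan)
    then show ?thesis unfolding v(3) using that by simp
  qed
  have "(\<Sum>i<N. cnj (e i) * e i) = (\<Sum>i<N. \<Sum>k<M. \<Sum>j<M.
      cnj (c k) * (cnj (zeta n ^ dot (us k) (es i)) * zeta n ^ dot (us j) (es i) * c j))"
  proof (rule sum.cong[OF refl])
    fix i
    have "cnj (e i) = (\<Sum>k<M. cnj (c k) * cnj (zeta n ^ dot (us k) (es i)))"
      unfolding e_def by (simp del: complex_cnj_power)
    then have "cnj (e i) * e i = (\<Sum>k<M. \<Sum>j<M.
        (cnj (c k) * cnj (zeta n ^ dot (us k) (es i))) * (c j * zeta n ^ dot (us j) (es i)))"
      unfolding e_def by (simp only: sum_product)
    also have "\<dots> = (\<Sum>k<M. \<Sum>j<M.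
      cnj (c k) * (cnj (zeta n ^ dot (us k) (es i)) * zeta n ^ dot (us j) (es i) * c j))"
      by (intro sum.cong refl) (simp only: mult_ac)
    finally show "cnj (e i) * e i = \<dots>" .
  qed
  also have "\<dots> = (\<Sum>k<M. \<Sum>j<M. \<Sum>i<N.
      cnj (c k) * (cnj (zeta n ^ dot (us k) (es i)) * zeta n ^ dot (us j) (es i) * c j))"
    by (subst sum.swap) (intro sum.cong refl sum.swap)
  also have "\<dots> = (\<Sum>k<M. \<Sum>j<M. cnj (c k) * (G $$ (k, j) * c j))"
    by (intro sum.cong refl) (simp add: ent sum_distrib_left sum_distrib_right)
  also have "\<dots> = (\<Sum>k<M. cnj (c k) * (\<Sum>j<M. G $$ (k, j) * c j))"
    by (simp add: sum_distrib_left)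
  also have "\<dots> = 0" using Gv by simp
  finally have "(\<Sum>i<N. cnj (e i) * e i) = 0" .
  moreover have "cnj x * x = of_real ((cmod x)\<^sup>2)" for x
    using complex_norm_square[of x] by (simp add: mult.commute)
  ultimately have "(\<Sum>i<N. complex_of_real ((cmod (e i))\<^sup>2)) = 0" by simp
  then have "complex_of_real (\<Sum>i<N. (cmod (e i))\<^sup>2) = 0" by (simp only: of_real_sum)
  then have "(\<Sum>i<N. (cmod (e i))\<^sup>2) = 0" by (simp only: of_real_eq_0_iff)
  then have "e i = 0" if "i < N" for i
    using that by (simp add: sum_nonneg_eq_0_iff)
  moreover have "\<exists>j<M. c j \<noteq> 0"
  proof (rule ccontr)
    assume "\<not> (\<exists>j<M. c j \<noteq> 0)"
    then have "v = 0\<^sub>v M" using v(1) unfolding c_def by (intro eq_vecI) auto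
    then show False using v(2) by simp
  qed
  ultimately show ?thesis using that[of c] unfolding e_def by blast
qed

text \<open>Since z has exact order n, X^m - 1 vanishes at z only if n divides m; hence
  \<open>xprod n\<close> and its divisor h do not vanish at z, so \<Phi> does. Evaluating D * E =
  \<Phi> * Q + r at z leaves r = 0 in characteristic p.\<close>

lemma (in field) char_dvd_norm:
  assumes p: "Factorial_Ring.prime (p::nat)" "ring_int (int p) = \<zero>"
    and z: "z \<in> carrier (Multiplicative_Group.mult_of R)" "group.ord (Multiplicative_Group.mult_of R) z = n" "n > 0"
    and D: "ring_eval z D = \<zero>"
    and N: "xpoly n = \<Phi> * h" "h dvd xprod n" "D * E = \<Phi> * Q + [:r:]"
  shows "int p dvd r"
proof -
  interpret mg: comm_group "Multiplicative_Group.mult_of R" by (rule mult_of_comm_group)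
  have zR: "z \<in> carrier R" using z(1) by simp
  have kx: "ring_eval z (xpoly m) = \<zero> \<longleftrightarrow> n dvd m" for m
  proof -
    have "ring_eval z (xpoly m) \<oplus> \<one> = ring_eval z (xpoly m + 1)" using ring_eval_add[OF zR] zR by simp
    also have "\<dots> = z [^] m" unfolding xpoly_def using zR by (simp add: ring_eval_monom)
    finally have e: "ring_eval z (xpoly m) \<oplus> \<one> = z [^] m" .
    have "ring_eval z (xpoly m) = \<zero> \<longleftrightarrow> z [^] m = \<one>"
    proof
      assume "ring_eval z (xpoly m) = \<zero>"
      then show "z [^] m = \<one>" using e zR by simp
    next
      assume "z [^] m = \<one>"
      then have "ring_eval z (xpoly m) \<oplus> \<one> = \<zero> \<oplus> \<one>" using e by simp
      then show "ring_eval z (xpoly m) = \<zero>" using zR by (subst (asm) add.right_cancel) auto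
    qed
    then show ?thesis using mg.pow_eq_id[OF z(1), of m] z(2) by (simp add: Multiplicative_Group.nat_pow_mult_of)
  qed
  have "ring_eval z \<Phi> \<otimes> ring_eval z h = \<zero>" using kx[of n] ring_eval_mult[OF zR] N(1) by simp
  then have "ring_eval z \<Phi> = \<zero> \<or> ring_eval z h = \<zero>" using integral zR by simp
  moreover have "ring_eval z h \<noteq> \<zero>"
  proof
    assume h0: "ring_eval z h = \<zero>"
    obtain q where "xprod n = h * q" using N(2) by (elim dvdE)
    then have "ring_eval z (xprod n) = \<zero>" using ring_eval_mult[OF zR] h0 zR by simp
    then obtain m where "m dvd n" "m < n" "ring_eval z (xpoly m) = \<zero>"
      unfolding xprod_def using ring_eval_prod[OF zR, of "{m. m dvd n \<and> m < n}" xpoly] by auto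
    then have "n dvd m" "m dvd n" "m < n" using kx by auto
    then show False using z(3) by (metis dvd_antisym less_irrefl)
  qed
  ultimately have "ring_eval z \<Phi> = \<zero>" by simp
  then have "ring_eval z (\<Phi> * Q + [:r:]) = ring_int r" using zR by (simp add: ring_eval_add ring_eval_mult ring_eval_const)
  moreover have "ring_eval z (D * E) = \<zero>" using D zR by (simp add: ring_eval_mult)
  ultimately have "ring_int r = \<zero>" using N(3) by simp
  then show ?thesis using ring_int_eq_zero_dvd[OF p] by blast
qed

section \<open>Transfer of binomial relations from roots of unity to the field\<close>

text \<open>Matrices need numbered monomials. Fixing one enumeration for each d makes
  \<open>gram_poly\<close> a function of d, N, n and the exponents alone.\<close>

definition tri_enum :: "nat \<Rightarrow> nat \<Rightarrow> nat \<times> nat"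
  where "tri_enum d = (SOME f. bij_betw f {0..<card (tri d)} (tri d))"

lemma tri_enum: "bij_betw (tri_enum d) {..<card (tri d)} (tri d)"
  unfolding tri_enum_def atLeast0LessThan[symmetric]
  by (rule someI_ex[OF ex_bij_betw_nat_finite[OF finite_tri]])

definition gram_poly :: "nat \<Rightarrow> nat \<Rightarrow> nat \<Rightarrow> (nat \<Rightarrow> nat \<times> nat) \<Rightarrow> int poly"
  where "gram_poly d N n es = det (gram (card (tri d)) (tri_enum d) n N es)"

lemma zeta_power_eq_cong:
  assumes "n > 0" "zeta n ^ s = zeta n ^ t" shows "[s = t] (mod n)"
proof -
  have "[s = t] (mod n)" if st: "s \<le> t" "zeta n ^ s = zeta n ^ t" for s t
  proof -
    obtain q where "t - s = n * q"
      using primroot_power_eq[OF zeta_primroot[OF assms(1)] assms(1) st] by (elim dvdE)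
    then have "t = s + n * q" using st(1) by simp
    then show ?thesis using cong_add_mult_self cong_sym by metis
  qed
  then show ?thesis using assms(2) by (metis cong_sym nat_le_linear)
qed

lemma mv_zeta: "mv (zeta n ^ fst e, zeta n ^ snd e) u = zeta n ^ dot u e"
  unfolding mv_def dot_def by (simp add: power_add mult.commute flip: power_mult)

context field
begin

text \<open>\<open>on_binomial\<close> over the field, with indices in place of points: the index is
  what a point and its complex counterpart have in common.\<close>

definition on_binomial_idx :: "nat \<Rightarrow> nat \<Rightarrow> (nat \<Rightarrow> 'a) \<Rightarrow> (nat \<Rightarrow> 'a) \<Rightarrow> bool" where
  "on_binomial_idx d N x y \<longleftrightarrow> (\<exists>a b. coprime a b \<and>
     ((\<exists>I\<subseteq>{..<N}. card I > d * (a + b) \<and>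
         (\<forall>i\<in>I. \<forall>j\<in>I. x i [^] a \<otimes> y i [^] b = x j [^] a \<otimes> y j [^] b)) \<or>
      (\<exists>I\<subseteq>{..<N}. card I > d * max a b \<and>
         (\<forall>i\<in>I. \<forall>j\<in>I. x i [^] a \<otimes> y j [^] b = x j [^] a \<otimes> y i [^] b))))"

text \<open>The kernel vector of the Gram matrix is read as a complex curve through the points P i,
  which are distinct because exponents below n are determined by the powers of
  \<open>zeta n\<close>. The relation supplied by the complex theory is an equality of powers of
  \<open>zeta n\<close>.\<close>

lemma low_order_points_on_binomial:
  assumes z: "z \<in> carrier (Multiplicative_Group.mult_of R)"
      "group.ord (Multiplicative_Group.mult_of R) z = n" "n > 0"
    and xy: "\<And>i. i < N \<Longrightarrow> x i = z [^] fst (es i)" "\<And>i. i < N \<Longrightarrow> y i = z [^] snd (es i)"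
    and es: "\<And>i. i < N \<Longrightarrow> fst (es i) < n \<and> snd (es i) < n"
    and inj: "inj_on (\<lambda>i. (x i, y i)) {..<N}" and N: "N > 11 * d\<^sup>2"
    and gram: "int_eval (gram_poly d N n es) (zeta n) = 0"
  shows "on_binomial_idx d N x y"
proof -
  interpret mg: comm_group "Multiplicative_Group.mult_of R" by (rule mult_of_comm_group)
  have zR: "z \<in> carrier R" using z(1) by simp
  define M where "M = card (tri d)"
  define us where "us = tri_enum d"
  have us: "bij_betw us {..<M} (tri d)" unfolding us_def M_def by (rule tri_enum)
  obtain c :: "nat \<Rightarrow> complex" where c: "\<exists>j<M. c j \<noteq> 0"
    "\<And>i. i < N \<Longrightarrow> (\<Sum>j<M. c j * zeta n ^ dot (us j) (es i)) = 0"
    using gram_kernel[OF z(3) gram[unfolded gram_poly_def]] unfolding M_def us_def by metis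
  define f where "f = tp (tri d) (\<lambda>u. c (the_inv_into {..<M} us u))"
  have inv: "the_inv_into {..<M} us (us j) = j" if "j < M" for j
    using us that by (auto simp: bij_betw_def the_inv_into_f_f)
  define P where "P = (\<lambda>i. (zeta n ^ fst (es i), zeta n ^ snd (es i)))"
  have pvf: "pv f (P i) = 0" if "i < N" for i
  proof -
    have "pv f (P i) = (\<Sum>u\<in>tri d. c (the_inv_into {..<M} us u) * zeta n ^ dot u (es i))"
      unfolding f_def pv_tp P_def mv_zeta ..
    also have "\<dots> = (\<Sum>j<M. c j * zeta n ^ dot (us j) (es i))"
      using inv by (subst sum.reindex_bij_betw[OF us, symmetric]) (auto intro!: sum.cong)
    finally show ?thesis using c(2)[OF that] by simp
  qed
  have f0: "f \<noteq> 0"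
  proof -
    obtain j where j: "j < M" "c j \<noteq> 0" using c(1) by blast
    have "us j \<in> tri d" using us j(1) by (auto simp: bij_betw_def)
    then have "cfp f (us j) = c j" unfolding f_def using inv[OF j(1)] by (simp add: cfp_tp)
    then show ?thesis using j(2) by auto
  qed
  have injP: "inj_on P {..<N}"
  proof (rule inj_onI)
    fix i j assume ij: "i \<in> {..<N}" "j \<in> {..<N}" "P i = P j"
    then have "fst (es i) = fst (es j)" "snd (es i) = snd (es j)"
      using zeta_power_inj[OF z(3)] es unfolding P_def by auto
    then have "(x i, y i) = (x j, y j)" using xy ij by simp
    then show "i = j" using inj ij unfolding inj_on_def by blast
  qed
  define T where "T = P ` {..<N}"
  have cT: "card T = N" unfolding T_def using card_image[OF injP] by simp
  have Pn: "P i ^ n = 1" for i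
    unfolding P_def using zeta_pow_self[OF z(3)]
    by (simp add: prod_eq_iff) (metis mult.commute power_mult power_one)
  have "on_binomial d T"
  proof (rule torsion_points_on_binomial[OF f0 _ _ z(3)])
    show "tdle f d" unfolding f_def by (rule tdle_tp) simp
    show "finite T" unfolding T_def by simp
    show "11 * d\<^sup>2 < card T" using cT N by simp
    fix Q assume "Q \<in> T"
    then show "Q ^ n = 1 \<and> pv f Q = 0" using Pn pvf unfolding T_def by blast
  qed
  then obtain a b where ab: "coprime a b" and
    alt: "(\<exists>T'\<subseteq>T. card T' > d * (a + b) \<and>
         (\<forall>P\<in>T'. \<forall>Q\<in>T'. fst P ^ a * snd P ^ b = fst Q ^ a * snd Q ^ b)) \<or>
      (\<exists>T'\<subseteq>T. card T' > d * max a b \<and>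
         (\<forall>P\<in>T'. \<forall>Q\<in>T'. fst P ^ a * snd Q ^ b = fst Q ^ a * snd P ^ b))"
    unfolding on_binomial_def by blast
  \<comment> \<open>Equal powers of \<open>zeta n\<close> have exponents congruent modulo n, and z
    satisfies z^n = 1.\<close>
  have transfer: "z [^] s = z [^] t" if "zeta n ^ s = zeta n ^ t" for s t :: nat
  proof -
    have "z [^] k = z [^] (k mod n)" for k :: nat
    proof -
      have zn: "z [^] n = \<one>" using mg.pow_ord_eq_1[OF z(1)] z(2) by (simp add: Multiplicative_Group.nat_pow_mult_of)
      have "z [^] k = z [^] (n * (k div n) + k mod n)" by simp
      also have "\<dots> = z [^] (n * (k div n)) \<otimes> z [^] (k mod n)" using zR by (simp only: nat_pow_mult)
      also have "z [^] (n * (k div n)) = \<one>" using zR zn by (simp flip: nat_pow_pow)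
      finally show ?thesis using zR by simp
    qed
    then show ?thesis using zeta_power_eq_cong[OF z(3) that] unfolding cong_def by metis
  qed
  have xyp: "x i [^] a \<otimes> y j [^] b = z [^] (fst (es i) * a + snd (es j) * b)" if "i < N" "j < N" for i j
    using xy that zR by (simp add: nat_pow_pow nat_pow_mult)
  have Pp: "fst (P i) ^ a * snd (P j) ^ b = zeta n ^ (fst (es i) * a + snd (es j) * b)" for i j
    unfolding P_def by (simp add: power_add power_mult)
  have idx: "card {i \<in> {..<N}. P i \<in> T'} = card T'" if T': "T' \<subseteq> T" for T'
  proof -
    have "P ` {i \<in> {..<N}. P i \<in> T'} = T'" using T' unfolding T_def by auto
    moreover have "inj_on P {i \<in> {..<N}. P i \<in> T'}" using injP by (rule inj_on_subset) auto
    ultimately show ?thesis using card_image by metis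
  qed
  from alt show ?thesis
  proof
    assume "\<exists>T'\<subseteq>T. card T' > d * (a + b) \<and>
         (\<forall>P\<in>T'. \<forall>Q\<in>T'. fst P ^ a * snd P ^ b = fst Q ^ a * snd Q ^ b)"
    then obtain T' where T': "T' \<subseteq> T" "card T' > d * (a + b)"
      "\<And>P Q. P \<in> T' \<Longrightarrow> Q \<in> T' \<Longrightarrow> fst P ^ a * snd P ^ b = fst Q ^ a * snd Q ^ b" by blast
    define I where "I = {i \<in> {..<N}. P i \<in> T'}"
    have "x i [^] a \<otimes> y i [^] b = x j [^] a \<otimes> y j [^] b" if "i \<in> I" "j \<in> I" for i j
    proof -
      have ij: "i < N" "j < N" "P i \<in> T'" "P j \<in> T'" using that unfolding I_def by auto
      have "zeta n ^ (fst (es i) * a + snd (es i) * b) = zeta n ^ (fst (es j) * a + snd (es j) * b)"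
        using T'(3)[OF ij(3,4)] unfolding Pp .
      from transfer[OF this] show ?thesis using xyp ij(1,2) by simp
    qed
    moreover have "card I > d * (a + b)" using T'(2) idx[OF T'(1)] unfolding I_def by simp
    moreover have "I \<subseteq> {..<N}" unfolding I_def by blast
    ultimately show ?thesis unfolding on_binomial_idx_def using ab by blast
  next
    assume "\<exists>T'\<subseteq>T. card T' > d * max a b \<and>
         (\<forall>P\<in>T'. \<forall>Q\<in>T'. fst P ^ a * snd Q ^ b = fst Q ^ a * snd P ^ b)"
    then obtain T' where T': "T' \<subseteq> T" "card T' > d * max a b"
      "\<And>P Q. P \<in> T' \<Longrightarrow> Q \<in> T' \<Longrightarrow> fst P ^ a * snd Q ^ b = fst Q ^ a * snd P ^ b" by blast
    define I where "I = {i \<in> {..<N}. P i \<in> T'}"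
    have "x i [^] a \<otimes> y j [^] b = x j [^] a \<otimes> y i [^] b" if "i \<in> I" "j \<in> I" for i j
    proof -
      have ij: "i < N" "j < N" "P i \<in> T'" "P j \<in> T'" using that unfolding I_def by auto
      have "zeta n ^ (fst (es i) * a + snd (es j) * b) = zeta n ^ (fst (es j) * a + snd (es i) * b)"
        using T'(3)[OF ij(3,4)] unfolding Pp .
      from transfer[OF this] show ?thesis using xyp ij(1,2) by simp
    qed
    moreover have "card I > d * max a b" using T'(2) idx[OF T'(1)] unfolding I_def by simp
    moreover have "I \<subseteq> {..<N}" unfolding I_def by blast
    ultimately show ?thesis unfolding on_binomial_idx_def using ab by blast
  qed
qed

lemma gram_poly_zero:
  assumes z: "z \<in> carrier R"
    and xy: "\<And>i. i < N \<Longrightarrow> x i = z [^] fst (es i)" "\<And>i. i < N \<Longrightarrow> y i = z [^] snd (es i)"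
    and c: "\<And>u. u \<in> tri d \<Longrightarrow> c u \<in> carrier R" "\<exists>u\<in>tri d. c u \<noteq> \<zero>"
    and zero: "\<And>i. i < N \<Longrightarrow> (\<Oplus>u\<in>tri d. c u \<otimes> (x i [^] fst u \<otimes> y i [^] snd u)) = \<zero>"
  shows "ring_eval z (gram_poly d N n es) = \<zero>"
proof -
  define M where "M = card (tri d)"
  define us where "us = tri_enum d"
  have us: "bij_betw us {..<M} (tri d)" unfolding us_def M_def by (rule tri_enum)
  have usj: "us j \<in> tri d" if "j < M" for j using us that by (auto simp: bij_betw_def)
  obtain l where l: "l < M" "c (us l) \<noteq> \<zero>"
    using c(2) us unfolding bij_betw_def by (metis imageE lessThan_iff)
  show ?thesis unfolding gram_poly_def M_def[symmetric] us_def[symmetric]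
  proof (rule gram_det_zero[OF z, where c = "\<lambda>j. c (us j)"])
    show "l < M" "c (us l) \<noteq> \<zero>" by fact+
    show "c (us j) \<in> carrier R" if "j < M" for j using c(1) usj that by blast
    fix i assume i: "i < N"
    have "(\<Oplus>j\<in>{..<M}. z [^] dot (us j) (es i) \<otimes> c (us j)) =
        (\<Oplus>u\<in>us ` {..<M}. c u \<otimes> (x i [^] fst u \<otimes> y i [^] snd u))"
    proof (subst finsum_reindex)
      show "inj_on us {..<M}" using us by (simp add: bij_betw_def)
      show "(\<lambda>u. c u \<otimes> (x i [^] fst u \<otimes> y i [^] snd u)) \<in> us ` {..<M} \<rightarrow> carrier R"
      proof
        fix v assume "v \<in> us ` {..<M}"
        then have "v \<in> tri d" using usj by blast
        then show "c v \<otimes> (x i [^] fst v \<otimes> y i [^] snd v) \<in> carrier R"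
          using c(1) xy i z by simp
      qed
      show "(\<Oplus>j\<in>{..<M}. z [^] dot (us j) (es i) \<otimes> c (us j)) =
          (\<Oplus>j\<in>{..<M}. c (us j) \<otimes> (x i [^] fst (us j) \<otimes> y i [^] snd (us j)))"
      proof (rule finsum_cong')
        fix j assume "j \<in> {..<M}"
        then have "c (us j) \<in> carrier R" using c(1) usj by auto
        then show "z [^] dot (us j) (es i) \<otimes> c (us j) = c (us j) \<otimes> (x i [^] fst (us j) \<otimes> y i [^] snd (us j))"
          using xy i z by (simp add: dot_def nat_pow_pow nat_pow_mult m_comm mult.commute)
      next
        show "(\<lambda>j. c (us j) \<otimes> (x i [^] fst (us j) \<otimes> y i [^] snd (us j))) \<in> {..<M} \<rightarrow> carrier R"
        proof
          fix j assume "j \<in> {..<M}"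
          then have "c (us j) \<in> carrier R" using c(1) usj by auto
          then show "c (us j) \<otimes> (x i [^] fst (us j) \<otimes> y i [^] snd (us j)) \<in> carrier R"
            using xy i z by simp
        qed
      qed simp
    qed
    also have "us ` {..<M} = tri d" using us by (simp add: bij_betw_def)
    finally show "(\<Oplus>j\<in>{..<M}. z [^] dot (us j) (es i) \<otimes> c (us j)) = \<zero>" using zero[OF i] by simp
  qed
qed

end

subsection \<open>Divisibility by a binomial\<close>

text \<open>The curve x^a y^b = 1 is the image of t -> (t^b, t^(-a)). For u * a + v * b = 1 the
  parameter is recovered as t = x^v y^(-u).\<close>

lemma (in comm_group) coprime_exponent_parametrization:
  assumes a: "x \<in> carrier G" and b: "y \<in> carrier G" and cop: "coprime (a::nat) b"
    and eq: "x [^] a \<otimes> y [^] b = \<one>"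
  obtains t where "t \<in> carrier G" "t [^] b = x" "t [^] a \<otimes> y = \<one>"
proof -
  obtain u v :: int where uv: "u * int a + v * int b = 1"
    using bezout_int[of "int a" "int b"] cop by auto
  define t where "t = x [^] v \<otimes> y [^] (- u)"
  have t: "t \<in> carrier G" unfolding t_def using a b by simp
  have eqi: "(x [^] int a \<otimes> y [^] int b) [^] k = \<one>" for k :: int
    using eq by (simp add: int_pow_int)
  have dist: "(p \<otimes> q) [^] (k::int) = p [^] k \<otimes> q [^] k" if "p \<in> carrier G" "q \<in> carrier G" for p q k
    using that by (rule int_pow_distrib)
  have E: "x [^] (int a * k) \<otimes> y [^] (int b * k) = \<one>" for k :: int
    using eqi[of k] a b by (simp add: dist int_pow_pow mult.commute)
  have tk: "t [^] k = x [^] (v * k) \<otimes> y [^] (- u * k)" for k :: int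
    unfolding t_def using a b by (simp add: dist int_pow_pow)
  have "t [^] int b = x [^] (1 + int a * (- u)) \<otimes> y [^] (int b * (- u))"
    unfolding tk using uv by (intro arg_cong2[where f = "(\<otimes>)"] arg_cong2[where f = "([^])"]) (auto simp: algebra_simps)
  also have "\<dots> = x \<otimes> (x [^] (int a * (- u)) \<otimes> y [^] (int b * (- u)))"
    using a b by (simp only: int_pow_mult int_pow_1 m_assoc int_pow_closed)
  finally have 1: "t [^] b = x" unfolding E using a by (simp add: int_pow_int)
  have "t [^] int a \<otimes> y = (x [^] (int a * v) \<otimes> y [^] (int b * v + (- 1))) \<otimes> y"
    unfolding tk using uv by (intro arg_cong2[where f = "(\<otimes>)"] arg_cong2[where f = "([^])"]) (auto simp: algebra_simps)
  also have "\<dots> = (x [^] (int a * v) \<otimes> y [^] (int b * v)) \<otimes> (y [^] (- 1 :: int) \<otimes> y)"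
    using a b by (simp only: int_pow_mult m_assoc int_pow_closed m_closed)
  also have "\<dots> = \<one>" unfolding E using b by (simp add: int_pow_neg int_pow_1)
  finally have "t [^] a \<otimes> y = \<one>" by (simp add: int_pow_int)
  then show ?thesis using that t 1 by blast
qed

lemma (in cring) divides_power_diff:
  assumes g: "g \<in> carrier R" and P: "P \<in> carrier R" "Q \<in> carrier R" "g divides (P \<ominus> Q)"
  shows "g divides (P [^] (k::nat) \<ominus> Q [^] k)"
proof (induction k)
  case 0
  show ?case using g unfolding factor_def by (intro bexI[of _ \<zero>]) (simp_all add: minus_eq r_neg)
next
  case (Suc k)
  obtain h where h: "h \<in> carrier R" "P [^] k \<ominus> Q [^] k = g \<otimes> h" using Suc unfolding factor_def by blast
  obtain l where l: "l \<in> carrier R" "P \<ominus> Q = g \<otimes> l" using P(3) unfolding factor_def by blast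
  have Pk: "P [^] k \<in> carrier R" "Q [^] k \<in> carrier R" using P by auto
  have "P [^] Suc k \<ominus> Q [^] Suc k = (P [^] k \<ominus> Q [^] k) \<otimes> P \<oplus> Q [^] k \<otimes> (P \<ominus> Q)"
  proof -
    define p q where "p = P [^] k" and "q = Q [^] k"
    have "p \<in> carrier R" "q \<in> carrier R" using Pk unfolding p_def q_def by auto
    then have "p \<otimes> P \<ominus> q \<otimes> Q = (p \<ominus> q) \<otimes> P \<oplus> q \<otimes> (P \<ominus> Q)"
      using P(1,2) by algebra
    then show ?thesis unfolding p_def q_def by simp
  qed
  also have "\<dots> = g \<otimes> (h \<otimes> P \<oplus> Q [^] k \<otimes> l)"
    unfolding h(2) l(2) using g h(1) l(1) P Pk by algebra
  finally show ?case unfolding factor_def using h(1) l(1) P Pk by blast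
qed

section \<open>Monomials, coefficients and evaluation in R[x][y]\<close>

context field
begin

lemma UP_cring_UP: "UP_cring (UP R)"
proof -
  interpret U: UP_cring R "UP R" by unfold_locales
  show ?thesis unfolding UP_cring_def by (rule U.UP_cring)
qed

lemma UP2_cring: "cring (UP2 R)"
proof -
  interpret U: UP_cring "UP R" "UP (UP R)" by (rule UP_cring_UP)
  show ?thesis by (rule U.UP_cring)
qed

lemma monom2_closed [simp]: "c \<in> carrier R \<Longrightarrow> monom2 R c a b \<in> carrier (UP2 R)"
proof -
  assume c: "c \<in> carrier R"
  interpret U: UP_cring R "UP R" by unfold_locales
  interpret V: UP_cring "UP R" "UP (UP R)" by (rule UP_cring_UP)
  show ?thesis unfolding monom2_def using c by simp
qed

lemma monom2_mult:
  assumes "c \<in> carrier R" "e \<in> carrier R"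
  shows "monom2 R c a b \<otimes>\<^bsub>UP2 R\<^esub> monom2 R e a' b' = monom2 R (c \<otimes> e) (a + a') (b + b')"
proof -
  interpret U: UP_cring R "UP R" by unfold_locales
  interpret V: UP_cring "UP R" "UP (UP R)" by (rule UP_cring_UP)
  show ?thesis unfolding monom2_def using assms by simp
qed

lemma monom2_one: "monom2 R \<one> 0 0 = \<one>\<^bsub>UP2 R\<^esub>"
proof -
  interpret U: UP_cring R "UP R" by unfold_locales
  interpret V: UP_cring "UP R" "UP (UP R)" by (rule UP_cring_UP)
  show ?thesis unfolding monom2_def by simp
qed

lemma monom2_pow:
  assumes "c \<in> carrier R"
  shows "monom2 R c a b [^]\<^bsub>UP2 R\<^esub> (k::nat) = monom2 R (c [^] k) (a * k) (b * k)"
proof (induction k)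
  case 0
  then show ?case using monom2_one by simp
next
  case (Suc k)
  then show ?case using assms by (simp add: monom2_mult add.commute)
qed

lemma coeff2_monom2:
  assumes "c \<in> carrier R"
  shows "coeff2 R (monom2 R c a b) i j = (if a = i \<and> b = j then c else \<zero>)"
proof -
  interpret U: UP_cring R "UP R" by unfold_locales
  interpret V: UP_cring "UP R" "UP (UP R)" by (rule UP_cring_UP)
  show ?thesis unfolding monom2_def coeff2_def using assms by simp
qed

lemma coeff2_closed: "f \<in> carrier (UP2 R) \<Longrightarrow> coeff2 R f i j \<in> carrier R"
proof -
  assume f: "f \<in> carrier (UP2 R)"
  interpret U: UP_cring R "UP R" by unfold_locales
  interpret V: UP_cring "UP R" "UP (UP R)" by (rule UP_cring_UP)
  show ?thesis unfolding coeff2_def using f by simp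
qed

lemma coeff2_finsum:
  assumes "finite A" "\<And>u. u \<in> A \<Longrightarrow> p u \<in> carrier (UP2 R)"
  shows "coeff2 R (\<Oplus>\<^bsub>UP2 R\<^esub>u\<in>A. p u) i j = (\<Oplus>u\<in>A. coeff2 R (p u) i j)"
proof -
  interpret U: UP_cring R "UP R" by unfold_locales
  interpret V: UP_cring "UP R" "UP (UP R)" by (rule UP_cring_UP)
  have "up_ring.coeff (UP2 R) (\<Oplus>\<^bsub>UP2 R\<^esub>u\<in>A. p u) j = (\<Oplus>\<^bsub>UP R\<^esub>u\<in>A. up_ring.coeff (UP2 R) (p u) j)"
    using assms by (intro V.coeff_finsum) auto
  then show ?thesis unfolding coeff2_def using assms by (simp add: U.coeff_finsum)
qed

lemma UP2_eqI:
  assumes "f \<in> carrier (UP2 R)" "g \<in> carrier (UP2 R)" "\<And>i j. coeff2 R f i j = coeff2 R g i j"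
  shows "f = g"
proof -
  interpret U: UP_cring R "UP R" by unfold_locales
  interpret V: UP_cring "UP R" "UP (UP R)" by (rule UP_cring_UP)
  have "up_ring.coeff (UP2 R) f j = up_ring.coeff (UP2 R) g j" for j
    using assms unfolding coeff2_def by (intro U.up_eqI) auto
  then show ?thesis using assms by (intro V.up_eqI) auto
qed

lemma coeff2_zero [simp]: "coeff2 R \<zero>\<^bsub>UP2 R\<^esub> i j = \<zero>"
proof -
  interpret U: UP_cring R "UP R" by unfold_locales
  interpret V: UP_cring "UP R" "UP (UP R)" by (rule UP_cring_UP)
  show ?thesis unfolding coeff2_def by simp
qed

lemma UP2_repr:
  assumes f: "f \<in> carrier (UP2 R)" and d: "\<And>i j. i + j > d \<Longrightarrow> coeff2 R f i j = \<zero>"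
  shows "f = (\<Oplus>\<^bsub>UP2 R\<^esub>u\<in>tri d. monom2 R (coeff2 R f (fst u) (snd u)) (fst u) (snd u))"
proof -
  interpret P: cring "UP2 R" by (rule UP2_cring)
  define c where "c = (\<lambda>u. coeff2 R f (fst u) (snd u))"
  have c: "c u \<in> carrier R" for u unfolding c_def using coeff2_closed[OF f] .
  have "f = (\<Oplus>\<^bsub>UP2 R\<^esub>u\<in>tri d. monom2 R (c u) (fst u) (snd u))"
  proof (rule UP2_eqI[OF f])
    show "(\<Oplus>\<^bsub>UP2 R\<^esub>u\<in>tri d. monom2 R (c u) (fst u) (snd u)) \<in> carrier (UP2 R)"
      using c by (intro P.finsum_closed) auto
    fix i j
    have "coeff2 R (\<Oplus>\<^bsub>UP2 R\<^esub>u\<in>tri d. monom2 R (c u) (fst u) (snd u)) i j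
        = (\<Oplus>u\<in>tri d. if fst u = i \<and> snd u = j then c u else \<zero>)"
      using c by (subst coeff2_finsum) (auto simp: coeff2_monom2)
    also have "\<dots> = (\<Oplus>u\<in>tri d. if (i, j) = u then c u else \<zero>)"
      using c by (intro finsum_cong') auto
    also have "\<dots> = c (i, j)"
    proof (cases "(i, j) \<in> tri d")
      case True
      then show ?thesis using c by (intro add.finprod_singleton) auto
    next
      case False
      then have "(\<Oplus>u\<in>tri d. if (i, j) = u then c u else \<zero>) = (\<Oplus>u\<in>tri d. \<zero>)"
        using c by (intro finsum_cong') auto
      also have "\<dots> = c (i, j)" using d[of i j] False unfolding c_def tri_def by simp
      finally show ?thesis .
    qed
    finally show "coeff2 R f i j = coeff2 R (\<Oplus>\<^bsub>UP2 R\<^esub>u\<in>tri d. monom2 R (c u) (fst u) (snd u)) i j"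
      unfolding c_def by simp
  qed
  then show ?thesis unfolding c_def .
qed

lemma eval2_hom:
  assumes x: "x \<in> carrier R" and y: "y \<in> carrier R"
  shows "(\<lambda>f. eval2 R f x y) \<in> Ring.ring_hom (UP2 R) R"
    and "c \<in> carrier R \<Longrightarrow> eval2 R (monom2 R c a b) x y = c \<otimes> (x [^] a \<otimes> y [^] b)"
proof -
  interpret U: UP_pre_univ_prop R R id "UP R"
    by unfold_locales (auto simp: Ring.ring_hom_def)
  interpret V: UP_pre_univ_prop "UP R" R "UnivPoly.eval R R id x" "UP (UP R)"
    by (intro UP_pre_univ_propI U.UP_cring is_cring U.eval_ring_hom x)
  show "(\<lambda>f. eval2 R f x y) \<in> Ring.ring_hom (UP2 R) R"
    unfolding eval2_def by (rule V.eval_ring_hom[OF y])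
  assume c: "c \<in> carrier R"
  show "eval2 R (monom2 R c a b) x y = c \<otimes> (x [^] a \<otimes> y [^] b)"
    unfolding eval2_def monom2_def using x y c
    by (simp add: V.eval_monom U.eval_monom m_assoc)
qed

lemma eval2_repr:
  assumes f: "f \<in> carrier (UP2 R)" and d: "\<And>i j. i + j > d \<Longrightarrow> coeff2 R f i j = \<zero>"
    and x: "x \<in> carrier R" and y: "y \<in> carrier R"
  shows "eval2 R f x y = (\<Oplus>u\<in>tri d. coeff2 R f (fst u) (snd u) \<otimes> (x [^] fst u \<otimes> y [^] snd u))"
proof -
  define c where "c = (\<lambda>u. coeff2 R f (fst u) (snd u))"
  have c: "c u \<in> carrier R" for u unfolding c_def using coeff2_closed[OF f] .
  interpret P: cring "UP2 R" by (rule UP2_cring)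
  interpret h: ring_hom_ring "UP2 R" R "\<lambda>f. eval2 R f x y"
    by (intro ring_hom_ring.intro P.ring_axioms ring_axioms ring_hom_ring_axioms.intro eval2_hom x y)
  have "eval2 R f x y = eval2 R (\<Oplus>\<^bsub>UP2 R\<^esub>u\<in>tri d. monom2 R (c u) (fst u) (snd u)) x y"
    using UP2_repr[OF f d] unfolding c_def by simp
  also have "\<dots> = (\<Oplus>u\<in>tri d. eval2 R (monom2 R (c u) (fst u) (snd u)) x y)"
    using c by (subst h.hom_finsum) (auto simp: comp_def)
  also have "\<dots> = (\<Oplus>u\<in>tri d. c u \<otimes> (x [^] fst u \<otimes> y [^] snd u))"
    using c x y by (intro finsum_cong') (auto simp: eval2_hom)
  finally show ?thesis unfolding c_def .
qed

text \<open>Members of \<open>binomials\<close> must be non-units; for each binomial constructed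
  below this follows from a point on it.\<close>

lemma not_unit_of_zero:
  assumes g: "g \<in> carrier (UP2 R)" and x: "x \<in> carrier R" and y: "y \<in> carrier R"
    and 0: "eval2 R g x y = \<zero>"
  shows "g \<notin> Units (UP2 R)"
proof
  assume "g \<in> Units (UP2 R)"
  then obtain h where h: "h \<in> carrier (UP2 R)" "g \<otimes>\<^bsub>UP2 R\<^esub> h = \<one>\<^bsub>UP2 R\<^esub>"
    unfolding Units_def by blast
  have "\<one> = eval2 R (g \<otimes>\<^bsub>UP2 R\<^esub> h) x y"
    unfolding h(2) using ring_hom_one[OF eval2_hom(1)[OF x y]] by simp
  also have "\<dots> = \<zero> \<otimes> eval2 R h x y"
    using ring_hom_mult[OF eval2_hom(1)[OF x y] g h(1)] 0 by simp
  also have "\<dots> = \<zero>" using ring_hom_closed[OF eval2_hom(1)[OF x y] h(1)] by simp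
  finally show False by simp
qed

section \<open>Reduction of monomials modulo a binomial\<close>

text \<open>Modulo g, monomials with the same value of s are scalar multiples of each other, the
  scalars being quotients of \<alpha>. Rewriting every monomial of f in terms of one representative
  per class leaves on it the class sum divided by \<alpha> of the representative, that is, zero. In
  the applications \<alpha> u is the value of the monomial u at a base point.\<close>

lemma divides_of_class_sums:
  assumes f: "f \<in> carrier (UP2 R)" and d: "\<And>i j. i + j > d \<Longrightarrow> coeff2 R f i j = \<zero>"
    and g: "g \<in> carrier (UP2 R)"
    and \<alpha>: "\<And>u. u \<in> tri d \<Longrightarrow> \<alpha> u \<in> carrier R - {\<zero>}"
    and cong: "\<And>u v. u \<in> tri d \<Longrightarrow> v \<in> tri d \<Longrightarrow> s u = s v \<Longrightarrow>
      g divides\<^bsub>UP2 R\<^esub> (monom2 R (\<alpha> v) (fst u) (snd u) \<ominus>\<^bsub>UP2 R\<^esub> monom2 R (\<alpha> u) (fst v) (snd v))"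
    and sums: "\<And>k. (\<Oplus>u\<in>{u\<in>tri d. s u = k}. coeff2 R f (fst u) (snd u) \<otimes> \<alpha> u) = \<zero>"
  shows "g divides\<^bsub>UP2 R\<^esub> f"
proof -
  interpret P: cring "UP2 R" by (rule UP2_cring)
  define c where "c = (\<lambda>u. coeff2 R f (fst u) (snd u))"
  have c: "c u \<in> carrier R" for u unfolding c_def using coeff2_closed[OF f] .
  define rep where "rep = (\<lambda>k. SOME v. v \<in> tri d \<and> s v = k)"
  define r where "r = (\<lambda>u. rep (s u))"
  have r: "r u \<in> tri d \<and> s (r u) = s u" if "u \<in> tri d" for u
    unfolding r_def rep_def using that by (intro someI[of "\<lambda>v. v \<in> tri d \<and> s v = s u" u]) simp
  have inv\<alpha>: "inv (\<alpha> u) \<in> carrier R" "\<alpha> u \<otimes> inv (\<alpha> u) = \<one>" if "u \<in> tri d" for u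
    using \<alpha>[OF that] field_Units by auto
  \<comment> \<open>The coefficient of u after u has been replaced by the representative of its
    class.\<close>
  define \<beta> where "\<beta> = (\<lambda>u. c u \<otimes> \<alpha> u \<otimes> inv (\<alpha> (r u)))"
  have \<beta>: "\<beta> u \<in> carrier R" if "u \<in> tri d" for u
    unfolding \<beta>_def using c \<alpha>[OF that] inv\<alpha> r[OF that] by simp
  have "\<exists>k\<in>carrier (UP2 R). monom2 R (c u) (fst u) (snd u) =
      monom2 R (\<beta> u) (fst (r u)) (snd (r u)) \<oplus>\<^bsub>UP2 R\<^esub> g \<otimes>\<^bsub>UP2 R\<^esub> k" if u: "u \<in> tri d" for u
  proof -
    define e where "e = c u \<otimes> inv (\<alpha> (r u))"
    have e: "e \<in> carrier R" unfolding e_def using c inv\<alpha> r[OF u] by simp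
    have au: "\<alpha> u \<in> carrier R" "\<alpha> (r u) \<in> carrier R" using \<alpha> u r[OF u] by auto
    obtain k where k: "k \<in> carrier (UP2 R)"
      "monom2 R (\<alpha> (r u)) (fst u) (snd u) \<ominus>\<^bsub>UP2 R\<^esub> monom2 R (\<alpha> u) (fst (r u)) (snd (r u)) = g \<otimes>\<^bsub>UP2 R\<^esub> k"
      using cong[OF u, of "r u"] r[OF u] unfolding factor_def by auto
    define E where "E = monom2 R e 0 0"
    have E: "E \<in> carrier (UP2 R)" unfolding E_def using e by simp
    have 1: "E \<otimes>\<^bsub>UP2 R\<^esub> monom2 R (\<alpha> (r u)) (fst u) (snd u) = monom2 R (c u) (fst u) (snd u)"
    proof -
      have "e \<otimes> \<alpha> (r u) = c u"
      proof -
        have "x \<otimes> y \<otimes> z = x \<otimes> (z \<otimes> y)" if "x \<in> carrier R" "y \<in> carrier R" "z \<in> carrier R" for x y z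
          using that by (simp add: m_assoc m_comm m_lcomm)
        then show ?thesis unfolding e_def using c inv\<alpha> r[OF u] au by simp
      qed
      then show ?thesis unfolding E_def using e au by (simp add: monom2_mult)
    qed
    have 2: "E \<otimes>\<^bsub>UP2 R\<^esub> monom2 R (\<alpha> u) (fst (r u)) (snd (r u)) = monom2 R (\<beta> u) (fst (r u)) (snd (r u))"
    proof -
      have "e \<otimes> \<alpha> u = \<beta> u"
      proof -
        have "x \<otimes> y \<otimes> z = x \<otimes> z \<otimes> y" if "x \<in> carrier R" "y \<in> carrier R" "z \<in> carrier R" for x y z
          using that by (simp add: m_assoc m_comm m_lcomm)
        then show ?thesis unfolding e_def \<beta>_def using c inv\<alpha> r[OF u] au by simp
      qed
      then show ?thesis unfolding E_def using e au by (simp add: monom2_mult)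
    qed
    define p q where "p = monom2 R (\<alpha> (r u)) (fst u) (snd u)" and "q = monom2 R (\<alpha> u) (fst (r u)) (snd (r u))"
    have pq: "p \<in> carrier (UP2 R)" "q \<in> carrier (UP2 R)" unfolding p_def q_def using au by auto
    have "E \<otimes>\<^bsub>UP2 R\<^esub> p = E \<otimes>\<^bsub>UP2 R\<^esub> q \<oplus>\<^bsub>UP2 R\<^esub> E \<otimes>\<^bsub>UP2 R\<^esub> (p \<ominus>\<^bsub>UP2 R\<^esub> q)"
      using pq E by (simp add: P.minus_eq P.r_distr[symmetric] P.a_assoc[symmetric]) (simp add: P.a_ac P.r_neg)
    also have "p \<ominus>\<^bsub>UP2 R\<^esub> q = g \<otimes>\<^bsub>UP2 R\<^esub> k" using k(2) unfolding p_def q_def .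
    also have "E \<otimes>\<^bsub>UP2 R\<^esub> (g \<otimes>\<^bsub>UP2 R\<^esub> k) = g \<otimes>\<^bsub>UP2 R\<^esub> (E \<otimes>\<^bsub>UP2 R\<^esub> k)"
      using E g k(1) by (simp add: P.m_lcomm)
    finally show ?thesis unfolding p_def q_def 1 2 using E k(1) by blast
  qed
  then obtain k where k: "\<And>u. u \<in> tri d \<Longrightarrow> k u \<in> carrier (UP2 R)"
    "\<And>u. u \<in> tri d \<Longrightarrow> monom2 R (c u) (fst u) (snd u) =
      monom2 R (\<beta> u) (fst (r u)) (snd (r u)) \<oplus>\<^bsub>UP2 R\<^esub> g \<otimes>\<^bsub>UP2 R\<^esub> k u" by metis
  have Z: "(\<Oplus>\<^bsub>UP2 R\<^esub>u\<in>tri d. monom2 R (\<beta> u) (fst (r u)) (snd (r u))) = \<zero>\<^bsub>UP2 R\<^esub>"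
  proof (rule UP2_eqI)
    show "(\<Oplus>\<^bsub>UP2 R\<^esub>u\<in>tri d. monom2 R (\<beta> u) (fst (r u)) (snd (r u))) \<in> carrier (UP2 R)"
      using \<beta> by (intro P.finsum_closed) auto
    fix i j
    have "coeff2 R (\<Oplus>\<^bsub>UP2 R\<^esub>u\<in>tri d. monom2 R (\<beta> u) (fst (r u)) (snd (r u))) i j
        = (\<Oplus>u\<in>tri d. if r u = (i, j) then \<beta> u else \<zero>)"
    proof -
      have "coeff2 R (\<Oplus>\<^bsub>UP2 R\<^esub>u\<in>tri d. monom2 R (\<beta> u) (fst (r u)) (snd (r u))) i j
        = (\<Oplus>u\<in>tri d. coeff2 R (monom2 R (\<beta> u) (fst (r u)) (snd (r u))) i j)"
        using \<beta> by (intro coeff2_finsum) auto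
      also have "\<dots> = (\<Oplus>u\<in>tri d. if r u = (i, j) then \<beta> u else \<zero>)"
        using \<beta> by (intro finsum_cong') (auto simp: coeff2_monom2 prod_eq_iff)
      finally show ?thesis .
    qed
    also have "\<dots> = \<zero>"
    proof (cases "\<exists>u1\<in>tri d. r u1 = (i, j)")
      case False
      then have "(\<Oplus>u\<in>tri d. if r u = (i, j) then \<beta> u else \<zero>) = (\<Oplus>u\<in>tri d. \<zero>)"
        by (intro finsum_cong') auto
      then show ?thesis by simp
    next
      case True
      then obtain u1 where u1: "u1 \<in> tri d" "r u1 = (i, j)" by blast
      have rs: "r u = (i, j) \<longleftrightarrow> s u = s u1" if "u \<in> tri d" for u
        using u1 r[OF that] r[OF u1(1)] unfolding r_def by metis
      have tij: "(i, j) \<in> tri d" using r[OF u1(1)] u1(2) by simp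
      have "(\<Oplus>u\<in>tri d. if r u = (i, j) then \<beta> u else \<zero>) = (\<Oplus>u\<in>{u\<in>tri d. s u = s u1}. c u \<otimes> \<alpha> u \<otimes> inv (\<alpha> (i, j)))"
      proof (rule add.finprod_mono_neutral_cong_right)
        fix u assume "u \<in> {u\<in>tri d. s u = s u1}"
        then have "r u = (i, j)" using rs[of u] by simp
        then show "(if r u = (i, j) then \<beta> u else \<zero>) = c u \<otimes> \<alpha> u \<otimes> inv (\<alpha> (i, j))"
          unfolding \<beta>_def by simp
      next
        fix u assume "u \<in> tri d - {u\<in>tri d. s u = s u1}"
        then show "(if r u = (i, j) then \<beta> u else \<zero>) = \<zero>" using rs[of u] by simp
      next
        show "(\<lambda>u. if r u = (i, j) then \<beta> u else \<zero>) \<in> tri d \<rightarrow> carrier R" using \<beta> by simp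
      qed simp_all
      also have "\<dots> = (\<Oplus>u\<in>{u\<in>tri d. s u = s u1}. c u \<otimes> \<alpha> u) \<otimes> inv (\<alpha> (i, j))"
        using c \<alpha> inv\<alpha>[OF tij] by (intro finsum_ldistr[symmetric]) auto
      also have "\<dots> = \<zero>" using sums[of "s u1"] inv\<alpha>[OF tij] unfolding c_def by simp
      finally show ?thesis .
    qed
    finally show "coeff2 R (\<Oplus>\<^bsub>UP2 R\<^esub>u\<in>tri d. monom2 R (\<beta> u) (fst (r u)) (snd (r u))) i j
        = coeff2 R \<zero>\<^bsub>UP2 R\<^esub> i j" by simp
  qed simp
  have "f = (\<Oplus>\<^bsub>UP2 R\<^esub>u\<in>tri d. monom2 R (c u) (fst u) (snd u))"
    using UP2_repr[OF f d] unfolding c_def .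
  also have "\<dots> = (\<Oplus>\<^bsub>UP2 R\<^esub>u\<in>tri d. monom2 R (\<beta> u) (fst (r u)) (snd (r u)) \<oplus>\<^bsub>UP2 R\<^esub> g \<otimes>\<^bsub>UP2 R\<^esub> k u)"
    using k \<beta> g by (intro P.finsum_cong') auto
  also have "\<dots> = (\<Oplus>\<^bsub>UP2 R\<^esub>u\<in>tri d. monom2 R (\<beta> u) (fst (r u)) (snd (r u)))
      \<oplus>\<^bsub>UP2 R\<^esub> (\<Oplus>\<^bsub>UP2 R\<^esub>u\<in>tri d. g \<otimes>\<^bsub>UP2 R\<^esub> k u)"
    using k \<beta> g by (intro P.finsum_addf) auto
  also have "\<dots> = (\<Oplus>\<^bsub>UP2 R\<^esub>u\<in>tri d. g \<otimes>\<^bsub>UP2 R\<^esub> k u)"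
    unfolding Z using k g by (intro P.l_zero P.finsum_closed) auto
  also have "\<dots> = g \<otimes>\<^bsub>UP2 R\<^esub> (\<Oplus>\<^bsub>UP2 R\<^esub>u\<in>tri d. k u)"
    using k g by (intro P.finsum_rdistr[symmetric]) auto
  finally show ?thesis unfolding factor_def using k(1) by (intro bexI[of _ "\<Oplus>\<^bsub>UP2 R\<^esub>u\<in>tri d. k u"] P.finsum_closed) auto
qed

text \<open>The equation says b * (i - i') = a * (j - j'), so the difference is an integer multiple
  of (a, b); the two alternatives stand for the sign of the multiple.\<close>

lemma coprime_class_nat:
  assumes "coprime (a::nat) b" "b * i + a * j' = b * i' + a * j" "a > 0 \<or> b > 0"
  obtains t where "i = i' + a * t \<and> j = j' + b * t \<or> i' = i + a * t \<and> j' = j + b * t"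
proof -
  have *: "\<exists>t. i = i' + a * t \<and> j = j' + b * t" if le: "i' \<le> i" "j' \<le> j" "b * i + a * j' = b * i' + a * j" for i i' j j'
  proof -
    obtain p q where pq: "i = i' + p" "j = j' + q" using le(1,2) le_Suc_ex by metis
    then have e: "b * p = a * q" using le(3) by (simp add: algebra_simps)
    then have "a dvd b * p" by simp
    then have "a dvd p" using assms(1) by (simp add: coprime_dvd_mult_right_iff)
    then obtain t where t: "p = a * t" by (elim dvdE)
    have "b dvd a * q" using e by (metis dvd_triv_left)
    then have "b dvd q" using assms(1) by (simp add: coprime_dvd_mult_right_iff coprime_commute)
    then obtain t' where t': "q = b * t'" by (elim dvdE)
    have ab: "b * (a * t) = a * (b * t')" using e t t' by simp
    show ?thesis
    proof (cases "a = 0 \<or> b = 0")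
      case True
      then show ?thesis
      proof
        assume "a = 0"
        then have "b = 1" using assms(1) by simp
        then show ?thesis using pq t t' \<open>a = 0\<close> by (intro exI[of _ t']) simp
      next
        assume "b = 0"
        then have "a = 1" using assms(1) by simp
        then show ?thesis using pq t t' \<open>b = 0\<close> by (intro exI[of _ t]) simp
      qed
    next
      case False
      then have "t = t'" using ab by simp
      then show ?thesis using pq t t' by (intro exI[of _ t]) simp
    qed
  qed
  have "i' \<le> i \<and> j' \<le> j \<or> i \<le> i' \<and> j \<le> j'"
  proof (rule ccontr)
    assume "\<not> ?thesis"
    then have "i' < i \<and> j < j' \<or> i < i' \<and> j' < j" by linarith
    then show False
    proof
      assume "i' < i \<and> j < j'"
      then have "b * i' \<le> b * i" "a * j \<le> a * j'" "b * i' < b * i \<or> b = 0" "a * j < a * j' \<or> a = 0" by auto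
      then show False using assms(2,3) by linarith
    next
      assume "i < i' \<and> j' < j"
      then have "b * i \<le> b * i'" "a * j' \<le> a * j" "b * i < b * i' \<or> b = 0" "a * j' < a * j \<or> a = 0" by auto
      then show False using assms(2,3) by linarith
    qed
  qed
  then show ?thesis using *[of i' i j' j] *[of i i' j j'] assms(2) that by metis
qed

text \<open>Along the parametrised curve f becomes a polynomial in t of degree at most K whose
  coefficients are the class sums; it has more than K distinct zeros.\<close>

lemma class_sums_zero:
  assumes c: "\<And>u. u \<in> tri d \<Longrightarrow> c u \<in> carrier R"
    and I: "finite I" "card I > K"
    and t: "\<And>i. i \<in> I \<Longrightarrow> t i \<in> carrier R - {\<zero>}" "inj_on t I"
    and s: "\<And>u. u \<in> tri d \<Longrightarrow> s u \<le> K" and \<alpha>: "\<And>u. u \<in> tri d \<Longrightarrow> \<alpha> u \<in> carrier R"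
    and zero: "\<And>i. i \<in> I \<Longrightarrow> (\<Oplus>u\<in>tri d. c u \<otimes> \<alpha> u \<otimes> t i [^] (s u :: nat)) = \<zero>"
  shows "(\<Oplus>u\<in>{u\<in>tri d. s u = k}. c u \<otimes> \<alpha> u) = \<zero>"
proof (cases "k \<le> K")
  case False
  then have "{u\<in>tri d. s u = k} = {}" using s by auto
  then show ?thesis by (simp only: finsum_empty)
next
  case True
  define h where "h = (\<lambda>k. \<Oplus>u\<in>{u\<in>tri d. s u = k}. c u \<otimes> \<alpha> u)"
  have hc: "h k \<in> carrier R" for k unfolding h_def using c \<alpha> by (intro finsum_closed) auto
  have "h k = \<zero>"
  proof (rule polynomial_function_zero[where S = "t ` I" and D = K, OF hc _ _ _ _ True])
    show "finite (t ` I)" "t ` I \<subseteq> carrier R" using I t by auto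
    show "card (t ` I) > K" using card_image[OF t(2)] I(2) by simp
    fix x assume "x \<in> t ` I"
    then obtain i where i: "i \<in> I" "x = t i" by blast
    have xR: "x \<in> carrier R" using i t by auto
    have "(\<Oplus>k\<in>{..K}. h k \<otimes> x [^] k) = (\<Oplus>k\<in>{..K}. \<Oplus>u\<in>{u\<in>tri d. s u = k}. c u \<otimes> \<alpha> u \<otimes> x [^] s u)"
    proof (rule finsum_cong')
      fix k assume "k \<in> {..K}"
      have "h k \<otimes> x [^] k = (\<Oplus>u\<in>{u\<in>tri d. s u = k}. c u \<otimes> \<alpha> u \<otimes> x [^] k)"
        unfolding h_def using c \<alpha> xR by (intro finsum_ldistr) auto
      also have "\<dots> = (\<Oplus>u\<in>{u\<in>tri d. s u = k}. c u \<otimes> \<alpha> u \<otimes> x [^] s u)"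
        using c \<alpha> xR by (intro finsum_cong') auto
      finally show "h k \<otimes> x [^] k = \<dots>" .
    qed (use c \<alpha> xR in auto)
    also have "\<dots> = (\<Oplus>u\<in>(\<Union>k\<in>{..K}. {u\<in>tri d. s u = k}). c u \<otimes> \<alpha> u \<otimes> x [^] s u)"
      using c \<alpha> xR by (intro add.finprod_UN_disjoint[symmetric]) (auto simp: pairwise_def disjnt_def)
    also have "(\<Union>k\<in>{..K}. {u\<in>tri d. s u = k}) = tri d" using s by auto
    finally show "(\<Oplus>k\<in>{..K}. h k \<otimes> x [^] k) = \<zero>" using zero[OF i(1)] i(2) by simp
  qed
  then show ?thesis unfolding h_def .
qed

end

section \<open>The algebraic closure of the prime field and base change\<close>

text \<open>K(x) has finite dimension over the finite field K, so it is finite and two powers of x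
  coincide. Order 0 would encode infinite order and pass for a small one.\<close>

lemma (in field) ord_pos_of_algebraic:
  assumes K: "subfield K R" "finite K" and x: "x \<in> carrier (Multiplicative_Group.mult_of R)"
    and alg: "(algebraic over K) x"
  shows "group.ord (Multiplicative_Group.mult_of R) x > 0"
proof -
  interpret mg: comm_group "Multiplicative_Group.mult_of R" by (rule mult_of_comm_group)
  have xR: "x \<in> carrier R" using x by simp
  obtain Vs where Vs: "set Vs \<subseteq> carrier R" "Span K Vs = simple_extension K x"
    using exists_base[OF K(1) dimension_simple_extension[OF K(1) xR alg]] by blast
  have "Span K Vs = (\<lambda>Ks. combine Ks Vs) ` {Ks. set Ks \<subseteq> K \<and> length Ks = length Vs}"
    using Span_eq_combine_set_length_version[OF K(1) Vs(1)] by auto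
  then have fin: "finite (simple_extension K x)"
    unfolding Vs(2)[symmetric] using finite_lists_length_eq[OF K(2)] by simp
  have sub: "subring (simple_extension K x) R" "x \<in> simple_extension K x"
    using simple_extension_is_subring[OF subfieldE(1)[OF K(1)] xR]
      simple_extension_mem[OF subfieldE(1)[OF K(1)] xR] by auto
  have "x [^] k \<in> simple_extension K x" for k :: nat
    using sub by (induction k) (auto dest: subringE)
  then have "range (\<lambda>k::nat. x [^] k) \<subseteq> simple_extension K x" by auto
  then have "\<not> inj (\<lambda>k::nat. x [^] k)" using fin finite_subset range_inj_infinite by blast
  then obtain k l :: nat where "k \<noteq> l" "x [^] k = x [^] l" unfolding inj_def by blast
  then obtain k l :: nat where kl: "k < l" "x [^] k = x [^] l" by (metis nat_neq_iff)
  have "x [^]\<^bsub>Multiplicative_Group.mult_of R\<^esub> (l - k) = \<one>\<^bsub>Multiplicative_Group.mult_of R\<^esub>"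
  proof -
    have "x [^]\<^bsub>Multiplicative_Group.mult_of R\<^esub> k \<otimes>\<^bsub>Multiplicative_Group.mult_of R\<^esub> x [^]\<^bsub>Multiplicative_Group.mult_of R\<^esub> (l - k)
      = x [^]\<^bsub>Multiplicative_Group.mult_of R\<^esub> k"
      using kl by (simp only: mg.nat_pow_mult[OF x]) (simp add: Multiplicative_Group.nat_pow_mult_of)
    then show ?thesis using mg.l_cancel_one[of "x [^]\<^bsub>Multiplicative_Group.mult_of R\<^esub> k"] x by (meson mg.nat_pow_closed)
  qed
  then have "mg.ord x \<noteq> 0" using mg.ord_eq_0[OF x] kl(1) by (metis diff_is_0_eq leD)
  then show ?thesis by simp
qed

lemma field_Fp_bar: "Factorial_Ring.prime p \<Longrightarrow> field (Fp_bar p)"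
  using algebraic_closure.axioms(1)[OF algebraic_closure_Fp_bar(1)] .

lemma ring_hom_Fp_of_nat:
  assumes p: "Factorial_Ring.prime p" and S: "field S" and h: "h \<in> Ring.ring_hom (Fp p) S"
  shows "h (int n mod int p) = field.ring_int S (int n)"
proof -
  interpret S: field S by (rule S)
  have p1: "int p > 1" using p prime_gt_1_nat by fastforce
  have fp: "field (Fp p)" by (rule field_Fp[OF p])
  interpret F: field "Fp p" by (rule fp)
  interpret h: ring_hom_ring "Fp p" S h
    by (intro ring_hom_ring.intro F.ring_axioms S.ring_axioms ring_hom_ring_axioms.intro h)
  have c: "int n mod int p \<in> carrier (Fp p)" for n
    using p1 unfolding Fp_def residue_ring_def by simp
  show ?thesis
  proof (induction n)
    case 0
    have "\<zero>\<^bsub>Fp p\<^esub> = 0" unfolding Fp_def residue_ring_def by simp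
    then show ?case using h.hom_zero by simp
  next
    case (Suc n)
    have 1: "\<one>\<^bsub>Fp p\<^esub> = 1" unfolding Fp_def residue_ring_def by simp
    have "int (Suc n) mod int p = (int n mod int p) \<oplus>\<^bsub>Fp p\<^esub> \<one>\<^bsub>Fp p\<^esub>"
      unfolding 1 unfolding Fp_def residue_ring_def using mod_add_left_eq[of "int n" "int p" 1] by (simp add: add.commute)
    then have "h (int (Suc n) mod int p) = h (int n mod int p) \<oplus>\<^bsub>S\<^esub> h \<one>\<^bsub>Fp p\<^esub>" using c by simp
    also have "\<dots> = S.ring_int (int n) \<oplus>\<^bsub>S\<^esub> S.ring_int 1" using Suc by simp
    also have "\<dots> = S.ring_int (int n + 1)" by (rule S.ring_int_add[symmetric])
    finally show ?case by (simp add: add.commute)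
  qed
qed

lemma ring_int_Fp_bar:
  assumes "Factorial_Ring.prime p"
  shows "field.ring_int (Fp_bar p) (int p) = \<zero>\<^bsub>Fp_bar p\<^esub>"
proof -
  note h = ring_hom_Fp_of_nat[OF assms field_Fp_bar[OF assms] algebraic_closure_Fp_bar(2)[OF assms]]
  have "field.ring_int (Fp_bar p) (int p) = field.ring_int (Fp_bar p) 0" using h[of p] h[of 0] by simp
  then show ?thesis using field.ring_int_0[OF field_Fp_bar[OF assms]] by simp
qed

lemma mult_ord_Fp_bar_pos:
  assumes p: "Factorial_Ring.prime p" and x: "x \<in> carrier (Multiplicative_Group.mult_of (Fp_bar p))"
  shows "mult_ord (Fp_bar p) x > 0"
proof -
  interpret C: algebraic_closure "Fp_bar p" "Fp_incl p ` carrier (Fp p)"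
    by (rule algebraic_closure_Fp_bar(1)[OF p])
  have "finite (carrier (Fp p))" unfolding Fp_def residue_ring_def by simp
  then have "finite (Fp_incl p ` carrier (Fp p))" by simp
  then show ?thesis unfolding mult_ord_def
    using C.ord_pos_of_algebraic[OF C.subfield_axioms _ x] C.algebraic_extension x by simp
qed

lemma coeff2_apply:
  assumes "f \<in> carrier (UP2 R)"
  shows "coeff2 R f i j = f j i"
proof -
  have fup: "f \<in> up (UP R)" using assms by (simp add: UP_def)
  have "f j \<in> up R" using mem_upD[OF fup] by (simp add: UP_def)
  then show ?thesis unfolding coeff2_def using fup by (simp add: UP_def)
qed

lemma base_change_closed:
  assumes R: "cring R" and S: "cring S" and h: "h \<in> Ring.ring_hom R S" and f: "f \<in> carrier (UP2 R)"
  shows "base_change R h f \<in> carrier (UP2 S)"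
    and "coeff2 S (base_change R h f) i j = h (coeff2 R f i j)"
proof -
  interpret R: cring R by (rule R)
  interpret S: cring S by (rule S)
  interpret h: ring_hom_ring R S h
    by (intro ring_hom_ring.intro R.ring_axioms S.ring_axioms ring_hom_ring_axioms.intro h)
  have fup: "f \<in> up (UP R)" using f by (simp add: UP_def)
  have fj: "f j \<in> up R" for j using mem_upD[OF fup] by (simp add: UP_def)
  have c: "coeff2 R f i j = f j i" for i j by (rule coeff2_apply[OF f])
  have row: "(\<lambda>i. h (f j i)) \<in> up S" for j
  proof (rule mem_upI)
    show "h (f j n) \<in> carrier S" for n using mem_upD[OF fj] by simp
    obtain n where "bound \<zero>\<^bsub>R\<^esub> n (f j)" using fj[of j] unfolding up_def by blast
    then show "\<exists>n. bound \<zero>\<^bsub>S\<^esub> n (\<lambda>i. h (f j i))"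
      unfolding bound_def by (intro exI[of _ n]) simp
  qed
  have z: "\<zero>\<^bsub>UP R\<^esub> = (\<lambda>i. \<zero>\<^bsub>R\<^esub>)" "\<zero>\<^bsub>UP S\<^esub> = (\<lambda>i. \<zero>\<^bsub>S\<^esub>)" by (simp_all add: UP_def)
  have up: "base_change R h f \<in> up (UP S)"
    unfolding base_change_def c
  proof (rule mem_upI)
    show "(\<lambda>i. h (f n i)) \<in> carrier (UP S)" for n using row by (simp add: UP_def)
    obtain n where n: "bound \<zero>\<^bsub>UP R\<^esub> n f" using fup unfolding up_def by blast
    show "\<exists>n. bound \<zero>\<^bsub>UP S\<^esub> n (\<lambda>j i. h (f j i))"
      using n unfolding bound_def z by (intro exI[of _ n]) auto
  qed
  then show F: "base_change R h f \<in> carrier (UP2 S)" by (simp add: UP_def)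
  show "coeff2 S (base_change R h f) i j = h (coeff2 R f i j)"
    unfolding coeff2_apply[OF F] by (simp add: base_change_def)
qed

lemma coeff2_total_degree:
  assumes f: "f \<in> carrier (UP2 R)" and ij: "total_degree R f < i + j"
  shows "coeff2 R f i j = \<zero>\<^bsub>R\<^esub>"
proof -
  have fup: "f \<in> up (UP R)" using f by (simp add: UP_def)
  have fj: "f j \<in> up R" for j using mem_upD[OF fup] by (simp add: UP_def)
  have c: "coeff2 R f i j = f j i" for i j by (rule coeff2_apply[OF f])
  obtain m where m: "bound \<zero>\<^bsub>UP R\<^esub> m f" using fup unfolding up_def by blast
  have "\<exists>n. bound \<zero>\<^bsub>R\<^esub> n (f j)" for j using fj[of j] unfolding up_def by blast
  then obtain n where n: "\<And>j. bound \<zero>\<^bsub>R\<^esub> (n j) (f j)" by metis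
  have "\<forall>i j. m + sum n {..m} < i + j \<longrightarrow> coeff2 R f i j = \<zero>\<^bsub>R\<^esub>"
  proof (intro allI impI)
    fix i j assume ij: "m + sum n {..m} < i + j"
    show "coeff2 R f i j = \<zero>\<^bsub>R\<^esub>"
    proof (cases "m < j")
      case True
      then show ?thesis using m unfolding bound_def c by (simp add: UP_def)
    next
      case False
      then have "n j \<le> sum n {..m}" by (intro member_le_sum) auto
      then have "n j < i" using ij False by linarith
      then show ?thesis using n[of j] unfolding bound_def c by blast
    qed
  qed
  then have "\<forall>i j. total_degree R f < i + j \<longrightarrow> coeff2 R f i j = \<zero>\<^bsub>R\<^esub>"
    unfolding total_degree_def by (rule LeastI)
  then show ?thesis using ij by blast
qed

context field
begin

text \<open>The choice \<rho> = 1, a = b = 0 yields the zero polynomial, which is not a unit. Thus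
  the hypothesis on binomials already excludes f = 0.\<close>

lemma binomial_divides_zero: "\<exists>g\<in>binomials R. g divides\<^bsub>UP2 R\<^esub> \<zero>\<^bsub>UP2 R\<^esub>"
proof -
  interpret P: cring "UP2 R" by (rule UP2_cring)
  define g where "g = monom2 R \<one> 0 0 \<ominus>\<^bsub>UP2 R\<^esub> \<one>\<^bsub>UP2 R\<^esub>"
  have g0: "g = \<zero>\<^bsub>UP2 R\<^esub>" unfolding g_def monom2_one[symmetric] by simp
  have "eval2 R \<zero>\<^bsub>UP2 R\<^esub> \<one> \<one> = \<zero>"
  proof -
    interpret h: ring_hom_ring "UP2 R" R "\<lambda>f. eval2 R f \<one> \<one>"
      by (intro ring_hom_ring.intro P.ring_axioms ring_axioms ring_hom_ring_axioms.intro eval2_hom) simp_all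
    show ?thesis by simp
  qed
  then have "g \<notin> Units (UP2 R)" using not_unit_of_zero[of "\<zero>\<^bsub>UP2 R\<^esub>" \<one> \<one>] g0 by simp
  then have "g \<in> binomials R" unfolding binomials_def g_def by blast
  moreover have "g divides\<^bsub>UP2 R\<^esub> \<zero>\<^bsub>UP2 R\<^esub>"
    unfolding factor_def g0 by (intro bexI[of _ "\<zero>\<^bsub>UP2 R\<^esub>"]) auto
  ultimately show ?thesis by blast
qed

lemma nonzero_coeff_of_no_binomial:
  assumes f: "f \<in> carrier (UP2 R)" "\<And>i j. i + j > d \<Longrightarrow> coeff2 R f i j = \<zero>"
    and nb: "\<not> (\<exists>g\<in>binomials R. g divides\<^bsub>UP2 R\<^esub> f)"
  shows "\<exists>u\<in>tri d. coeff2 R f (fst u) (snd u) \<noteq> \<zero>"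
proof (rule ccontr)
  interpret P: cring "UP2 R" by (rule UP2_cring)
  assume "\<not> (\<exists>u\<in>tri d. coeff2 R f (fst u) (snd u) \<noteq> \<zero>)"
  then have z: "coeff2 R f i j = \<zero>" if "i + j \<le> d" for i j using that unfolding tri_def by force
  have "f = \<zero>\<^bsub>UP2 R\<^esub>"
  proof (rule UP2_eqI)
    show "coeff2 R f i j = coeff2 R \<zero>\<^bsub>UP2 R\<^esub> i j" for i j
      using z[of i j] f(2)[of i j] by (cases "i + j \<le> d") auto
  qed (use f in auto)
  then show False using nb binomial_divides_zero by simp
qed

end

lemma (in cring) divides_minus_commute:
  assumes "g \<in> carrier R" "p \<in> carrier R" "q \<in> carrier R" "g divides (p \<ominus> q)"
  shows "g divides (q \<ominus> p)"
proof -
  obtain h where h: "h \<in> carrier R" "p \<ominus> q = g \<otimes> h" using assms(4) unfolding factor_def by blast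
  have "q \<ominus> p = \<ominus> (p \<ominus> q)" using assms(2,3) by algebra
  also have "\<dots> = g \<otimes> (\<ominus> h)" unfolding h(2) using assms(1) h(1) by algebra
  finally show ?thesis unfolding factor_def using h(1) by blast
qed

lemma (in cring) divides_mult_power_diff:
  assumes g: "g \<in> carrier R" and P: "P \<in> carrier R" "Q \<in> carrier R" "g divides (P \<ominus> Q)"
    and W: "W \<in> carrier R"
  shows "g divides (W \<otimes> P [^] (k::nat) \<ominus> W \<otimes> Q [^] k)"
proof -
  obtain h where h: "h \<in> carrier R" "P [^] k \<ominus> Q [^] k = g \<otimes> h"
    using divides_power_diff[OF g P] unfolding factor_def by blast
  define p q where "p = P [^] k" and "q = Q [^] k"
  have pq: "p \<in> carrier R" "q \<in> carrier R" using P(1,2) unfolding p_def q_def by auto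
  have "W \<otimes> p \<ominus> W \<otimes> q = W \<otimes> (p \<ominus> q)" using W pq by algebra
  also have "\<dots> = g \<otimes> (W \<otimes> h)" unfolding p_def q_def h(2) using W g h(1) by algebra
  finally show ?thesis unfolding p_def q_def factor_def using W h(1) by blast
qed

lemma (in cring) minus_one_mult:
  assumes "m \<in> carrier R" "q \<in> carrier R"
  shows "(m \<ominus> \<one>) \<otimes> q = q \<otimes> m \<ominus> q"
  using assms by (simp add: minus_eq l_distr l_minus) (simp add: m_comm)

context field
begin

lemma eval2_minus:
  assumes "p \<in> carrier (UP2 R)" "q \<in> carrier (UP2 R)" "x \<in> carrier R" "y \<in> carrier R"
  shows "eval2 R (p \<ominus>\<^bsub>UP2 R\<^esub> q) x y = eval2 R p x y \<ominus> eval2 R q x y"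
proof -
  interpret P: cring "UP2 R" by (rule UP2_cring)
  interpret h: ring_hom_ring "UP2 R" R "\<lambda>f. eval2 R f x y"
    by (intro ring_hom_ring.intro P.ring_axioms ring_axioms ring_hom_ring_axioms.intro eval2_hom assms)
  show ?thesis using assms(1,2) by (simp add: a_minus_def)
qed

text \<open>The factor r clears denominators: a power of t if y depends on t through a negative
  exponent, and 1 otherwise.\<close>

lemma point_on_curve_zero:
  assumes f: "f \<in> carrier (UP2 R)" "\<And>i j. i + j > d \<Longrightarrow> coeff2 R f i j = \<zero>"
    and xy: "x \<in> carrier R" "y \<in> carrier R" "eval2 R f x y = \<zero>"
    and \<alpha>: "\<And>u. u \<in> tri d \<Longrightarrow> \<alpha> u \<in> carrier R" and t: "t \<in> carrier R"
    and eq: "\<And>u. u \<in> tri d \<Longrightarrow> \<alpha> u \<otimes> t [^] (s u :: nat) = x [^] fst u \<otimes> y [^] snd u \<otimes> r"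
    and r: "r \<in> carrier R"
  shows "(\<Oplus>u\<in>tri d. coeff2 R f (fst u) (snd u) \<otimes> \<alpha> u \<otimes> t [^] s u) = \<zero>"
proof -
  have c: "coeff2 R f i j \<in> carrier R" for i j using coeff2_closed[OF f(1)] .
  have "(\<Oplus>u\<in>tri d. coeff2 R f (fst u) (snd u) \<otimes> \<alpha> u \<otimes> t [^] s u) =
      (\<Oplus>u\<in>tri d. coeff2 R f (fst u) (snd u) \<otimes> (x [^] fst u \<otimes> y [^] snd u) \<otimes> r)"
    using c \<alpha> t eq xy r by (intro finsum_cong') (auto simp: m_assoc)
  also have "\<dots> = (\<Oplus>u\<in>tri d. coeff2 R f (fst u) (snd u) \<otimes> (x [^] fst u \<otimes> y [^] snd u)) \<otimes> r"
    using c xy(1,2) r by (intro finsum_ldistr[symmetric]) auto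
  also have "\<dots> = eval2 R f x y \<otimes> r" using eval2_repr[of f d x y] f xy(1,2) by simp
  finally show ?thesis using xy(3) r by simp
qed

lemma mult_of_quotients:
  assumes "x \<in> carrier (Multiplicative_Group.mult_of R)" "x0 \<in> carrier (Multiplicative_Group.mult_of R)"
  shows "x \<otimes> inv x0 \<in> carrier (Multiplicative_Group.mult_of R)" "x0 \<otimes> (x \<otimes> inv x0) = x"
    "x0 \<otimes> inv x0 = \<one>" "inv x0 \<in> carrier R" "(inv x0) [^] (k::nat) \<otimes> x0 [^] k = \<one>"
proof -
  have x: "x \<in> carrier R" "x \<noteq> \<zero>" "x0 \<in> carrier R" "x0 \<noteq> \<zero>" using assms by auto
  then have i: "inv x0 \<in> carrier R" "x0 \<otimes> inv x0 = \<one>" "inv x0 \<otimes> x0 = \<one>"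
    using field_Units by auto
  then have "inv x0 \<noteq> \<zero>" using x by auto
  then show "x \<otimes> inv x0 \<in> carrier (Multiplicative_Group.mult_of R)" using x i(1) integral by auto
  show "x0 \<otimes> (x \<otimes> inv x0) = x" using x i by (metis m_comm m_lcomm r_one)
  show "x0 \<otimes> inv x0 = \<one>" "inv x0 \<in> carrier R" using i by auto
  show "(inv x0) [^] k \<otimes> x0 [^] k = \<one>"
    using i x by (metis nat_pow_distrib nat_pow_one)
qed

text \<open>
  The curve is parametrised as \<open>(x i, y i) = (x0 t^b, y0 t^(-a))\<close>; multiplying by \<open>t^(a d)\<close>
  avoids negative exponents.
\<close>

lemma binomial_divides_product:
  assumes f: "f \<in> carrier (UP2 R)" "\<And>i j. i + j > d \<Longrightarrow> coeff2 R f i j = \<zero>"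
    and xy: "\<And>i. i \<in> I \<Longrightarrow> x i \<in> carrier (Multiplicative_Group.mult_of R) \<and>
        y i \<in> carrier (Multiplicative_Group.mult_of R) \<and> eval2 R f (x i) (y i) = \<zero>"
    and inj: "inj_on (\<lambda>i. (x i, y i)) I" and cop: "coprime (a::nat) b"
    and I: "finite I" "card I > d * (a + b)"
    and eq: "\<And>i j. i \<in> I \<Longrightarrow> j \<in> I \<Longrightarrow> x i [^] a \<otimes> y i [^] b = x j [^] a \<otimes> y j [^] b"
  shows "\<exists>g\<in>binomials R. g divides\<^bsub>UP2 R\<^esub> f"
proof -
  interpret P: cring "UP2 R" by (rule UP2_cring)
  interpret mg: comm_group "Multiplicative_Group.mult_of R" by (rule mult_of_comm_group)
  have pow: "u [^]\<^bsub>Multiplicative_Group.mult_of R\<^esub> k = u [^] k" for u and k :: nat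
    by (simp add: Multiplicative_Group.nat_pow_mult_of)
  have "I \<noteq> {}" using I(2) by auto
  then obtain i0 where i0: "i0 \<in> I" by blast
  define x0 y0 where "x0 = x i0" and "y0 = y i0"
  have 0: "x0 \<in> carrier (Multiplicative_Group.mult_of R)" "y0 \<in> carrier (Multiplicative_Group.mult_of R)"
    using xy[OF i0] unfolding x0_def y0_def by auto
  have h0: "x0 \<in> carrier R" "y0 \<in> carrier R" using 0 by auto
  define \<kappa> where "\<kappa> = x0 [^] a \<otimes> y0 [^] b"
  have kmg: "\<kappa> \<in> carrier (Multiplicative_Group.mult_of R)"
    unfolding \<kappa>_def using mg.m_closed[OF mg.nat_pow_closed[OF 0(1), of a] mg.nat_pow_closed[OF 0(2), of b]] pow by simp
  have k: "\<kappa> \<in> carrier R" "\<kappa> \<noteq> \<zero>" using kmg by auto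
  \<comment> \<open>With \<kappa> the common value of x^a y^b, the binomial x^a y^b / \<kappa> - 1
    vanishes at all the points.\<close>
  define \<rho> where "\<rho> = inv \<kappa>"
  have r: "\<rho> \<in> carrier R" "\<kappa> \<otimes> \<rho> = \<one>" unfolding \<rho>_def using mult_of_quotients[OF kmg kmg] by auto
  define \<alpha> where "\<alpha> = (\<lambda>u::nat\<times>nat. x0 [^] fst u \<otimes> y0 [^] snd u)"
  have \<alpha>R: "\<alpha> u \<in> carrier R" for u unfolding \<alpha>_def using h0 by simp
  have \<alpha>: "\<alpha> u \<in> carrier R - {\<zero>}" for u
    unfolding \<alpha>_def using mg.m_closed[OF mg.nat_pow_closed[OF 0(1), of "fst u"] mg.nat_pow_closed[OF 0(2), of "snd u"]] pow by simp
  have "\<exists>t. t \<in> carrier (Multiplicative_Group.mult_of R) \<and> x0 \<otimes> t [^] b = x i \<and> y i \<otimes> t [^] a = y0" if i: "i \<in> I" for i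
  proof -
    have xi: "x i \<in> carrier (Multiplicative_Group.mult_of R)" "y i \<in> carrier (Multiplicative_Group.mult_of R)"
      using xy[OF i] by auto
    have xiR: "x i \<in> carrier R" "y i \<in> carrier R" using xi by auto
    note qx = mult_of_quotients[OF xi(1) 0(1)] and qy = mult_of_quotients[OF xi(2) 0(2)]
    have "(x i \<otimes> inv x0) [^] a \<otimes> (y i \<otimes> inv y0) [^] b
      = (x i [^] a \<otimes> y i [^] b) \<otimes> ((inv x0) [^] a \<otimes> (inv y0) [^] b)"
      using xiR qx(4) qy(4) by (simp add: nat_pow_distrib m_assoc m_comm m_lcomm)
    also have "x i [^] a \<otimes> y i [^] b = x0 [^] a \<otimes> y0 [^] b" using eq[OF i i0] unfolding x0_def y0_def .
    also have "(x0 [^] a \<otimes> y0 [^] b) \<otimes> ((inv x0) [^] a \<otimes> (inv y0) [^] b)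
      = ((inv x0) [^] a \<otimes> x0 [^] a) \<otimes> ((inv y0) [^] b \<otimes> y0 [^] b)"
      using h0 qx(4) qy(4) by (simp add: m_assoc m_comm m_lcomm)
    also have "\<dots> = \<one>" using qx(5) qy(5) by simp
    finally have "(x i \<otimes> inv x0) [^] a \<otimes> (y i \<otimes> inv y0) [^] b = \<one>" .
    then obtain t where t: "t \<in> carrier (Multiplicative_Group.mult_of R)" "t [^] b = x i \<otimes> inv x0"
      "t [^] a \<otimes> (y i \<otimes> inv y0) = \<one>"
      using mg.coprime_exponent_parametrization[OF qx(1) qy(1) cop] pow by auto
    have tR: "t \<in> carrier R" using t(1) by simp
    have "x0 \<otimes> t [^] b = x i" using t(2) qx(2) by simp
    moreover have "y i \<otimes> t [^] a = y0"
    proof -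
      have "y0 = y0 \<otimes> (t [^] a \<otimes> (y i \<otimes> inv y0))" using t(3) h0 by simp
      also have "\<dots> = t [^] a \<otimes> (y0 \<otimes> (y i \<otimes> inv y0))" using h0 tR xiR qy(4) by (simp add: m_lcomm)
      also have "\<dots> = t [^] a \<otimes> y i" using qy(2) by simp
      finally show ?thesis using tR xiR by (simp add: m_comm)
    qed
    ultimately show ?thesis using t(1) by blast
  qed
  then obtain t where t: "\<And>i. i \<in> I \<Longrightarrow> t i \<in> carrier (Multiplicative_Group.mult_of R)"
    "\<And>i. i \<in> I \<Longrightarrow> x0 \<otimes> t i [^] b = x i" "\<And>i. i \<in> I \<Longrightarrow> y i \<otimes> t i [^] a = y0" by metis
  have tR: "t i \<in> carrier R" if "i \<in> I" for i using t(1)[OF that] by simp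
  \<comment> \<open>The exponent of t in x^(fst u) y^(snd u) t^(a * d); adding a * d makes it a
    natural number at most d * (a + b).\<close>
  define s where "s = (\<lambda>u. b * fst u + a * (d - snd u))"
  define g where "g = monom2 R \<rho> a b \<ominus>\<^bsub>UP2 R\<^esub> \<one>\<^bsub>UP2 R\<^esub>"
  have g: "g \<in> carrier (UP2 R)" unfolding g_def using r by simp
  define Pm Q where "Pm = monom2 R \<one> a b" and "Q = monom2 R \<kappa> 0 0"
  have PQ: "Pm \<in> carrier (UP2 R)" "Q \<in> carrier (UP2 R)" unfolding Pm_def Q_def using k by auto
  have "Pm \<ominus>\<^bsub>UP2 R\<^esub> Q = g \<otimes>\<^bsub>UP2 R\<^esub> Q"
  proof -
    have "Q \<otimes>\<^bsub>UP2 R\<^esub> monom2 R \<rho> a b = Pm" unfolding Q_def Pm_def using k r by (simp add: monom2_mult)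
    moreover have "g \<otimes>\<^bsub>UP2 R\<^esub> Q = Q \<otimes>\<^bsub>UP2 R\<^esub> monom2 R \<rho> a b \<ominus>\<^bsub>UP2 R\<^esub> Q"
    proof -
      define m where "m = monom2 R \<rho> a b"
      have "m \<in> carrier (UP2 R)" unfolding m_def using r by simp
      then show ?thesis unfolding g_def m_def[symmetric] using P.minus_one_mult PQ(2) by simp
    qed
    ultimately show ?thesis by simp
  qed
  then have dPQ: "g divides\<^bsub>UP2 R\<^esub> (Pm \<ominus>\<^bsub>UP2 R\<^esub> Q)" unfolding factor_def using PQ by blast
  have half: "g divides\<^bsub>UP2 R\<^esub> (monom2 R (\<alpha> v) (fst u) (snd u) \<ominus>\<^bsub>UP2 R\<^esub> monom2 R (\<alpha> u) (fst v) (snd v))"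
    if uv: "fst u = fst v + a * k" "snd u = snd v + b * k" for u v k
  proof -
    define W where "W = monom2 R (\<alpha> v) (fst v) (snd v)"
    have "\<alpha> u = \<alpha> v \<otimes> \<kappa> [^] k"
      unfolding \<alpha>_def \<kappa>_def uv using h0
      by (simp add: nat_pow_distrib nat_pow_pow nat_pow_mult[symmetric] m_assoc m_comm m_lcomm)
    then have "W \<otimes>\<^bsub>UP2 R\<^esub> Q [^]\<^bsub>UP2 R\<^esub> k = monom2 R (\<alpha> u) (fst v) (snd v)"
      unfolding W_def Q_def using \<alpha>R \<open>\<kappa> \<in> carrier R\<close> by (simp add: monom2_mult monom2_pow)
    moreover have "W \<otimes>\<^bsub>UP2 R\<^esub> Pm [^]\<^bsub>UP2 R\<^esub> k = monom2 R (\<alpha> v) (fst u) (snd u)"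
      unfolding W_def Pm_def uv using \<alpha>R by (simp add: monom2_mult monom2_pow)
    ultimately show ?thesis
      using P.divides_mult_power_diff[OF g PQ dPQ, of W k] \<alpha>R unfolding W_def by simp
  qed
  have "g divides\<^bsub>UP2 R\<^esub> f"
  proof (rule divides_of_class_sums[OF f g, where \<alpha> = \<alpha> and s = s])
    show "\<alpha> u \<in> carrier R - {\<zero>}" for u by (rule \<alpha>)
  next
    fix u v assume uv: "u \<in> tri d" "v \<in> tri d" "s u = s v"
    have "snd u \<le> d" "snd v \<le> d" using uv(1,2) unfolding tri_def by auto
    then obtain ju jv where j: "d = snd u + ju" "d = snd v + jv" by (metis le_Suc_ex)
    have "b * fst u + a * ju = b * fst v + a * jv" proof -
      have "d - snd u = ju" "d - snd v = jv" using j by auto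
      then show ?thesis using uv(3) unfolding s_def by simp
    qed
    \<comment> \<open>Both sides are enlarged so that the truncated subtractions in s
      disappear.\<close>
    then have "b * fst u + a * ju + a * snd u + a * snd v = b * fst v + a * jv + a * snd u + a * snd v" by simp
    then have "b * fst u + a * d + a * snd v = b * fst v + a * d + a * snd u"
      using j by (metis (no_types, lifting) add.assoc add.commute distrib_left)
    then have e: "b * fst u + a * snd v = b * fst v + a * snd u" by simp
    have ab: "a > 0 \<or> b > 0" using cop by auto
    obtain k where "fst u = fst v + a * k \<and> snd u = snd v + b * k \<or> fst v = fst u + a * k \<and> snd v = snd u + b * k"
      using coprime_class_nat[OF cop e ab] by blast
    then show "g divides\<^bsub>UP2 R\<^esub> (monom2 R (\<alpha> v) (fst u) (snd u) \<ominus>\<^bsub>UP2 R\<^esub> monom2 R (\<alpha> u) (fst v) (snd v))"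
    proof
      assume "fst u = fst v + a * k \<and> snd u = snd v + b * k"
      then show ?thesis by (intro half[of u v k]) simp_all
    next
      assume "fst v = fst u + a * k \<and> snd v = snd u + b * k"
      then have "g divides\<^bsub>UP2 R\<^esub> (monom2 R (\<alpha> u) (fst v) (snd v) \<ominus>\<^bsub>UP2 R\<^esub> monom2 R (\<alpha> v) (fst u) (snd u))"
        by (intro half[of v u k]) simp_all
      then show ?thesis by (rule P.divides_minus_commute[OF g monom2_closed[OF \<alpha>R] monom2_closed[OF \<alpha>R]])
    qed
  next
    fix k
    show "(\<Oplus>u\<in>{u\<in>tri d. s u = k}. coeff2 R f (fst u) (snd u) \<otimes> \<alpha> u) = \<zero>"
    proof (rule class_sums_zero[where c = "\<lambda>u. coeff2 R f (fst u) (snd u)" and t = t and I = I and s = s and \<alpha> = \<alpha>, OF _ I])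
      show "coeff2 R f (fst u) (snd u) \<in> carrier R" for u using coeff2_closed[OF f(1)] .
      show "t i \<in> carrier R - {\<zero>}" if "i \<in> I" for i using t(1)[OF that] by simp
      show "inj_on t I"
      proof (rule inj_onI)
        fix i j assume ij: "i \<in> I" "j \<in> I" "t i = t j"
        have "x i = x j" using t(2)[OF ij(1)] t(2)[OF ij(2)] ij(3) by simp
        moreover have "y i = y j"
        proof -
          have "t j [^] a \<in> carrier (Multiplicative_Group.mult_of R)"
            using mg.nat_pow_closed[OF t(1)[OF ij(2)], of a] pow by simp
          then have "t j [^] a \<in> carrier R" "t j [^] a \<noteq> \<zero>" by auto
          moreover have "y i \<otimes> t j [^] a = y j \<otimes> t j [^] a"
            using t(3)[OF ij(1)] t(3)[OF ij(2)] ij(3) by simp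
          ultimately show ?thesis using xy[OF ij(1)] xy[OF ij(2)] by (simp add: m_rcancel)
        qed
        ultimately show "i = j" using inj ij unfolding inj_on_def by blast
      qed
      show "s u \<le> d * (a + b)" if "u \<in> tri d" for u
      proof -
        have "b * fst u \<le> b * d" "a * (d - snd u) \<le> a * d" using that unfolding tri_def by auto
        moreover have "d * (a + b) = a * d + b * d" by (simp add: algebra_simps)
        ultimately show ?thesis unfolding s_def by linarith
      qed
      show "\<alpha> u \<in> carrier R" for u by (rule \<alpha>R)
      fix i assume i: "i \<in> I"
      have xiR: "x i \<in> carrier R" "y i \<in> carrier R" "eval2 R f (x i) (y i) = \<zero>" using xy[OF i] by auto
      show "(\<Oplus>u\<in>tri d. coeff2 R f (fst u) (snd u) \<otimes> \<alpha> u \<otimes> t i [^] s u) = \<zero>"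
      proof (rule point_on_curve_zero[OF f xiR _ tR[OF i], where r = "t i [^] (a * d)"])
        show "\<alpha> u \<in> carrier R" for u by (rule \<alpha>R)
        show "t i [^] (a * d) \<in> carrier R" using tR[OF i] by simp
        fix u assume "u \<in> tri d"
        then have "snd u \<le> d" unfolding tri_def by auto
        then have ad: "a * d = a * snd u + a * (d - snd u)" by (simp add: diff_mult_distrib2)
        have xi: "x i [^] fst u = x0 [^] fst u \<otimes> t i [^] (b * fst u)"
          unfolding t(2)[OF i, symmetric] using h0 tR[OF i] by (simp add: nat_pow_distrib nat_pow_pow)
        have yi: "y0 [^] snd u = y i [^] snd u \<otimes> t i [^] (a * snd u)"
          unfolding t(3)[OF i, symmetric] using xiR tR[OF i] by (simp add: nat_pow_distrib nat_pow_pow)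
        show "\<alpha> u \<otimes> t i [^] s u = x i [^] fst u \<otimes> y i [^] snd u \<otimes> t i [^] (a * d)"
          unfolding \<alpha>_def s_def xi yi ad using h0 tR[OF i] xiR(2)
          by (simp add: nat_pow_mult[symmetric] m_assoc m_comm m_lcomm)
      qed
    qed
  qed
  moreover have "g \<in> binomials R"
  proof -
    have "eval2 R g x0 y0 = \<zero>"
      unfolding g_def monom2_one[symmetric] using r k h0
      by (simp add: eval2_minus eval2_hom \<kappa>_def[symmetric] m_comm)
    then have "g \<notin> Units (UP2 R)" using not_unit_of_zero[OF g h0] by blast
    then show ?thesis unfolding binomials_def using r(1) unfolding g_def by blast
  qed
  ultimately show ?thesis by blast
qed

text \<open>Here the parametrisation is (x0 t^b, y0 t^a), obtained from the quotients x i / x0 and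
  y0 / y i. No negative exponents arise, and the degree in t is at most d * max a b.\<close>

lemma binomial_divides_quotient:
  assumes f: "f \<in> carrier (UP2 R)" "\<And>i j. i + j > d \<Longrightarrow> coeff2 R f i j = \<zero>"
    and xy: "\<And>i. i \<in> I \<Longrightarrow> x i \<in> carrier (Multiplicative_Group.mult_of R) \<and>
        y i \<in> carrier (Multiplicative_Group.mult_of R) \<and> eval2 R f (x i) (y i) = \<zero>"
    and inj: "inj_on (\<lambda>i. (x i, y i)) I" and cop: "coprime (a::nat) b"
    and I: "finite I" "card I > d * max a b"
    and eq: "\<And>i j. i \<in> I \<Longrightarrow> j \<in> I \<Longrightarrow> x i [^] a \<otimes> y j [^] b = x j [^] a \<otimes> y i [^] b"
  shows "\<exists>g\<in>binomials R. g divides\<^bsub>UP2 R\<^esub> f"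
proof -
  interpret P: cring "UP2 R" by (rule UP2_cring)
  interpret mg: comm_group "Multiplicative_Group.mult_of R" by (rule mult_of_comm_group)
  have pow: "u [^]\<^bsub>Multiplicative_Group.mult_of R\<^esub> k = u [^] k" for u and k :: nat
    by (simp add: Multiplicative_Group.nat_pow_mult_of)
  have "I \<noteq> {}" using I(2) by auto
  then obtain i0 where i0: "i0 \<in> I" by blast
  define x0 y0 where "x0 = x i0" and "y0 = y i0"
  have 0: "x0 \<in> carrier (Multiplicative_Group.mult_of R)" "y0 \<in> carrier (Multiplicative_Group.mult_of R)"
    using xy[OF i0] unfolding x0_def y0_def by auto
  have h0: "x0 \<in> carrier R" "y0 \<in> carrier R" using 0 by auto
  have y0b: "y0 [^] b \<in> carrier (Multiplicative_Group.mult_of R)"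
    using mg.nat_pow_closed[OF 0(2), of b] pow by simp
  have x0a: "x0 [^] a \<in> carrier (Multiplicative_Group.mult_of R)"
    using mg.nat_pow_closed[OF 0(1), of a] pow by simp
  define \<rho> where "\<rho> = x0 [^] a \<otimes> inv (y0 [^] b)"
  have r: "\<rho> \<in> carrier R" "\<rho> \<otimes> y0 [^] b = x0 [^] a"
  proof -
    note q = mult_of_quotients[OF x0a y0b]
    show "\<rho> \<in> carrier R" unfolding \<rho>_def using q(1) by simp
    then show "\<rho> \<otimes> y0 [^] b = x0 [^] a" using q(2) h0 unfolding \<rho>_def by (simp add: m_comm)
  qed
  define \<alpha> where "\<alpha> = (\<lambda>u::nat\<times>nat. x0 [^] fst u \<otimes> y0 [^] snd u)"
  have \<alpha>R: "\<alpha> u \<in> carrier R" for u unfolding \<alpha>_def using h0 by simp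
  have \<alpha>: "\<alpha> u \<in> carrier R - {\<zero>}" for u
    unfolding \<alpha>_def using mg.m_closed[OF mg.nat_pow_closed[OF 0(1), of "fst u"] mg.nat_pow_closed[OF 0(2), of "snd u"]] pow by simp
  have "\<exists>t. t \<in> carrier (Multiplicative_Group.mult_of R) \<and> x0 \<otimes> t [^] b = x i \<and> y0 \<otimes> t [^] a = y i" if i: "i \<in> I" for i
  proof -
    have xi: "x i \<in> carrier (Multiplicative_Group.mult_of R)" "y i \<in> carrier (Multiplicative_Group.mult_of R)"
      using xy[OF i] by auto
    have xiR: "x i \<in> carrier R" "y i \<in> carrier R" using xi by auto
    note qx = mult_of_quotients[OF xi(1) 0(1)] and qy = mult_of_quotients[OF 0(2) xi(2)]
    have "(x i \<otimes> inv x0) [^] a \<otimes> (y0 \<otimes> inv (y i)) [^] b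
      = (x i [^] a \<otimes> y0 [^] b) \<otimes> ((inv x0) [^] a \<otimes> (inv (y i)) [^] b)"
      using xiR h0 qx(4) qy(4) by (simp add: nat_pow_distrib m_assoc m_comm m_lcomm)
    also have "x i [^] a \<otimes> y0 [^] b = x0 [^] a \<otimes> y i [^] b" using eq[OF i i0] unfolding x0_def y0_def .
    also have "(x0 [^] a \<otimes> y i [^] b) \<otimes> ((inv x0) [^] a \<otimes> (inv (y i)) [^] b)
      = ((inv x0) [^] a \<otimes> x0 [^] a) \<otimes> ((inv (y i)) [^] b \<otimes> y i [^] b)"
      using h0 xiR qx(4) qy(4) by (simp add: m_assoc m_comm m_lcomm)
    also have "\<dots> = \<one>" using qx(5) qy(5) by simp
    finally have "(x i \<otimes> inv x0) [^] a \<otimes> (y0 \<otimes> inv (y i)) [^] b = \<one>" .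
    then obtain t where t: "t \<in> carrier (Multiplicative_Group.mult_of R)" "t [^] b = x i \<otimes> inv x0"
      "t [^] a \<otimes> (y0 \<otimes> inv (y i)) = \<one>"
      using mg.coprime_exponent_parametrization[OF qx(1) qy(1) cop] pow by auto
    have tR: "t \<in> carrier R" using t(1) by simp
    have "x0 \<otimes> t [^] b = x i" using t(2) qx(2) by simp
    moreover have "y0 \<otimes> t [^] a = y i"
    proof -
      have "y i = y i \<otimes> (t [^] a \<otimes> (y0 \<otimes> inv (y i)))" using t(3) xiR by simp
      also have "\<dots> = t [^] a \<otimes> (y i \<otimes> (y0 \<otimes> inv (y i)))" using h0 tR xiR qy(4) by (simp add: m_lcomm)
      also have "\<dots> = t [^] a \<otimes> y0" using qy(2) by simp
      finally show ?thesis using tR h0 by (simp add: m_comm)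
    qed
    ultimately show ?thesis using t(1) by blast
  qed
  then obtain t where t: "\<And>i. i \<in> I \<Longrightarrow> t i \<in> carrier (Multiplicative_Group.mult_of R)"
    "\<And>i. i \<in> I \<Longrightarrow> x0 \<otimes> t i [^] b = x i" "\<And>i. i \<in> I \<Longrightarrow> y0 \<otimes> t i [^] a = y i" by metis
  have tR: "t i \<in> carrier R" if "i \<in> I" for i using t(1)[OF that] by simp
  define s where "s = (\<lambda>u. b * fst u + a * snd u)"
  define g where "g = monom2 R \<rho> 0 b \<ominus>\<^bsub>UP2 R\<^esub> monom2 R \<one> a 0"
  have g: "g \<in> carrier (UP2 R)" unfolding g_def using r by simp
  define Pm Q where "Pm = monom2 R \<one> a 0" and "Q = monom2 R \<rho> 0 b"
  have PQ: "Pm \<in> carrier (UP2 R)" "Q \<in> carrier (UP2 R)" unfolding Pm_def Q_def using r by auto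
  have "g divides\<^bsub>UP2 R\<^esub> (Q \<ominus>\<^bsub>UP2 R\<^esub> Pm)"
    unfolding factor_def g_def Pm_def Q_def using r by (intro bexI[of _ "\<one>\<^bsub>UP2 R\<^esub>"]) auto
  then have dPQ: "g divides\<^bsub>UP2 R\<^esub> (Pm \<ominus>\<^bsub>UP2 R\<^esub> Q)" by (rule P.divides_minus_commute[OF g PQ(2,1)])
  have half: "g divides\<^bsub>UP2 R\<^esub> (monom2 R (\<alpha> v) (fst u) (snd u) \<ominus>\<^bsub>UP2 R\<^esub> monom2 R (\<alpha> u) (fst v) (snd v))"
    if uv: "fst u = fst v + a * k" "snd v = snd u + b * k" for u v k
  proof -
    \<comment> \<open>The x-exponent of v and the y-exponent of u are the smaller ones, so W carries
      the common part of the two monomials.\<close>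
    define W where "W = monom2 R (\<alpha> v) (fst v) (snd u)"
    have "\<alpha> u = \<alpha> v \<otimes> \<rho> [^] k"
    proof -
      have "\<alpha> v \<otimes> \<rho> [^] k = x0 [^] fst v \<otimes> y0 [^] snd u \<otimes> (\<rho> \<otimes> y0 [^] b) [^] k"
        unfolding \<alpha>_def uv(2) using h0 r(1)
        by (simp add: nat_pow_distrib nat_pow_pow nat_pow_mult[symmetric] m_assoc m_comm m_lcomm)
      also have "\<dots> = \<alpha> u"
        unfolding r(2) \<alpha>_def uv(1) using h0
        by (simp add: nat_pow_pow nat_pow_mult[symmetric] m_assoc m_comm m_lcomm)
      finally show ?thesis by simp
    qed
    then have "W \<otimes>\<^bsub>UP2 R\<^esub> Q [^]\<^bsub>UP2 R\<^esub> k = monom2 R (\<alpha> u) (fst v) (snd v)"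
      unfolding W_def Q_def uv(2) using \<alpha>R r(1) by (simp add: monom2_mult monom2_pow)
    moreover have "W \<otimes>\<^bsub>UP2 R\<^esub> Pm [^]\<^bsub>UP2 R\<^esub> k = monom2 R (\<alpha> v) (fst u) (snd u)"
      unfolding W_def Pm_def uv(1) using \<alpha>R by (simp add: monom2_mult monom2_pow)
    ultimately show ?thesis
      using P.divides_mult_power_diff[OF g PQ dPQ, of W k] \<alpha>R unfolding W_def by simp
  qed
  have "g divides\<^bsub>UP2 R\<^esub> f"
  proof (rule divides_of_class_sums[OF f g, where \<alpha> = \<alpha> and s = s])
    show "\<alpha> u \<in> carrier R - {\<zero>}" for u by (rule \<alpha>)
  next
    fix u v assume uv: "u \<in> tri d" "v \<in> tri d" "s u = s v"
    have e: "b * fst u + a * snd u = b * fst v + a * snd v" using uv(3) unfolding s_def by simp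
    have ab: "a > 0 \<or> b > 0" using cop by auto
    obtain k where "fst u = fst v + a * k \<and> snd v = snd u + b * k \<or> fst v = fst u + a * k \<and> snd u = snd v + b * k"
      using coprime_class_nat[OF cop e ab] by blast
    then show "g divides\<^bsub>UP2 R\<^esub> (monom2 R (\<alpha> v) (fst u) (snd u) \<ominus>\<^bsub>UP2 R\<^esub> monom2 R (\<alpha> u) (fst v) (snd v))"
    proof
      assume "fst u = fst v + a * k \<and> snd v = snd u + b * k"
      then show ?thesis by (intro half[of u v k]) simp_all
    next
      assume "fst v = fst u + a * k \<and> snd u = snd v + b * k"
      then have "g divides\<^bsub>UP2 R\<^esub> (monom2 R (\<alpha> u) (fst v) (snd v) \<ominus>\<^bsub>UP2 R\<^esub> monom2 R (\<alpha> v) (fst u) (snd u))"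
        by (intro half[of v u k]) simp_all
      then show ?thesis by (rule P.divides_minus_commute[OF g monom2_closed[OF \<alpha>R] monom2_closed[OF \<alpha>R]])
    qed
  next
    fix k
    show "(\<Oplus>u\<in>{u\<in>tri d. s u = k}. coeff2 R f (fst u) (snd u) \<otimes> \<alpha> u) = \<zero>"
    proof (rule class_sums_zero[where c = "\<lambda>u. coeff2 R f (fst u) (snd u)" and t = t and I = I and s = s and \<alpha> = \<alpha>, OF _ I])
      show "coeff2 R f (fst u) (snd u) \<in> carrier R" for u using coeff2_closed[OF f(1)] .
      show "t i \<in> carrier R - {\<zero>}" if "i \<in> I" for i using t(1)[OF that] by simp
      show "inj_on t I"
      proof (rule inj_onI)
        fix i j assume ij: "i \<in> I" "j \<in> I" "t i = t j"
        have "x i = x j" using t(2)[OF ij(1)] t(2)[OF ij(2)] ij(3) by simp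
        moreover have "y i = y j" using t(3)[OF ij(1)] t(3)[OF ij(2)] ij(3) by simp
        ultimately show "i = j" using inj ij unfolding inj_on_def by blast
      qed
      show "s u \<le> d * max a b" if "u \<in> tri d" for u
      proof -
        have "b * fst u \<le> max a b * fst u" "a * snd u \<le> max a b * snd u" by auto
        then have "s u \<le> max a b * (fst u + snd u)" unfolding s_def distrib_left by linarith
        also have "\<dots> \<le> max a b * d" using that unfolding tri_def by (intro mult_le_mono2) auto
        finally show ?thesis by (simp add: mult.commute)
      qed
      show "\<alpha> u \<in> carrier R" for u by (rule \<alpha>R)
      fix i assume i: "i \<in> I"
      have xiR: "x i \<in> carrier R" "y i \<in> carrier R" "eval2 R f (x i) (y i) = \<zero>" using xy[OF i] by auto
      show "(\<Oplus>u\<in>tri d. coeff2 R f (fst u) (snd u) \<otimes> \<alpha> u \<otimes> t i [^] s u) = \<zero>"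
      proof (rule point_on_curve_zero[OF f xiR _ tR[OF i], where r = \<one>])
        show "\<alpha> u \<in> carrier R" for u by (rule \<alpha>R)
        fix u :: "nat \<times> nat"
        have xi: "x i [^] fst u = x0 [^] fst u \<otimes> t i [^] (b * fst u)"
          unfolding t(2)[OF i, symmetric] using h0 tR[OF i] by (simp add: nat_pow_distrib nat_pow_pow)
        have yi: "y i [^] snd u = y0 [^] snd u \<otimes> t i [^] (a * snd u)"
          unfolding t(3)[OF i, symmetric] using h0 tR[OF i] by (simp add: nat_pow_distrib nat_pow_pow)
        show "\<alpha> u \<otimes> t i [^] s u = x i [^] fst u \<otimes> y i [^] snd u \<otimes> \<one>"
          unfolding \<alpha>_def s_def xi yi using h0 tR[OF i]
          by (simp add: nat_pow_mult[symmetric] m_assoc m_comm m_lcomm)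
      qed (assumption, rule one_closed)
    qed
  qed
  moreover have "g \<in> binomials R"
  proof -
    have "eval2 R g x0 y0 = \<zero>"
      unfolding g_def using r h0 by (simp add: eval2_minus eval2_hom)
    then have "g \<notin> Units (UP2 R)" using not_unit_of_zero[OF g h0] by blast
    then show ?thesis unfolding binomials_def using r(1) unfolding g_def by blast
  qed
  ultimately show ?thesis by blast
qed

lemma binomial_divides:
  assumes f: "f \<in> carrier (UP2 R)" "\<And>i j. i + j > d \<Longrightarrow> coeff2 R f i j = \<zero>"
    and xy: "\<And>i. i < N \<Longrightarrow> x i \<in> carrier (Multiplicative_Group.mult_of R) \<and>
        y i \<in> carrier (Multiplicative_Group.mult_of R) \<and> eval2 R f (x i) (y i) = \<zero>"
    and inj: "inj_on (\<lambda>i. (x i, y i)) {..<N}" and ob: "on_binomial_idx d N x y"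
  shows "\<exists>g\<in>binomials R. g divides\<^bsub>UP2 R\<^esub> f"
proof -
  obtain a b where cop: "coprime a b" and
    alt: "(\<exists>I\<subseteq>{..<N}. card I > d * (a + b) \<and>
         (\<forall>i\<in>I. \<forall>j\<in>I. x i [^] a \<otimes> y i [^] b = x j [^] a \<otimes> y j [^] b)) \<or>
      (\<exists>I\<subseteq>{..<N}. card I > d * max a b \<and>
         (\<forall>i\<in>I. \<forall>j\<in>I. x i [^] a \<otimes> y j [^] b = x j [^] a \<otimes> y i [^] b))"
    using ob unfolding on_binomial_idx_def by blast
  from alt show ?thesis
  proof
    assume "\<exists>I\<subseteq>{..<N}. card I > d * (a + b) \<and>
         (\<forall>i\<in>I. \<forall>j\<in>I. x i [^] a \<otimes> y i [^] b = x j [^] a \<otimes> y j [^] b)"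
    then obtain I where I: "I \<subseteq> {..<N}" "card I > d * (a + b)"
      "\<And>i j. i \<in> I \<Longrightarrow> j \<in> I \<Longrightarrow> x i [^] a \<otimes> y i [^] b = x j [^] a \<otimes> y j [^] b" by blast
    show ?thesis
      by (rule binomial_divides_product[OF f _ inj_on_subset[OF inj I(1)] cop _ I(2,3)])
        (use xy I(1) finite_subset[OF I(1)] in auto)
  next
    assume "\<exists>I\<subseteq>{..<N}. card I > d * max a b \<and>
         (\<forall>i\<in>I. \<forall>j\<in>I. x i [^] a \<otimes> y j [^] b = x j [^] a \<otimes> y i [^] b)"
    then obtain I where I: "I \<subseteq> {..<N}" "card I > d * max a b"
      "\<And>i j. i \<in> I \<Longrightarrow> j \<in> I \<Longrightarrow> x i [^] a \<otimes> y j [^] b = x j [^] a \<otimes> y i [^] b" by blast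
    show ?thesis
      by (rule binomial_divides_quotient[OF f _ inj_on_subset[OF inj I(1)] cop _ I(2,3)])
        (use xy I(1) finite_subset[OF I(1)] in auto)
  qed
qed

end

subsection \<open>Exceptional primes\<close>

text \<open>Each prime divisor contributes a factor of at least 2, so a bound 2^(c * n) on r allows
  at most c * n primes.\<close>

lemma two_power_card_prime_divisors_le:
  assumes "r \<noteq> (0::int)"
  shows "finite {p::nat. Factorial_Ring.prime p \<and> int p dvd r}"
    and "2 ^ card {p::nat. Factorial_Ring.prime p \<and> int p dvd r} \<le> \<bar>r\<bar>"
proof -
  define n where "n = nat \<bar>r\<bar>"
  have n: "n \<noteq> 0" "int n = \<bar>r\<bar>" using assms unfolding n_def by auto
  have "int p dvd r \<longleftrightarrow> p dvd n" for p using n(2) by (metis dvd_abs_iff int_dvd_int_iff)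
  then have eq: "{p::nat. Factorial_Ring.prime p \<and> int p dvd r} = prime_factors n"
    using n(1) by (auto simp: prime_factors_dvd)
  show "finite {p::nat. Factorial_Ring.prime p \<and> int p dvd r}" unfolding eq by simp
  have "(\<Prod>p\<in>prime_factors n. 2) \<le> (\<Prod>p\<in>prime_factors n. p ^ multiplicity p n)"
  proof (rule prod_mono)
    fix p assume p: "p \<in> prime_factors n"
    then have "2 \<le> p" "multiplicity p n > 0"
      using prime_ge_2_nat by (auto simp: prime_factors_multiplicity)
    then show "0 \<le> (2::nat) \<and> 2 \<le> p ^ multiplicity p n"
      using self_le_power[of p "multiplicity p n"] by simp
  qed
  also have "\<dots> = n" using prod_prime_factors[OF n(1)] by simp
  finally have "2 ^ card (prime_factors n) \<le> n" by simp
  then have "int (2 ^ card (prime_factors n)) \<le> int n" by (rule of_nat_mono)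
  then show "2 ^ card {p::nat. Factorial_Ring.prime p \<and> int p dvd r} \<le> \<bar>r\<bar>" unfolding eq n(2)[symmetric] by simp
qed

lemma gram_poly_cong:
  "(\<And>i. i < N \<Longrightarrow> es i = es' i) \<Longrightarrow> gram_poly d N n es = gram_poly d N n es'"
  unfolding gram_poly_def gram_def by simp

text \<open>Exactly the polynomial identities that \<open>char_dvd_norm\<close> evaluates; they
  mention no prime, so one certificate serves all characteristics.\<close>

definition norm_certificate :: "nat \<Rightarrow> int poly \<Rightarrow> int \<Rightarrow> bool" where
  "norm_certificate n D r \<longleftrightarrow>
    (\<exists>A \<Phi> Q h. xpoly n = \<Phi> * h \<and> h dvd xprod n \<and> D * A = \<Phi> * Q + [:r:])"

text \<open>There are at most m choices of n and m^(2 * N) families of exponents, and each has a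
  certificate with r at most 2^(c * n) in absolute value, hence at most c * m prime divisors. The
  constant c comes from the determinant bound and depends on d and N only.\<close>

lemma exceptional_primes:
  "\<exists>c. \<forall>m. \<exists>E. finite E \<and> card E \<le> c * m ^ (2 * N + 2) \<and>
     (\<forall>n es. 0 < n \<and> n \<le> m \<and> (\<forall>i<N. fst (es i) < n \<and> snd (es i) < n) \<and>
        int_eval (gram_poly d N n es) (zeta n) \<noteq> 0 \<longrightarrow>
        (\<exists>r. norm_certificate n (gram_poly d N n es) r \<and>
          (\<forall>p::nat. Factorial_Ring.prime p \<and> int p dvd r \<longrightarrow> p \<in> E)))"
proof -
  define K where "K = card (tri d)"
  obtain c :: nat where "fact K * real N ^ K < 2 ^ c"
    using real_arch_pow[of 2 "fact K * real N ^ K"] by auto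
  then have c: "fact K * real N ^ K \<le> 2 ^ c" by simp
  define ok where "ok = (\<lambda>n es. 0 < n \<and> int_eval (gram_poly d N n es) (zeta n) \<noteq> 0)"
  have "\<exists>r. r \<noteq> 0 \<and> \<bar>r\<bar> \<le> 2 ^ (c * n) \<and> norm_certificate n (gram_poly d N n es) r" if "ok n es" for n es
  proof -
    have n: "0 < n" "int_eval (gram_poly d N n es) (zeta n) \<noteq> 0" using that unfolding ok_def by auto
    have b: "norm (int_eval (gram_poly d N n es) w) \<le> 2 ^ c" if "norm w = 1" for w
      using gram_det_bound[OF that, of K "tri_enum d" n N es] c unfolding gram_poly_def K_def by linarith
    have one: "(1::real) \<le> 2 ^ c" by simp
    obtain r :: int and A \<Phi> Q h where r: "r \<noteq> 0" "\<bar>real_of_int r\<bar> \<le> (2 ^ c) ^ n"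
      "xpoly n = \<Phi> * h" "h dvd xprod n" "gram_poly d N n es * A = \<Phi> * Q + [:r:]"
      by (rule norm_in_ideal[OF n one b]) (assumption, rule that)
    have "real_of_int \<bar>r\<bar> \<le> real_of_int (2 ^ (c * n))" using r(2) by (simp add: power_mult)
    then have "\<bar>r\<bar> \<le> 2 ^ (c * n)" by (simp only: of_int_le_iff)
    then show ?thesis using r unfolding norm_certificate_def by blast
  qed
  then obtain r where r: "\<And>n es. ok n es \<Longrightarrow> r n es \<noteq> 0" "\<And>n es. ok n es \<Longrightarrow> \<bar>r n es\<bar> \<le> 2 ^ (c * n)"
    "\<And>n es. ok n es \<Longrightarrow> norm_certificate n (gram_poly d N n es) (r n es)" by metis
  define B where "B = (\<lambda>q. {p::nat. Factorial_Ring.prime p \<and> int p dvd r (fst q) (snd q)})"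
  have B: "finite (B q)" "card (B q) \<le> c * fst q" if "ok (fst q) (snd q)" for q
  proof -
    show "finite (B q)" unfolding B_def by (rule two_power_card_prime_divisors_le[OF r(1)[OF that]])
    have "2 ^ card (B q) \<le> \<bar>r (fst q) (snd q)\<bar>"
      unfolding B_def by (rule two_power_card_prime_divisors_le[OF r(1)[OF that]])
    also have "\<dots> \<le> 2 ^ (c * fst q)" by (rule r(2)[OF that])
    finally show "card (B q) \<le> c * fst q" by simp
  qed
  show ?thesis
  proof (rule exI[of _ c], rule allI)
    fix m :: nat
    define F where "F = {1..m} \<times> (PiE {..<N} (\<lambda>_. {..<m} \<times> {..<m}))"
    define G where "G = {q \<in> F. ok (fst q) (snd q)}"
    define E where "E = (\<Union>q\<in>G. B q)"
    have finF: "finite F" unfolding F_def by (intro finite_cartesian_product finite_PiE) auto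
    have cF: "card F = m * (m * m) ^ N"
      unfolding F_def by (simp add: card_cartesian_product card_PiE)
    have finG: "finite G" using finF unfolding G_def by simp
    have finE: "finite E" unfolding E_def using finG B(1) by (intro finite_UN_I) (auto simp: G_def)
    have "card E \<le> (\<Sum>q\<in>G. card (B q))" unfolding E_def by (rule card_UN_le[OF finG])
    also have "\<dots> \<le> (\<Sum>q\<in>G. c * m)"
    proof (rule sum_mono)
      fix q assume q: "q \<in> G"
      then have "card (B q) \<le> c * fst q" using B(2) unfolding G_def by simp
      also have "\<dots> \<le> c * m"
      proof -
        have "q \<in> F" using q unfolding G_def by blast
        then have "fst q \<in> {1..m}" unfolding F_def by (simp only: mem_Times_iff)
        then show ?thesis by simp
      qed
      finally show "card (B q) \<le> c * m" .
    qed
    also have "\<dots> = card G * (c * m)" by simp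
    also have "\<dots> \<le> card F * (c * m)"
      using card_mono[OF finF, of G] unfolding G_def by (intro mult_le_mono1) auto
    also have "\<dots> = c * m ^ (2 * N + 2)"
      unfolding cF by (simp add: power_mult power_add power2_eq_square)
    finally have cE: "card E \<le> c * m ^ (2 * N + 2)" .
    show "\<exists>E. finite E \<and> card E \<le> c * m ^ (2 * N + 2) \<and>
     (\<forall>n es. 0 < n \<and> n \<le> m \<and> (\<forall>i<N. fst (es i) < n \<and> snd (es i) < n) \<and>
        int_eval (gram_poly d N n es) (zeta n) \<noteq> 0 \<longrightarrow>
        (\<exists>r. norm_certificate n (gram_poly d N n es) r \<and>
          (\<forall>p::nat. Factorial_Ring.prime p \<and> int p dvd r \<longrightarrow> p \<in> E)))"
    proof (rule exI[of _ E], intro conjI allI impI)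
      show "finite E" by (rule finE)
      show "card E \<le> c * m ^ (2 * N + 2)" by (rule cE)
      fix n es
      assume a: "0 < n \<and> n \<le> m \<and> (\<forall>i<N. fst (es i) < n \<and> snd (es i) < n) \<and>
        int_eval (gram_poly d N n es) (zeta n) \<noteq> 0"
      \<comment> \<open>The Gram polynomial sees the exponents below N only; restriction puts them
        into the finite set F over which E is formed.\<close>
      define es' where "es' = restrict es {..<N}"
      have g: "gram_poly d N n es' = gram_poly d N n es"
        unfolding es'_def by (rule gram_poly_cong) simp
      have ok: "ok n es'" unfolding ok_def g using a by simp
      have "es i \<in> {..<m} \<times> {..<m}" if "i \<in> {..<N}" for i
      proof -
        have "fst (es i) < n" "snd (es i) < n" "n \<le> m" using a that by auto
        then show ?thesis unfolding mem_Times_iff by simp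
      qed
      then have pe: "es' \<in> PiE {..<N} (\<lambda>_. {..<m} \<times> {..<m})"
        unfolding es'_def restrict_PiE_iff by blast
      have "n \<in> {1..m}" using a by simp
      from SigmaI[OF this pe] have "(n, es') \<in> F" unfolding F_def .
      then have G: "(n, es') \<in> G" unfolding G_def using ok by (simp only: mem_Collect_eq fst_conv snd_conv simp_thms)
      show "\<exists>r. norm_certificate n (gram_poly d N n es) r \<and>
          (\<forall>p::nat. Factorial_Ring.prime p \<and> int p dvd r \<longrightarrow> p \<in> E)"
      proof (intro exI conjI allI impI)
        show "norm_certificate n (gram_poly d N n es) (r n es')" using r(3)[OF ok] g by simp
        show "p \<in> E" if "Factorial_Ring.prime p \<and> int p dvd r n es'" for p :: nat
        proof -
          have "p \<in> B (n, es')" unfolding B_def using that by simp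
          then show ?thesis unfolding E_def using G by blast
        qed
      qed
    qed
  qed
qed

context field
begin

text \<open>N points have at most 2 * N different coordinates, each of order at most L, so one
  element of order at most L^(2 * N) generates them all. Assumption E says that p is not exceptional
  at this level.\<close>

lemma low_order_zeros_contradiction:
  assumes p: "Factorial_Ring.prime (p::nat)" "ring_int (int p) = \<zero>" and N: "N > 11 * d\<^sup>2"
    and f: "f \<in> carrier (UP2 R)" "\<And>i j. i + j > d \<Longrightarrow> coeff2 R f i j = \<zero>"
    and nz: "\<exists>u\<in>tri d. coeff2 R f (fst u) (snd u) \<noteq> \<zero>"
    and nb: "\<not> (\<exists>g\<in>binomials R. g divides\<^bsub>UP2 R\<^esub> f)"
    and E: "\<And>n es. 0 < n \<Longrightarrow> n \<le> L ^ (2 * N) \<Longrightarrow> (\<And>i. i < N \<Longrightarrow> fst (es i) < n \<and> snd (es i) < n) \<Longrightarrow>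
        int_eval (gram_poly d N n es) (zeta n) \<noteq> 0 \<Longrightarrow>
        \<exists>r. norm_certificate n (gram_poly d N n es) r \<and> \<not> int p dvd r"
    and S: "finite S" "card S = N"
      "\<And>x y. (x, y) \<in> S \<Longrightarrow> x \<in> carrier (Multiplicative_Group.mult_of R) \<and>
         y \<in> carrier (Multiplicative_Group.mult_of R) \<and> eval2 R f x y = \<zero>"
      "\<And>x y. (x, y) \<in> S \<Longrightarrow> 0 < mult_ord R x \<and> mult_ord R x \<le> L \<and> 0 < mult_ord R y \<and> mult_ord R y \<le> L"
  shows False
proof -
  define T where "T = fst ` S \<union> snd ` S"
  have T: "finite T" "T \<subseteq> carrier (Multiplicative_Group.mult_of R)"
    "\<And>x. x \<in> T \<Longrightarrow> group.ord (Multiplicative_Group.mult_of R) x > 0"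
    "\<And>x. x \<in> T \<Longrightarrow> group.ord (Multiplicative_Group.mult_of R) x \<le> L"
    using S unfolding T_def mult_ord_def by auto
  have "card T \<le> card (fst ` S) + card (snd ` S)" unfolding T_def by (rule card_Un_le)
  also have "\<dots> \<le> 2 * N" using card_image_le[OF S(1), of fst] card_image_le[OF S(1), of snd] S(2) by simp
  finally have cT: "card T \<le> 2 * N" .
  have "S \<noteq> {}" using S(2) N by auto
  then have L: "L \<ge> 1" using S(4) by fastforce
  obtain w where w: "w \<in> carrier (Multiplicative_Group.mult_of R)" "group.ord (Multiplicative_Group.mult_of R) w > 0"
    "group.ord (Multiplicative_Group.mult_of R) w \<le> (\<Prod>x\<in>T. group.ord (Multiplicative_Group.mult_of R) x)"
    "\<And>x. x \<in> T \<Longrightarrow> \<exists>i < group.ord (Multiplicative_Group.mult_of R) w. x = w [^] i"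
    by (rule common_generator[OF T(1-3)]) (assumption, rule that)
  define n where "n = group.ord (Multiplicative_Group.mult_of R) w"
  have n: "0 < n" "n \<le> L ^ (2 * N)"
  proof -
    show "0 < n" unfolding n_def by (rule w(2))
    have "(\<Prod>x\<in>T. group.ord (Multiplicative_Group.mult_of R) x) \<le> (\<Prod>x\<in>T. L)"
      using T(4) by (intro prod_mono) auto
    also have "\<dots> \<le> L ^ (2 * N)" using power_increasing[OF cT L] by simp
    finally show "n \<le> L ^ (2 * N)" using w(3) unfolding n_def by linarith
  qed
  obtain P where P: "bij_betw P {0..<N} S" using ex_bij_betw_nat_finite[OF S(1)] S(2) by blast
  define x y where "x = (\<lambda>i. fst (P i))" and "y = (\<lambda>i. snd (P i))"
  have PS: "(x i, y i) \<in> S" if "i < N" for i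
    using P that unfolding bij_betw_def x_def y_def by auto
  have "\<exists>e. fst e < n \<and> snd e < n \<and> x i = w [^] fst e \<and> y i = w [^] snd e" if "i < N" for i
  proof -
    have "x i \<in> T" "y i \<in> T" unfolding T_def using PS[OF that] by force+
    then obtain j k where "j < n" "x i = w [^] j" "k < n" "y i = w [^] k" using w(4) unfolding n_def by meson
    then show ?thesis by (intro exI[of _ "(j, k)"]) simp
  qed
  then obtain es where es: "\<And>i. i < N \<Longrightarrow> fst (es i) < n \<and> snd (es i) < n"
    "\<And>i. i < N \<Longrightarrow> x i = w [^] fst (es i)" "\<And>i. i < N \<Longrightarrow> y i = w [^] snd (es i)" by metis
  have wR: "w \<in> carrier R" using w(1) by simp
  have k0: "ring_eval w (gram_poly d N n es) = \<zero>"
  proof (rule gram_poly_zero[where x = x and y = y and c = "\<lambda>u. coeff2 R f (fst u) (snd u)", OF wR es(2,3) _ nz])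
    show "coeff2 R f (fst u) (snd u) \<in> carrier R" for u using coeff2_closed[OF f(1)] .
    fix i assume i: "i < N"
    have xy: "x i \<in> carrier R" "y i \<in> carrier R" "eval2 R f (x i) (y i) = \<zero>" using S(3)[OF PS[OF i]] by auto
    show "(\<Oplus>u\<in>tri d. coeff2 R f (fst u) (snd u) \<otimes> (x i [^] fst u \<otimes> y i [^] snd u)) = \<zero>"
      using eval2_repr[of f d "x i" "y i"] f xy by simp
  qed
  have "int_eval (gram_poly d N n es) (zeta n) = 0"
  proof (rule ccontr)
    assume "int_eval (gram_poly d N n es) (zeta n) \<noteq> 0"
    then obtain r where r: "norm_certificate n (gram_poly d N n es) r" "\<not> int p dvd r"
      using E[OF n, of es] es(1) by blast
    then obtain A \<Phi> Q h where c: "xpoly n = \<Phi> * h" "h dvd xprod n" "gram_poly d N n es * A = \<Phi> * Q + [:r:]"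
      unfolding norm_certificate_def by blast
    show False using char_dvd_norm[OF p w(1) n_def[symmetric] n(1) k0 c] r(2) by contradiction
  qed
  moreover have inj: "inj_on (\<lambda>i. (x i, y i)) {..<N}"
    using P unfolding bij_betw_def x_def y_def atLeast0LessThan by simp
  ultimately have "on_binomial_idx d N x y"
    by (intro low_order_points_on_binomial[where x = x and y = y and es = es,
          OF w(1) n_def[symmetric] n(1) es(2,3,1) _ N])
  then have "\<exists>g\<in>binomials R. g divides\<^bsub>UP2 R\<^esub> f"
    using S(3)[OF PS] by (intro binomial_divides[where x = x and y = y, OF f _ inj]) blast+
  then show False using nb by contradiction
qed

end

text \<open>Orders are compared with z rather than with p: for p at most z, an order sum below
  p^\<epsilon> is below z^\<epsilon>, so a single exceptional set serves all these primes.\<close>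

theorem theorem4:
  fixes d :: nat and \<delta> :: real
  assumes "d > 0" and "\<delta> > 0"
  shows "\<exists>\<epsilon>::real. \<epsilon> > 0 \<and>
    (\<forall>\<^sub>F z::real in at_top.
       \<exists>E::nat set. finite E \<and> real (card E) \<le> z powr \<delta> \<and>
         (\<forall>p. Factorial_Ring.prime p \<and> real p \<le> z \<and> p \<notin> E \<longrightarrow>
           (\<forall>f \<in> carrier (UP2 (Fp p)).
              total_degree (Fp p) f \<le> d \<and>
              \<not> (\<exists>g \<in> binomials (Fp_bar p).
                    g divides\<^bsub>UP2 (Fp_bar p)\<^esub> base_change (Fp p) (Fp_incl p) f) \<longrightarrow>
              (\<exists>S. finite S \<and> card S \<le> 11 * d ^ 3 + d \<and>
                 (\<forall>x \<in> carrier (Multiplicative_Group.mult_of (Fp_bar p)). \<forall>y \<in> carrier (Multiplicative_Group.mult_of (Fp_bar p)).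
                    eval2 (Fp_bar p) (base_change (Fp p) (Fp_incl p) f) x y = \<zero>\<^bsub>Fp_bar p\<^esub> \<and>
                    (x, y) \<notin> S \<longrightarrow>
                    real (mult_ord (Fp_bar p) x + mult_ord (Fp_bar p) y) \<ge> real p powr \<epsilon>)))))"
proof -
  \<comment> \<open>One more than the number of exceptions allowed; d > 0 puts it above 11 *
    d^2.\<close>
  define N where "N = 11 * d ^ 3 + d + 1"
  have N: "N > 11 * d\<^sup>2"
    using assms(1) power_increasing[of 2 3 d] unfolding N_def by simp
  \<comment> \<open>The exceptional set has at most c * m^(2 * N + 2) elements with m = L^(2 * N),
    that is, c * L^k.\<close>
  define k where "k = 2 * N * (2 * N + 2)"
  have k: "k > 0" unfolding k_def N_def by simp
  obtain c where c: "\<And>m. \<exists>E. finite E \<and> card E \<le> c * m ^ (2 * N + 2) \<and>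
     (\<forall>n es. 0 < n \<and> n \<le> m \<and> (\<forall>i<N. fst (es i) < n \<and> snd (es i) < n) \<and>
        int_eval (gram_poly d N n es) (zeta n) \<noteq> 0 \<longrightarrow>
        (\<exists>r. norm_certificate n (gram_poly d N n es) r \<and>
          (\<forall>p::nat. Factorial_Ring.prime p \<and> int p dvd r \<longrightarrow> p \<in> E)))"
    using exceptional_primes[of N d] by blast
  define \<epsilon> where "\<epsilon> = \<delta> / (2 * real k)"
  have \<epsilon>: "\<epsilon> > 0" "\<epsilon> * real k = \<delta> / 2" using assms(2) k unfolding \<epsilon>_def by auto
  \<comment> \<open>The budget z^\<delta> is split in halves: one absorbs the constant c for large
    z, the other absorbs L^k since \<epsilon> * k = \<delta> / 2.\<close>
  have ev: "\<forall>\<^sub>F z::real in at_top. real c \<le> z powr (\<delta> / 2) \<and> z \<ge> 1"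
    using eventually_ge_at_top[of "max 1 ((real c + 1) powr (2 / \<delta>))"]
  proof eventually_elim
    case (elim z)
    have "real c + 1 = ((real c + 1) powr (2 / \<delta>)) powr (\<delta> / 2)"
      using assms(2) by (simp add: powr_powr)
    also have "\<dots> \<le> z powr (\<delta> / 2)"
      using elim assms(2) by (intro powr_mono2) auto
    finally show ?case using elim by simp
  qed
  show ?thesis
  proof (intro exI[of _ \<epsilon>] conjI \<epsilon>(1) eventually_mono[OF ev])
    fix z :: real assume z: "real c \<le> z powr (\<delta> / 2) \<and> z \<ge> 1"
    define L where "L = nat \<lfloor>z powr \<epsilon>\<rfloor>"
    have L: "real L \<le> z powr \<epsilon>" unfolding L_def by simp
    obtain E where E: "finite E" "card E \<le> c * (L ^ (2 * N)) ^ (2 * N + 2)"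
      and Ep: "\<And>n es. 0 < n \<and> n \<le> L ^ (2 * N) \<and> (\<forall>i<N. fst (es i) < n \<and> snd (es i) < n) \<and>
        int_eval (gram_poly d N n es) (zeta n) \<noteq> 0 \<Longrightarrow>
        \<exists>r. norm_certificate n (gram_poly d N n es) r \<and>
          (\<forall>p::nat. Factorial_Ring.prime p \<and> int p dvd r \<longrightarrow> p \<in> E)"
      using c[of "L ^ (2 * N)"] by blast
    have "real (card E) \<le> real (c * L ^ k)"
      using E(2) unfolding k_def power_mult by (rule of_nat_mono)
    also have "\<dots> = real c * real L ^ k" by simp
    also have "\<dots> \<le> z powr (\<delta> / 2) * (z powr \<epsilon>) ^ k"
      using z L by (intro mult_mono power_mono) auto
    also have "(z powr \<epsilon>) ^ k = z powr (\<delta> / 2)"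
    proof -
      have "(z powr \<epsilon>) ^ k = z powr (\<epsilon> * real k)"
        using z by (simp flip: powr_realpow add: powr_powr)
      then show ?thesis unfolding \<epsilon>(2) .
    qed
    also have "z powr (\<delta> / 2) * z powr (\<delta> / 2) = z powr \<delta>" by (simp flip: powr_add)
    finally have cE: "real (card E) \<le> z powr \<delta>" .
    show "\<exists>E::nat set. finite E \<and> real (card E) \<le> z powr \<delta> \<and>
         (\<forall>p. Factorial_Ring.prime p \<and> real p \<le> z \<and> p \<notin> E \<longrightarrow>
           (\<forall>f \<in> carrier (UP2 (Fp p)).
              total_degree (Fp p) f \<le> d \<and>
              \<not> (\<exists>g \<in> binomials (Fp_bar p).
                    g divides\<^bsub>UP2 (Fp_bar p)\<^esub> base_change (Fp p) (Fp_incl p) f) \<longrightarrow>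
              (\<exists>S. finite S \<and> card S \<le> 11 * d ^ 3 + d \<and>
                 (\<forall>x \<in> carrier (Multiplicative_Group.mult_of (Fp_bar p)). \<forall>y \<in> carrier (Multiplicative_Group.mult_of (Fp_bar p)).
                    eval2 (Fp_bar p) (base_change (Fp p) (Fp_incl p) f) x y = \<zero>\<^bsub>Fp_bar p\<^esub> \<and>
                    (x, y) \<notin> S \<longrightarrow>
                    real (mult_ord (Fp_bar p) x + mult_ord (Fp_bar p) y) \<ge> real p powr \<epsilon>))))"
    proof (intro exI[of _ E] conjI E(1) cE allI impI ballI)
      fix p f
      assume p: "Factorial_Ring.prime p \<and> real p \<le> z \<and> p \<notin> E" and f: "f \<in> carrier (UP2 (Fp p))"
        and df: "total_degree (Fp p) f \<le> d \<and>
              \<not> (\<exists>g \<in> binomials (Fp_bar p).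
                    g divides\<^bsub>UP2 (Fp_bar p)\<^esub> base_change (Fp p) (Fp_incl p) f)"
      have pp: "Factorial_Ring.prime p" using p by blast
      interpret F: field "Fp p" by (rule field_Fp[OF pp])
      interpret K: field "Fp_bar p" by (rule field_Fp_bar[OF pp])
      note h = algebraic_closure_Fp_bar(2)[OF pp]
      define g where "g = base_change (Fp p) (Fp_incl p) f"
      have g: "g \<in> carrier (UP2 (Fp_bar p))"
        unfolding g_def by (rule base_change_closed(1)[OF F.cring_axioms K.cring_axioms h f])
      have gd: "coeff2 (Fp_bar p) g i j = \<zero>\<^bsub>Fp_bar p\<^esub>" if "i + j > d" for i j
      proof -
        interpret h: ring_hom_ring "Fp p" "Fp_bar p" "Fp_incl p"
          by (intro ring_hom_ring.intro F.ring_axioms K.ring_axioms ring_hom_ring_axioms.intro h)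
        have "total_degree (Fp p) f < i + j" using df that by simp
        then show ?thesis
          unfolding g_def base_change_closed(2)[OF F.cring_axioms K.cring_axioms h f]
          using coeff2_total_degree[OF f] by simp
      qed
      have nb: "\<not> (\<exists>q \<in> binomials (Fp_bar p). q divides\<^bsub>UP2 (Fp_bar p)\<^esub> g)"
        using df unfolding g_def by blast
      have nz: "\<exists>u\<in>tri d. coeff2 (Fp_bar p) g (fst u) (snd u) \<noteq> \<zero>\<^bsub>Fp_bar p\<^esub>"
        by (rule K.nonzero_coeff_of_no_binomial[OF g gd nb])
      \<comment> \<open>The exceptional set S of the statement: no N-element subset can exist, so it
        is finite and has fewer than N elements.\<close>
      define Low where "Low = {(x, y). x \<in> carrier (Multiplicative_Group.mult_of (Fp_bar p)) \<and>
        y \<in> carrier (Multiplicative_Group.mult_of (Fp_bar p)) \<and> eval2 (Fp_bar p) g x y = \<zero>\<^bsub>Fp_bar p\<^esub> \<and>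
        real (mult_ord (Fp_bar p) x + mult_ord (Fp_bar p) y) < real p powr \<epsilon>}"
      have no: False if S: "S \<subseteq> Low" "finite S" "card S = N" for S
      proof (rule K.low_order_zeros_contradiction[OF pp ring_int_Fp_bar[OF pp] N g gd nz nb _ S(2,3)])
        show "d < i + j \<Longrightarrow> d < i + j" for i j .
      next
        fix n es
        assume n: "0 < n" "n \<le> L ^ (2 * N)" "\<And>i. i < N \<Longrightarrow> fst (es i) < n \<and> snd (es i) < n"
          "int_eval (gram_poly d N n es) (zeta n) \<noteq> 0"
        show "\<exists>r. norm_certificate n (gram_poly d N n es) r \<and> \<not> int p dvd r"
          using Ep[of n es] n p by blast
      next
        fix x y assume "(x, y) \<in> S"
        then have xy: "(x, y) \<in> Low" using S(1) by blast
        then show "x \<in> carrier (Multiplicative_Group.mult_of (Fp_bar p)) \<and>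
            y \<in> carrier (Multiplicative_Group.mult_of (Fp_bar p)) \<and> eval2 (Fp_bar p) g x y = \<zero>\<^bsub>Fp_bar p\<^esub>"
          unfolding Low_def by blast
        have "real (mult_ord (Fp_bar p) x + mult_ord (Fp_bar p) y) < real p powr \<epsilon>"
          using xy unfolding Low_def by blast
        also have "\<dots> \<le> z powr \<epsilon>" using p \<epsilon>(1) by (intro powr_mono2) auto
        finally have "mult_ord (Fp_bar p) x + mult_ord (Fp_bar p) y \<le> L"
          unfolding L_def by (simp add: le_nat_floor)
        moreover have "0 < mult_ord (Fp_bar p) x" "0 < mult_ord (Fp_bar p) y"
          using xy mult_ord_Fp_bar_pos[OF pp] unfolding Low_def by blast+
        ultimately show "0 < mult_ord (Fp_bar p) x \<and> mult_ord (Fp_bar p) x \<le> L \<and>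
            0 < mult_ord (Fp_bar p) y \<and> mult_ord (Fp_bar p) y \<le> L" by linarith
      qed
      have fin: "finite Low"
      proof (rule ccontr)
        assume "infinite Low"
        then show False using infinite_arbitrarily_large[of Low N] no by blast
      qed
      have card: "card Low \<le> 11 * d ^ 3 + d"
      proof (rule ccontr)
        assume "\<not> card Low \<le> 11 * d ^ 3 + d"
        then have "N \<le> card Low" unfolding N_def by simp
        then show False using no by (metis obtain_subset_with_card_n)
      qed
      show "\<exists>S. finite S \<and> card S \<le> 11 * d ^ 3 + d \<and>
                 (\<forall>x \<in> carrier (Multiplicative_Group.mult_of (Fp_bar p)). \<forall>y \<in> carrier (Multiplicative_Group.mult_of (Fp_bar p)).
                    eval2 (Fp_bar p) (base_change (Fp p) (Fp_incl p) f) x y = \<zero>\<^bsub>Fp_bar p\<^esub> \<and>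
                    (x, y) \<notin> S \<longrightarrow>
                    real (mult_ord (Fp_bar p) x + mult_ord (Fp_bar p) y) \<ge> real p powr \<epsilon>)"
        unfolding g_def[symmetric]
      proof (intro exI[of _ Low] conjI fin card ballI impI)
        fix x y
        assume "x \<in> carrier (Multiplicative_Group.mult_of (Fp_bar p))"
          "y \<in> carrier (Multiplicative_Group.mult_of (Fp_bar p))"
          "eval2 (Fp_bar p) g x y = \<zero>\<^bsub>Fp_bar p\<^esub> \<and> (x, y) \<notin> Low"
        then show "real (mult_ord (Fp_bar p) x + mult_ord (Fp_bar p) y) \<ge> real p powr \<epsilon>"
          unfolding Low_def by force
      qed
    qed
  qed
qed

end
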